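(* Let $\Gamma\subseteq G$ be a lattice in a second countable unimodular locally compact group $G$. Let $(\pi,\mathcal{H}_\pi)$ be a discrete series $\sigma$-representation of $G$ of formal dimension $d_\pi>0$. Suppose that $(\Gamma,\sigma)$ satisfies Kleppner's condition. Then the following assertions hold: (i) If $\mathrm{vol}(G/\Gamma)\,d_\pi<1$, then there exists $g\in\mathcal{H}_\pi$ such that $\pi(\Gamma)g$ is a Parseval frame for $\mathcal{H}_\pi$, but $\pi(\Gamma)''$ does not admit a separating vector. (In particular, there is no $g \in \mathcal{H}_\pi$ such that $\pi(\Gamma)g$ is a Riesz sequence.) (ii) If $\mathrm{vol}(G/\Gamma)\,d_\pi=1$, then there exists $g\in\mathcal{H}_\pi$ such that $\pi(\Gamma)g$ is an orthonormal basis of $\mathcal{H}_\pi$. (iii) If $\mathrm{vol}(G/\Gamma)\,d_\pi>1$, then there exists $g\in\mathcal{H}_\pi$ such that $\pi(\Gamma)g$ is an orthonormal sequence in $\mathcal{H}_\pi$, but $\pi|_\Gamma$ does not admit a cyclic vector. (In particular, there is no $g\in\mathcal{H}_\pi$ such that $\pi(\Gamma)g$ is a frame for $\mathcal{H}_\pi$.)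
   Context: Fix a Haar measure $\mu_G$ on $G$. A cocycle on $G$ is a Borel function $\sigma:G\times G\to\mathbb{T}$ with $\sigma(x,yz)\sigma(y,z)=\sigma(xy,z)\sigma(x,y)$ and $\sigma(x,e)=\sigma(e,x)=1$ for all $x,y,z\in G$. A $\sigma$-representation of $G$ is a map $\pi$ from $G$ to the unitary operators of a complex separable Hilbert space $\mathcal{H}_\pi$ with $\pi(e)=I$, $\pi(x)\pi(y)=\sigma(x,y)\pi(xy)$ for all $x,y\in G$, and $x\mapsto\langle\pi(x)f,g\rangle$ Borel for all $f,g\in\mathcal{H}_\pi$. It is irreducible if $\mathcal{H}_\pi\ne\{0\}$ and the only closed $\pi(G)$-invariant subspaces are $\{0\}$ and $\mathcal{H}_\pi$; it is square-integrable if there is a norm dense subspace $\mathcal{D}\subset\mathcal{H}_\pi$ with $\langle f,\pi(\cdot)g\rangle\in L^2(G)$ for all $f\in\mathcal{H}_\pi$, $g\in\mathcal{D}$. A discrete series $\sigma$-representation is an irreducible and square-integrable one. Inner products are linear in the first argument. Formal dimension: the unique number $d_\pi>0$ such that $\int_G\langle\pi(x)f_1,g_1\rangle\overline{\langle\pi(x)f_2,g_2\rangle}\,d\mu_G(x)=d_\pi^{-1}\langle f_1,f_2\rangle\overline{\langle g_1,g_2\rangle}$ for all $f_1,f_2,g_1,g_2\in\mathcal{H}_\pi$. Lattice: a discrete subgroup $\Gamma\subset G$ admitting a right fundamental domain of finite measure, i.e., a Borel set $\Omega\subset G$ with $\mu_G(\Omega)<\infty$, $G=\Omega\cdot\Gamma$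 and $\Omega\gamma\cap\Omega\gamma'=\emptyset$ for distinct $\gamma,\gamma'\in\Gamma$. The co-volume is $\mathrm{vol}(G/\Gamma):=\mu_G(\Omega)$ (independent of $\Omega$). Kleppner's condition for $(\Gamma,\sigma)$ (with $\sigma$ restricted to $\Gamma\times\Gamma$): an element $\gamma_0\in\Gamma$ is $\sigma$-regular if $\sigma(\gamma_0,\gamma)=\sigma(\gamma,\gamma_0)$ for all $\gamma\in\Gamma$ commuting with $\gamma_0$; the condition is that the conjugacy class $\{\gamma\gamma_0\gamma^{-1}:\gamma\in\Gamma\}$ of every $\sigma$-regular $\gamma_0\in\Gamma\setminus\{e\}$ is infinite. For $g\in\mathcal{H}_\pi$, $\pi(\Gamma)g=(\pi(\gamma)g)_{\gamma\in\Gamma}$ is regarded as a family indexed by $\Gamma$ (repetitions allowed); "orthonormal" refers to this indexed family. It is a frame for $\mathcal{H}_\pi$ if there are $A,B>0$ with $A\|f\|^2\le\sum_{\gamma\in\Gamma}|\langle f,\pi(\gamma)g\rangle|^2\le B\|f\|^2$ for all $f\in\mathcal{H}_\pi$, and a Parseval frame if one can take $A=B=1$. It is a Riesz sequence if there are $A,B>0$ with $A\|c\|_{\ell^2}^2\le\|\sum_{\gamma\in\Gamma}c_\gamma\pi(\gamma)g\|^2\le B\|c\|_{\ell^2}^2$ for all $c\in\ell^2(\Gamma)$. The vector $g$ is cyclic for $\pi|_\Gamma$ if the closed linear span of $\pi(\Gamma)g$ is $\mathcal{H}_\pi$. For $M\subset\mathcal{B}(\mathcal{H}_\pi)$, $M'$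 is the commutant and $M''=(M')'$. A vector $g$ is separating for $\pi(\Gamma)''$ if $T\in\pi(\Gamma)''$ and $Tg=0$ imply $T=0$. *)

theory Defs
  imports "HOL-Analysis.Analysis"
begin

section \<open>Complex Hilbert spaces\<close>

text \<open>The norm, metric and topology (and completeness) come from the library class
  \<open>banach\<close>; the inner product is linear in its first argument. Separability is
  the additional sort \<open>second_countable_topology\<close>, as for Polish spaces in the library.\<close>

class chilbert_space = banach +
  fixes scaleC :: "complex \<Rightarrow> 'a \<Rightarrow> 'a"  (infixr \<open>*\<^sub>C\<close> 75)
    and cinner :: "'a \<Rightarrow> 'a \<Rightarrow> complex"
  assumes scaleC_add_right: "a *\<^sub>C (x + y) = a *\<^sub>C x + a *\<^sub>C y"
    and scaleC_add_left: "(a + b) *\<^sub>C x = a *\<^sub>C x + b *\<^sub>C x"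
    and scaleC_scaleC: "a *\<^sub>C (b *\<^sub>C x) = (a * b) *\<^sub>C x"
    and scaleC_one: "1 *\<^sub>C x = x"
    and scaleR_scaleC: "r *\<^sub>R x = complex_of_real r *\<^sub>C x"
    and cinner_commute: "cinner x y = cnj (cinner y x)"
    and cinner_add_left: "cinner (x + y) z = cinner x z + cinner y z"
    and cinner_scaleC_left: "cinner (a *\<^sub>C x) y = a * cinner x y"
    and cinner_self: "cinner x x = complex_of_real ((norm x)\<^sup>2)"

instantiation complex :: chilbert_space
begin
definition scaleC_complex :: "complex \<Rightarrow> complex \<Rightarrow> complex" where "scaleC_complex a x = a * x"
definition cinner_complex :: "complex \<Rightarrow> complex \<Rightarrow> complex" where "cinner_complex x y = x * cnj y"
instance
  by standard
    (simp_all add: scaleC_complex_def cinner_complex_def algebra_simps scaleR_conv_of_real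
      complex_norm_square del: of_real_power)
end

global_interpretation complex_vector: vector_space "scaleC :: complex \<Rightarrow> 'h \<Rightarrow> 'h::chilbert_space"
  defines csubspace = complex_vector.subspace
    and cspan = complex_vector.span
  by standard (simp_all add: scaleC_add_right scaleC_add_left scaleC_scaleC scaleC_one)

abbreviation clinear :: "('h::chilbert_space \<Rightarrow> 'h) \<Rightarrow> bool" where
  "clinear \<equiv> Vector_Spaces.linear scaleC scaleC"

definition bounded_clinear :: "('h::chilbert_space \<Rightarrow> 'h) \<Rightarrow> bool" where
  "bounded_clinear T \<longleftrightarrow> clinear T \<and> bounded_linear T"

definition unitary_operator :: "('h::chilbert_space \<Rightarrow> 'h) \<Rightarrow> bool" where
  "unitary_operator U \<longleftrightarrow> clinear U \<and> surj U \<and> (\<forall>f g. cinner (U f) (U g) = cinner f g)"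

definition commutant :: "('h::chilbert_space \<Rightarrow> 'h) set \<Rightarrow> ('h \<Rightarrow> 'h) set" where
  "commutant M = {T. bounded_clinear T \<and> (\<forall>S\<in>M. T \<circ> S = S \<circ> T)}"

definition separating_vector :: "('h::chilbert_space \<Rightarrow> 'h) set \<Rightarrow> 'h \<Rightarrow> bool" where
  "separating_vector N g \<longleftrightarrow> (\<forall>T\<in>N. T g = 0 \<longrightarrow> T = (\<lambda>f. 0))"


section \<open>Haar measures, lattices and co-volume\<close>

text \<open>Topological groups are taken from the library class \<open>topological_group_add\<close>, which
  writes the group law additively but does \<^emph>\<open>not\<close> assume it to be commutative. Thus
  \<open>x + y\<close>, \<open>0\<close> and \<open>- x\<close> stand for the product \<open>xy\<close>, the identity \<open>e\<close> and the inverse of \<open>x\<close>,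
  and \<open>x + y - x\<close> is the conjugate of \<open>y\<close> by \<open>x\<close>.\<close>

definition radon_measure :: "'g::topological_space measure \<Rightarrow> bool" where
  "radon_measure \<mu> \<longleftrightarrow> sets \<mu> = sets borel
    \<and> (\<forall>K. compact K \<longrightarrow> emeasure \<mu> K < \<infinity>)
    \<and> (\<forall>A\<in>sets borel. emeasure \<mu> A = (INF U\<in>{U. open U \<and> A \<subseteq> U}. emeasure \<mu> U))
    \<and> (\<forall>U. open U \<longrightarrow> emeasure \<mu> U = (SUP K\<in>{K. compact K \<and> K \<subseteq> U}. emeasure \<mu> K))"

definition left_invariant :: "'g::topological_group_add measure \<Rightarrow> bool" where
  "left_invariant \<mu> \<longleftrightarrow> (\<forall>x. \<forall>A\<in>sets borel. emeasure \<mu> ((\<lambda>y. x + y) ` A) = emeasure \<mu> A)"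

definition right_invariant :: "'g::topological_group_add measure \<Rightarrow> bool" where
  "right_invariant \<mu> \<longleftrightarrow> (\<forall>x. \<forall>A\<in>sets borel. emeasure \<mu> ((\<lambda>y. y + x) ` A) = emeasure \<mu> A)"

definition haar_measure :: "'g::topological_group_add measure \<Rightarrow> bool" where
  "haar_measure \<mu> \<longleftrightarrow> radon_measure \<mu> \<and> left_invariant \<mu> \<and> emeasure \<mu> UNIV \<noteq> 0"

definition unimodular :: "'g::topological_group_add itself \<Rightarrow> bool" where
  "unimodular (G :: 'g itself) \<longleftrightarrow>
     (\<forall>\<mu> :: 'g measure. haar_measure \<mu> \<longrightarrow> right_invariant \<mu>)"

definition is_subgroup :: "'g::group_add set \<Rightarrow> bool" where
  "is_subgroup \<Gamma> \<longleftrightarrow> 0 \<in> \<Gamma> \<and> (\<forall>x\<in>\<Gamma>. \<forall>y\<in>\<Gamma>. x + y \<in> \<Gamma>) \<and> (\<forall>x\<in>\<Gamma>. - x \<in> \<Gamma>)"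

definition fundamental_domain ::
    "'g::topological_group_add measure \<Rightarrow> 'g set \<Rightarrow> 'g set \<Rightarrow> bool" where
  "fundamental_domain \<mu> \<Gamma> \<Omega> \<longleftrightarrow> \<Omega> \<in> sets borel \<and> emeasure \<mu> \<Omega> < \<infinity>
    \<and> {\<omega> + \<gamma> | \<omega> \<gamma>. \<omega> \<in> \<Omega> \<and> \<gamma> \<in> \<Gamma>} = UNIV
    \<and> (\<forall>\<gamma>\<in>\<Gamma>. \<forall>\<gamma>'\<in>\<Gamma>. \<gamma> \<noteq> \<gamma>' \<longrightarrow> (\<lambda>\<omega>. \<omega> + \<gamma>) ` \<Omega> \<inter> (\<lambda>\<omega>. \<omega> + \<gamma>') ` \<Omega> = {})"

definition lattice_in :: "'g::topological_group_add measure \<Rightarrow> 'g set \<Rightarrow> bool" where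
  "lattice_in \<mu> \<Gamma> \<longleftrightarrow> is_subgroup \<Gamma> \<and> discrete \<Gamma> \<and> (\<exists>\<Omega>. fundamental_domain \<mu> \<Gamma> \<Omega>)"

definition covolume :: "'g::topological_group_add measure \<Rightarrow> 'g set \<Rightarrow> real" where
  "covolume \<mu> \<Gamma> = (THE v. \<exists>\<Omega>. fundamental_domain \<mu> \<Gamma> \<Omega> \<and> v = measure \<mu> \<Omega>)"


section \<open>Cocycles and projective representations\<close>

definition cocycle :: "('g::topological_group_add \<Rightarrow> 'g \<Rightarrow> complex) \<Rightarrow> bool" where
  "cocycle \<sigma> \<longleftrightarrow> (\<lambda>(x, y). \<sigma> x y) \<in> borel_measurable borel
    \<and> (\<forall>x y. cmod (\<sigma> x y) = 1)
    \<and> (\<forall>x y z. \<sigma> x (y + z) * \<sigma> y z = \<sigma> (x + y) z * \<sigma> x y)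
    \<and> (\<forall>x. \<sigma> x 0 = 1 \<and> \<sigma> 0 x = 1)"

definition kleppner_condition :: "('g::group_add \<Rightarrow> 'g \<Rightarrow> complex) \<Rightarrow> 'g set \<Rightarrow> bool" where
  "kleppner_condition \<sigma> \<Gamma> \<longleftrightarrow>
    (\<forall>\<gamma>\<^sub>0\<in>\<Gamma> - {0}.
       (\<forall>\<gamma>\<in>\<Gamma>. \<gamma> + \<gamma>\<^sub>0 = \<gamma>\<^sub>0 + \<gamma> \<longrightarrow> \<sigma> \<gamma>\<^sub>0 \<gamma> = \<sigma> \<gamma> \<gamma>\<^sub>0)
       \<longrightarrow> infinite {\<gamma> + \<gamma>\<^sub>0 - \<gamma> | \<gamma>. \<gamma> \<in> \<Gamma>})"

definition projective_rep ::
    "('g::topological_group_add \<Rightarrow> 'g \<Rightarrow> complex)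
      \<Rightarrow> ('g \<Rightarrow> 'h \<Rightarrow> 'h::{chilbert_space, second_countable_topology}) \<Rightarrow> bool" where
  "projective_rep \<sigma> \<pi> \<longleftrightarrow> (\<forall>x. unitary_operator (\<pi> x)) \<and> \<pi> 0 = id
    \<and> (\<forall>x y f. \<pi> x (\<pi> y f) = \<sigma> x y *\<^sub>C \<pi> (x + y) f)
    \<and> (\<forall>f g. (\<lambda>x. cinner (\<pi> x f) g) \<in> borel_measurable borel)"

definition irreducible_rep :: "('g \<Rightarrow> 'h \<Rightarrow> 'h::chilbert_space) \<Rightarrow> bool" where
  "irreducible_rep \<pi> \<longleftrightarrow> (UNIV :: 'h set) \<noteq> {0}
    \<and> (\<forall>V. csubspace V \<and> closed V \<and> (\<forall>x. \<pi> x ` V \<subseteq> V) \<longrightarrow> V = {0} \<or> V = UNIV)"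

definition square_integrable :: "'g measure \<Rightarrow> ('g \<Rightarrow> complex) \<Rightarrow> bool" where
  "square_integrable \<mu> F \<longleftrightarrow> F \<in> borel_measurable \<mu> \<and> integrable \<mu> (\<lambda>x. (cmod (F x))\<^sup>2)"

definition square_integrable_rep :: "'g measure \<Rightarrow> ('g \<Rightarrow> 'h \<Rightarrow> 'h::chilbert_space) \<Rightarrow> bool" where
  "square_integrable_rep \<mu> \<pi> \<longleftrightarrow>
    (\<exists>D. csubspace D \<and> closure D = UNIV
       \<and> (\<forall>f. \<forall>g\<in>D. square_integrable \<mu> (\<lambda>x. cinner f (\<pi> x g))))"

definition discrete_series_rep ::
    "'g::topological_group_add measure \<Rightarrow> ('g \<Rightarrow> 'g \<Rightarrow> complex)
      \<Rightarrow> ('g \<Rightarrow> 'h \<Rightarrow> 'h::{chilbert_space, second_countable_topology}) \<Rightarrow> bool" where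
  "discrete_series_rep \<mu> \<sigma> \<pi> \<longleftrightarrow>
    projective_rep \<sigma> \<pi> \<and> irreducible_rep \<pi> \<and> square_integrable_rep \<mu> \<pi>"

definition formal_dimension :: "'g measure \<Rightarrow> ('g \<Rightarrow> 'h \<Rightarrow> 'h::chilbert_space) \<Rightarrow> real \<Rightarrow> bool" where
  "formal_dimension \<mu> \<pi> d \<longleftrightarrow> d > 0
    \<and> (\<forall>f\<^sub>1 f\<^sub>2 g\<^sub>1 g\<^sub>2.
         has_bochner_integral \<mu> (\<lambda>x. cinner (\<pi> x f\<^sub>1) g\<^sub>1 * cnj (cinner (\<pi> x f\<^sub>2) g\<^sub>2))
           (complex_of_real (inverse d) * cinner f\<^sub>1 f\<^sub>2 * cnj (cinner g\<^sub>1 g\<^sub>2)))"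


section \<open>Orbits of the lattice\<close>

text \<open>All notions below concern the family \<open>\<pi> \<gamma> g\<close> indexed by \<open>\<gamma> \<in> \<Gamma>\<close>, not its set of values.\<close>

definition frame_bounds ::
    "('g \<Rightarrow> 'h \<Rightarrow> 'h::chilbert_space) \<Rightarrow> 'g set \<Rightarrow> 'h \<Rightarrow> real \<Rightarrow> real \<Rightarrow> bool" where
  "frame_bounds \<pi> \<Gamma> g A B \<longleftrightarrow>
    (\<forall>f. (\<lambda>\<gamma>. (cmod (cinner f (\<pi> \<gamma> g)))\<^sup>2) summable_on \<Gamma>
       \<and> A * (norm f)\<^sup>2 \<le> (\<Sum>\<^sub>\<infinity>\<gamma>\<in>\<Gamma>. (cmod (cinner f (\<pi> \<gamma> g)))\<^sup>2)
       \<and> (\<Sum>\<^sub>\<infinity>\<gamma>\<in>\<Gamma>. (cmod (cinner f (\<pi> \<gamma> g)))\<^sup>2) \<le> B * (norm f)\<^sup>2)"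

definition frame :: "('g \<Rightarrow> 'h \<Rightarrow> 'h::chilbert_space) \<Rightarrow> 'g set \<Rightarrow> 'h \<Rightarrow> bool" where
  "frame \<pi> \<Gamma> g \<longleftrightarrow> (\<exists>A>0. \<exists>B>0. frame_bounds \<pi> \<Gamma> g A B)"

definition parseval_frame :: "('g \<Rightarrow> 'h \<Rightarrow> 'h::chilbert_space) \<Rightarrow> 'g set \<Rightarrow> 'h \<Rightarrow> bool" where
  "parseval_frame \<pi> \<Gamma> g \<longleftrightarrow> frame_bounds \<pi> \<Gamma> g 1 1"

definition riesz_sequence :: "('g \<Rightarrow> 'h \<Rightarrow> 'h::chilbert_space) \<Rightarrow> 'g set \<Rightarrow> 'h \<Rightarrow> bool" where
  "riesz_sequence \<pi> \<Gamma> g \<longleftrightarrow>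
    (\<exists>A>0. \<exists>B>0. \<forall>c :: 'g \<Rightarrow> complex. (\<lambda>\<gamma>. (cmod (c \<gamma>))\<^sup>2) summable_on \<Gamma> \<longrightarrow>
       (\<lambda>\<gamma>. c \<gamma> *\<^sub>C \<pi> \<gamma> g) summable_on \<Gamma>
       \<and> A * (\<Sum>\<^sub>\<infinity>\<gamma>\<in>\<Gamma>. (cmod (c \<gamma>))\<^sup>2) \<le> (norm (\<Sum>\<^sub>\<infinity>\<gamma>\<in>\<Gamma>. c \<gamma> *\<^sub>C \<pi> \<gamma> g))\<^sup>2
       \<and> (norm (\<Sum>\<^sub>\<infinity>\<gamma>\<in>\<Gamma>. c \<gamma> *\<^sub>C \<pi> \<gamma> g))\<^sup>2 \<le> B * (\<Sum>\<^sub>\<infinity>\<gamma>\<in>\<Gamma>. (cmod (c \<gamma>))\<^sup>2))"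

definition cyclic_vector :: "('g \<Rightarrow> 'h \<Rightarrow> 'h::chilbert_space) \<Rightarrow> 'g set \<Rightarrow> 'h \<Rightarrow> bool" where
  "cyclic_vector \<pi> \<Gamma> g \<longleftrightarrow> closure (cspan ((\<lambda>\<gamma>. \<pi> \<gamma> g) ` \<Gamma>)) = UNIV"

definition orthonormal_system :: "('g \<Rightarrow> 'h \<Rightarrow> 'h::chilbert_space) \<Rightarrow> 'g set \<Rightarrow> 'h \<Rightarrow> bool" where
  "orthonormal_system \<pi> \<Gamma> g \<longleftrightarrow>
    (\<forall>\<gamma>\<in>\<Gamma>. \<forall>\<gamma>'\<in>\<Gamma>. cinner (\<pi> \<gamma> g) (\<pi> \<gamma>' g) = (if \<gamma> = \<gamma>' then 1 else 0))"

definition orthonormal_basis :: "('g \<Rightarrow> 'h \<Rightarrow> 'h::chilbert_space) \<Rightarrow> 'g set \<Rightarrow> 'h \<Rightarrow> bool" where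
  "orthonormal_basis \<pi> \<Gamma> g \<longleftrightarrow>
    orthonormal_system \<pi> \<Gamma> g \<and> closure (cspan ((\<lambda>\<gamma>. \<pi> \<gamma> g) ` \<Gamma>)) = UNIV"

end

theory Submission
  imports Defs
begin

text \<open>Call \<open>h\<close> a Bessel vector if \<open>f \<mapsto> (\<langle>f, \<pi> \<gamma> h\<rangle>)\<^sub>\<gamma>\<close> is a bounded map from the
  Hilbert space to \<open>\<ell>\<^sup>2(\<Gamma>)\<close>. Given any \<open>k\<close>, choose an extreme point \<open>u\<close> of the convex,
  weakly compact set of Bessel vectors of bound \<open>1\<close> that maximizes \<open>Re \<langle>u, k\<rangle>\<close>; it plays the role
  of the polar part of \<open>k\<close>. As for extreme points of the unit ball of a von Neumann algebra, its
  frame operator \<open>X\<close> is a projection, and by Kleppner's condition (the twisted group von Neumann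
  algebra is a factor) either \<open>X = 1\<close>, so that \<open>\<pi>(\<Gamma>)u\<close> is a Parseval frame, or \<open>\<pi>(\<Gamma>)u\<close> is
  orthonormal. Unfolding the orthogonality relations over a fundamental domain \<open>\<Omega>\<close> gives
  \<open>\<parallel>u\<parallel>\<^sup>2 \<le> \<mu>(\<Omega>) d\<close> with equality iff \<open>X = 1\<close>, so the value of \<open>\<mu>(\<Omega>) d\<close> decides between the two
  cases. First-order optimality of \<open>u\<close> forces \<open>X = 1\<close> if \<open>k\<close> is cyclic, and \<open>\<parallel>u\<parallel> = 1\<close> if \<open>k\<close> is
  separating or generates a Riesz sequence.\<close>

section \<open>Complex Hilbert spaces\<close>

text \<open>Everything is phrased by vectors. A Bessel vector h stands for its bounded intertwiner
  \<open>coef h\<close> into \<open>ell2\<close>, and \<open>pairing h u\<close>, which is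
  \<open>coef h\<close> followed by the adjoint of \<open>coef u\<close>, lies in the commutant of
  \<pi>(\<Gamma>). With P the composition of \<open>coef u\<close> with its adjoint, the squared
  norm of u is the coordinate at 0 of P applied to \<open>ell2_delta 0\<close>; it takes the place
  of a trace. Extremality does the work of functional calculus and of the comparison of projections:
  perturbing u by a polynomial in X applied to u makes X a projection, and perturbing it in the
  corner cut out by 1 - P and 1 - X shows that this corner is zero. Kleppner's condition enters
  through a fixed point of twisted conjugation on \<open>ell2\<close>. The obstacle is to have
  enough Bessel vectors: square integrability over G does not make a given vector Bessel, so they
  are produced by integrating over \<Omega>.\<close>

lemma cinner_add_right: "cinner x (y + z) = cinner x y + cinner x z"
  by (subst (1 2 3) cinner_commute) (simp add: cinner_add_left)

lemma cinner_scaleC_right: "cinner x (a *\<^sub>C y) = cnj a * cinner x y"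
  by (subst (1 2) cinner_commute) (simp add: cinner_scaleC_left)

lemma scaleC_minus1: "(-1) *\<^sub>C x = - (x::'a::chilbert_space)"
  using scaleR_scaleC[of "-1" x] by simp

lemma scaleC_zero_left [simp]: "0 *\<^sub>C x = (0::'a::chilbert_space)"
  by (rule complex_vector.scale_zero_left)

lemma scaleC_zero_right [simp]: "a *\<^sub>C 0 = (0::'a::chilbert_space)"
  by (rule complex_vector.scale_zero_right)

lemma scaleC_one' [simp]: "1 *\<^sub>C x = (x::'a::chilbert_space)"
  by (rule scaleC_one)

lemma cinner_zero_left [simp]: "cinner 0 x = 0"
  using cinner_scaleC_left[of 0 0 x] by simp

lemma cinner_zero_right [simp]: "cinner x 0 = 0"
  using cinner_scaleC_right[of x 0 0] by simp

lemma cinner_minus_left: "cinner (- x) y = - cinner x y"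
  using cinner_scaleC_left[of "-1" x y] by (simp add: scaleC_minus1)

lemma cinner_minus_right: "cinner x (- y) = - cinner x y"
  using cinner_scaleC_right[of x "-1" y] by (simp add: scaleC_minus1)

lemma cinner_diff_left: "cinner (x - y) z = cinner x z - cinner y z"
  using cinner_add_left[of x "-y" z] by (simp add: cinner_minus_left)

lemma cinner_diff_right: "cinner x (y - z) = cinner x y - cinner x z"
  using cinner_add_right[of x y "-z"] by (simp add: cinner_minus_right)

lemma cinner_scaleR_left: "cinner (r *\<^sub>R x) y = of_real r * cinner x y"
  by (simp add: scaleR_scaleC cinner_scaleC_left)

lemma cinner_scaleR_right: "cinner x (r *\<^sub>R y) = of_real r * cinner x y"
  by (simp add: scaleR_scaleC cinner_scaleC_right)

lemmas cinner_simps = cinner_add_left cinner_add_right cinner_diff_left cinner_diff_right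
  cinner_minus_left cinner_minus_right cinner_scaleR_left cinner_scaleR_right
  cinner_scaleC_left cinner_scaleC_right

lemma cinner_sum_right: "cinner y (\<Sum>i\<in>A. f i) = (\<Sum>i\<in>A. cinner y (f i))"
  by (induction A rule: infinite_finite_induct) (auto simp: cinner_add_right)

lemma Re_cinner_self [simp]: "Re (cinner x x) = (norm x)\<^sup>2"
  by (simp add: cinner_self)

lemma Re_cinner_commute: "Re (cinner x y) = Re (cinner y x)"
  by (subst cinner_commute) simp

lemma cinner_eq_zero_commute: "cinner x y = 0 \<longleftrightarrow> cinner y x = 0"
  by (metis cinner_commute complex_cnj_zero)

lemma norm_add_sq: "(norm (x + y))\<^sup>2 = (norm x)\<^sup>2 + (norm y)\<^sup>2 + 2 * Re (cinner x y)"
proof -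
  have "(norm (x + y))\<^sup>2 = Re (cinner (x + y) (x + y))" by simp
  also have "\<dots> = (norm x)\<^sup>2 + (norm y)\<^sup>2 + Re (cinner x y) + Re (cinner y x)"
    by (simp only: cinner_simps plus_complex.simps Re_cinner_self)
  finally show ?thesis by (simp add: Re_cinner_commute)
qed

lemma norm_diff_sq: "(norm (x - y))\<^sup>2 = (norm x)\<^sup>2 + (norm y)\<^sup>2 - 2 * Re (cinner x y)"
  using norm_add_sq[of x "- y"] by (simp add: cinner_minus_right)

lemma norm_scaleC: "norm (a *\<^sub>C x) = cmod a * norm x"
proof -
  have "(norm (a *\<^sub>C x))\<^sup>2 = Re (a * cnj a * cinner x x)"
    by (simp only: Re_cinner_self[symmetric] cinner_simps mult_ac)
  also have "\<dots> = Re (complex_of_real ((cmod a)\<^sup>2 * (norm x)\<^sup>2))"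
    by (simp only: complex_norm_square[symmetric] cinner_self of_real_mult)
  also have "\<dots> = (cmod a * norm x)\<^sup>2"
    by (simp only: Re_complex_of_real power_mult_distrib)
  finally have "(norm (a *\<^sub>C x))\<^sup>2 = (cmod a * norm x)\<^sup>2" .
  then show ?thesis by (simp add: power2_eq_iff_nonneg)
qed

lemma cinner_eq_0_imp_0: "(\<And>f. cinner x f = 0) \<Longrightarrow> x = 0"
  using cinner_self[of x] by simp

lemma Re_cinner_le: "Re (cinner x y) \<le> norm x * norm y"
proof -
  \<comment> \<open>Both terms have norm \<open>norm x * norm y\<close>, so expanding the square
    gives Cauchy-Schwarz up to a nonnegative factor.\<close>
  have "0 \<le> (norm (norm y *\<^sub>R x - norm x *\<^sub>R y))\<^sup>2" by simp
  also have "\<dots> = 2 * (norm x * norm y) * (norm x * norm y - Re (cinner x y))"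
    unfolding norm_diff_sq by (simp add: cinner_simps power_mult_distrib algebra_simps power2_eq_square)
  finally have *: "0 \<le> 2 * (norm x * norm y) * (norm x * norm y - Re (cinner x y))" .
  show ?thesis
  proof (cases "norm x * norm y = 0")
    case True
    then show ?thesis by auto
  next
    case False
    then have "0 < 2 * (norm x * norm y)" by (simp add: less_le)
    with * show ?thesis by (simp add: zero_le_mult_iff)
  qed
qed

lemma norm_cinner_le: "cmod (cinner x y) \<le> norm x * norm y"
proof (cases "cinner x y = 0")
  case False
  \<comment> \<open>The phase that rotates the inner product onto the positive real axis, which
    reduces the claim to \<open>Re_cinner_le\<close>.\<close>
  define a where "a = cnj (cinner x y) / of_real (cmod (cinner x y))"
  have "cnj (cinner x y) * cinner x y = of_real (cmod (cinner x y)) * of_real (cmod (cinner x y))"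
    using complex_norm_square[of "cinner x y"] by (simp add: power2_eq_square mult.commute)
  then have "a * cinner x y = complex_of_real (cmod (cinner x y))"
    using False by (simp add: a_def)
  then have "cmod (cinner x y) = Re (a * cinner x y)" by simp
  also have "\<dots> = Re (cinner (a *\<^sub>C x) y)" by (simp add: cinner_simps)
  also have "\<dots> \<le> norm (a *\<^sub>C x) * norm y" by (rule Re_cinner_le)
  also have "\<dots> = norm x * norm y" using False by (simp add: norm_scaleC a_def norm_divide)
  finally show ?thesis .
qed simp

lemma bounded_bilinear_cinner: "bounded_bilinear cinner"
  by (rule bounded_bilinear.intro)
    (auto simp: cinner_simps scaleR_conv_of_real intro!: exI[of _ 1] norm_cinner_le)

lemma bounded_bilinear_scaleC: "bounded_bilinear (*\<^sub>C)"
proof (rule bounded_bilinear.intro)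
  show "(r *\<^sub>R a) *\<^sub>C b = r *\<^sub>R (a *\<^sub>C b)" for r a and b :: 'a
    by (simp add: scaleR_conv_of_real scaleR_scaleC[of r "a *\<^sub>C b"] scaleC_scaleC)
  show "a *\<^sub>C (r *\<^sub>R b) = r *\<^sub>R (a *\<^sub>C b)" for r a and b :: 'a
    by (simp add: scaleR_scaleC[of r] scaleC_scaleC mult.commute)
qed (auto simp: scaleC_add_left scaleC_add_right norm_scaleC intro!: exI[of _ 1])

lemmas tendsto_cinner [tendsto_intros] = bounded_bilinear.tendsto[OF bounded_bilinear_cinner]
lemmas continuous_on_cinner [continuous_intros] =
  bounded_bilinear.continuous_on[OF bounded_bilinear_cinner]
lemmas bounded_linear_cinner_left = bounded_bilinear.bounded_linear_left[OF bounded_bilinear_cinner]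
lemmas tendsto_scaleC [tendsto_intros] = bounded_bilinear.tendsto[OF bounded_bilinear_scaleC]

section \<open>Closed subspaces: projection, Riesz representation and adjoints\<close>

lemma csubspace_iff:
  "csubspace V \<longleftrightarrow> 0 \<in> V \<and> (\<forall>x\<in>V. \<forall>y\<in>V. x + y \<in> V) \<and> (\<forall>a. \<forall>x\<in>V. a *\<^sub>C x \<in> V)"
  by (simp add: complex_vector.subspace_def)

lemma csubspace_diff: "csubspace V \<Longrightarrow> x \<in> V \<Longrightarrow> y \<in> V \<Longrightarrow> x - y \<in> V"
  by (rule complex_vector.subspace_diff)

lemma csubspace_closure:
  fixes V :: "'a::chilbert_space set"
  assumes "csubspace V" shows "csubspace (closure V)"
  unfolding csubspace_iff
proof (intro conjI ballI allI)
  show "0 \<in> closure V" using assms closure_subset by (auto simp: csubspace_iff)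
next
  fix x y assume "x \<in> closure V" "y \<in> closure V"
  then obtain X Y where "\<And>n. X n \<in> V" "X \<longlonglongrightarrow> x" "\<And>n. Y n \<in> V" "Y \<longlonglongrightarrow> y"
    unfolding closure_sequential by blast
  then show "x + y \<in> closure V"
    unfolding closure_sequential using assms
    by (intro exI[of _ "\<lambda>n. X n + Y n"]) (auto simp: csubspace_iff intro!: tendsto_intros)
next
  fix a x assume "x \<in> closure V"
  then obtain X where "\<And>n. X n \<in> V" "X \<longlonglongrightarrow> x"
    unfolding closure_sequential by blast
  then show "a *\<^sub>C x \<in> closure V"
    unfolding closure_sequential using assms
    by (intro exI[of _ "\<lambda>n. a *\<^sub>C X n"]) (auto simp: csubspace_iff intro!: tendsto_intros)
qed

lemma closed_orthogonal: "closed {x. cinner x y = (0::complex)}"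
  by (intro closed_Collect_eq continuous_intros)

lemma closed_orthogonal': "closed {x. cinner y x = (0::complex)}"
  by (intro closed_Collect_eq continuous_intros)

lemma csubspace_closest_point:
  fixes V :: "'a::chilbert_space set"
  assumes V: "csubspace V" "closed V"
  obtains p where "p \<in> V" "\<And>v. v \<in> V \<Longrightarrow> norm (x - p) \<le> norm (x - v)"
proof -
  define D where "D = (INF v\<in>V. (norm (x - v))\<^sup>2)"
  have V0: "0 \<in> V" using V by (auto simp: csubspace_iff)
  have bdd: "bdd_below ((\<lambda>v. (norm (x - v))\<^sup>2) ` V)" by (rule bdd_belowI[of _ 0]) auto
  have D_le: "D \<le> (norm (x - v))\<^sup>2" if "v \<in> V" for v
    unfolding D_def by (rule cINF_lower[OF bdd that])
  have "\<exists>v\<in>V. (norm (x - v))\<^sup>2 < D + inverse (real (Suc n))" for n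
    using cINF_less_iff[OF _ bdd, of "D + inverse (real (Suc n))"] V0 by (auto simp: D_def)
  then obtain X where X: "\<And>n. X n \<in> V" "\<And>n. (norm (x - X n))\<^sup>2 < D + inverse (real (Suc n))"
    by metis
  have par: "(norm (X m - X n))\<^sup>2 \<le> 2 * inverse (real (Suc m)) + 2 * inverse (real (Suc n))" for m n
  proof -
    let ?c = "(1/2) *\<^sub>R (X m + X n)"
    have "?c \<in> V" using X V by (auto simp: csubspace_iff scaleR_scaleC)
    from D_le[OF this] have "4 * D \<le> (norm (2 *\<^sub>R (x - ?c)))\<^sup>2" by (simp add: power_mult_distrib)
    also have "2 *\<^sub>R (x - ?c) = (x - X m) + (x - X n)" by (simp add: algebra_simps scaleR_2)
    finally have 1: "4 * D \<le> (norm ((x - X m) + (x - X n)))\<^sup>2" .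
    have "(norm (X m - X n))\<^sup>2 = (norm ((x - X n) - (x - X m)))\<^sup>2" by simp
    also have "\<dots> = 2 * (norm (x - X m))\<^sup>2 + 2 * (norm (x - X n))\<^sup>2 - (norm ((x - X m) + (x - X n)))\<^sup>2"
      unfolding norm_diff_sq[of "x - X n" "x - X m"] norm_add_sq[of "x - X m" "x - X n"]
      by (simp add: Re_cinner_commute)
    finally show ?thesis using 1 X(2)[of m] X(2)[of n] by linarith
  qed
  have "Cauchy X"
  proof (rule metric_CauchyI)
    fix e :: real assume "e > 0"
    then have "0 < e\<^sup>2 / 4" by simp
    then obtain N where N: "inverse (real (Suc N)) < e\<^sup>2 / 4" using reals_Archimedean by blast
    have "dist (X m) (X n) < e" if "m \<ge> N" "n \<ge> N" for m n
    proof -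
      have "inverse (real (Suc m)) \<le> inverse (real (Suc N))" "inverse (real (Suc n)) \<le> inverse (real (Suc N))"
        using that by (auto intro!: le_imp_inverse_le)
      with par[of m n] N have "(norm (X m - X n))\<^sup>2 < e\<^sup>2" by linarith
      then show ?thesis using \<open>e > 0\<close> by (simp add: dist_norm power_less_imp_less_base)
    qed
    then show "\<exists>M. \<forall>m\<ge>M. \<forall>n\<ge>M. dist (X m) (X n) < e" by blast
  qed
  then obtain p where p: "X \<longlonglongrightarrow> p" using Cauchy_convergent_iff convergent_def by blast
  have "p \<in> V" using V(2) X(1) p closed_sequentially by blast
  moreover have "norm (x - p) \<le> norm (x - v)" if "v \<in> V" for v
  proof -
    have "(\<lambda>n. (norm (x - X n))\<^sup>2) \<longlonglongrightarrow> (norm (x - p))\<^sup>2" using p by (intro tendsto_intros)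
    moreover have "(\<lambda>n. D + inverse (real (Suc n))) \<longlonglongrightarrow> D"
      using tendsto_add[OF tendsto_const LIMSEQ_inverse_real_of_nat, of D] by simp
    ultimately have "(norm (x - p))\<^sup>2 \<le> D"
      using X(2) by (blast intro: LIMSEQ_le less_imp_le)
    with D_le[OF that] have "(norm (x - p))\<^sup>2 \<le> (norm (x - v))\<^sup>2" by linarith
    then show ?thesis by (rule power2_le_imp_le) simp
  qed
  ultimately show thesis using that by blast
qed

lemma linear_le_quadratic_imp_zero:
  fixes b K :: real
  assumes le: "\<And>t. t * b \<le> t\<^sup>2 * K" and "K \<ge> 0"
  shows "b = 0"
proof -
  have K: "K + 1 > 0" using assms by simp
  \<comment> \<open>The test value is t = b / (K + 1). Taking K + 1 instead of K keeps the
    denominator positive and leaves the margin that forces b to vanish.\<close>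
  have "b\<^sup>2 / (K + 1) \<le> b\<^sup>2 * K / (K + 1)\<^sup>2"
    using le[of "b / (K + 1)"] by (simp add: power2_eq_square)
  then have "b\<^sup>2 / (K + 1) * (K + 1)\<^sup>2 \<le> b\<^sup>2 * K / (K + 1)\<^sup>2 * (K + 1)\<^sup>2"
    by (intro mult_right_mono) auto
  also have "\<dots> = b\<^sup>2 * K" using K by simp
  also have "b\<^sup>2 / (K + 1) * (K + 1)\<^sup>2 = b\<^sup>2 * (K + 1)"
    using K by (simp add: power2_eq_square)
  finally show ?thesis by (simp add: distrib_left)
qed

text \<open>Meant for \<open>first_variation\<close>: returning u + t h to the unit ball costs a
  factor sqrt (1 + t^2 m), which is 1 up to second order in t and so cannot pay for a nonzero linear
  term.\<close>

lemma le_sqrt_imp_zero: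
  fixes a b m :: real
  assumes "\<And>t. a + t * b \<le> sqrt (1 + t\<^sup>2 * m) * a" "m \<ge> 0" "a \<ge> 0"
  shows "b = 0"
proof (rule linear_le_quadratic_imp_zero)
  show "t * b \<le> t\<^sup>2 * (m * a)" for t
  proof -
    define s where "s = t\<^sup>2 * m"
    have "s \<ge> 0" using assms(2) by (simp add: s_def)
    then have "sqrt (1 + s) \<le> 1 + s"
      by (intro real_le_lsqrt) (simp_all add: power2_eq_square algebra_simps)
    then have "sqrt (1 + s) * a \<le> (1 + s) * a"
      using assms(3) by (intro mult_right_mono)
    then show ?thesis using assms(1)[of t] by (simp add: s_def algebra_simps)
  qed
qed (use assms in simp)

lemma csubspace_projection:
  fixes V :: "'a::chilbert_space set"
  assumes V: "csubspace V" "closed V"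
  obtains p where "p \<in> V" "\<And>v. v \<in> V \<Longrightarrow> cinner (x - p) v = 0"
proof -
  obtain p where p: "p \<in> V" "\<And>v. v \<in> V \<Longrightarrow> norm (x - p) \<le> norm (x - v)"
    using csubspace_closest_point[OF V] by blast
  have Re0: "Re (cinner (x - p) v) = 0" if v: "v \<in> V" for v
  proof (rule linear_le_quadratic_imp_zero)
    fix t :: real
    have "p + t *\<^sub>R v \<in> V" using p v V by (simp add: csubspace_iff scaleR_scaleC)
    from p(2)[OF this] have "(norm (x - p))\<^sup>2 \<le> (norm ((x - p) - t *\<^sub>R v))\<^sup>2"
      by (simp add: algebra_simps power_mono)
    then show "t * Re (cinner (x - p) v) \<le> t\<^sup>2 * ((norm v)\<^sup>2 / 2)"
      unfolding norm_diff_sq[of "x - p" "t *\<^sub>R v"] by (simp add: cinner_simps power_mult_distrib)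
  qed simp
  have "cinner (x - p) v = 0" if v: "v \<in> V" for v
  proof -
    have "\<i> *\<^sub>C v \<in> V" using v V by (simp add: csubspace_iff)
    from Re0[OF this] Re0[OF v] show ?thesis by (simp add: cinner_simps complex_eq_iff)
  qed
  with p(1) show thesis using that by blast
qed

text \<open>Pythagoras. It yields the invariance of a closest point in
  \<open>kleppner_annihilator\<close>: the transformed point lies in V and is no farther
  away.\<close>

lemma closest_point_unique:
  fixes V :: "'a::chilbert_space set"
  assumes "csubspace V" "p \<in> V" "\<And>v. v \<in> V \<Longrightarrow> cinner (x - p) v = 0"
    and "q \<in> V" "norm (x - q) \<le> norm (x - p)"
  shows "q = p"
proof -
  have "(norm (x - q))\<^sup>2 = (norm ((x - p) + (p - q)))\<^sup>2" by simp
  also have "\<dots> = (norm (x - p))\<^sup>2 + (norm (p - q))\<^sup>2"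
    unfolding norm_add_sq[of "x - p" "p - q"] using assms by (simp add: csubspace_diff)
  finally have "(norm (p - q))\<^sup>2 \<le> 0" using power_mono[OF assms(5), of 2] by simp
  then show ?thesis by simp
qed

lemma csubspace_eq_UNIV:
  fixes V :: "'a::chilbert_space set"
  assumes "csubspace V" "closed V" "\<And>f. (\<And>v. v \<in> V \<Longrightarrow> cinner f v = 0) \<Longrightarrow> f = 0"
  shows "V = UNIV"
proof -
  have "x \<in> V" for x
  proof -
    obtain p where "p \<in> V" "\<And>v. v \<in> V \<Longrightarrow> cinner (x - p) v = 0"
      using csubspace_projection[OF assms(1,2)] by blast
    with assms(3)[of "x - p"] show ?thesis by simp
  qed
  then show ?thesis by auto
qed

lemma riesz_representation:
  fixes \<phi> :: "'a::chilbert_space \<Rightarrow> complex"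
  assumes add: "\<And>x y. \<phi> (x + y) = \<phi> x + \<phi> y"
    and scale: "\<And>a x. \<phi> (a *\<^sub>C x) = a * \<phi> x"
    and bdd: "\<And>x. cmod (\<phi> x) \<le> K * norm x"
  obtains g where "\<And>x. \<phi> x = cinner x g"
proof -
  define V where "V = {x. \<phi> x = 0}"
  have bl: "bounded_linear \<phi>"
  proof (rule bounded_linear_intro[of _ K])
    show "\<phi> (r *\<^sub>R x) = r *\<^sub>R \<phi> x" for r x
      by (simp add: scaleR_scaleC[of r x] scale scaleR_conv_of_real)
  qed (simp_all add: add bdd mult.commute)
  have \<phi>0: "\<phi> 0 = 0" using scale[of 0 0] by simp
  have \<phi>d: "\<phi> (x - y) = \<phi> x - \<phi> y" for x y
    using bl by (simp add: bounded_linear.linear linear_diff)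
  have V: "csubspace V" by (auto simp: V_def csubspace_iff add scale \<phi>0)
  have cV: "closed V"
    unfolding V_def by (intro closed_Collect_eq continuous_intros linear_continuous_on bl)
  show thesis
  proof (cases "V = UNIV")
    case True
    then have "\<phi> x = cinner x 0" for x by (auto simp: V_def)
    then show ?thesis using that by blast
  next
    case False
    then obtain f where f: "f \<noteq> 0" "\<And>v. v \<in> V \<Longrightarrow> cinner f v = 0"
      using csubspace_eq_UNIV[OF V cV] by blast
    have ff: "cinner f f \<noteq> 0" using f(1) by (simp add: cinner_self)
    then have f0: "\<phi> f \<noteq> 0" using f(2)[of f] by (auto simp: V_def)
    \<comment> \<open>The kernel has codimension one, so the representing vector is a multiple of f;
      the factor is fixed by evaluating at f.\<close>
    define g where "g = cnj (\<phi> f / cinner f f) *\<^sub>C f"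
    have "\<phi> x = cinner x g" for x
    proof -
      have "\<phi> (x - (\<phi> x / \<phi> f) *\<^sub>C f) = 0" using f0 by (simp add: \<phi>d scale)
      then have "cinner (x - (\<phi> x / \<phi> f) *\<^sub>C f) f = 0"
        using f(2) by (subst cinner_eq_zero_commute) (auto simp: V_def)
      then have "cinner x f = \<phi> x / \<phi> f * cinner f f" by (simp add: cinner_simps)
      then show ?thesis using f0 ff by (simp add: g_def cinner_simps)
    qed
    then show ?thesis using that by blast
  qed
qed

lemma clinear_iff: "clinear T \<longleftrightarrow> (\<forall>x y. T (x + y) = T x + T y) \<and> (\<forall>a x. T (a *\<^sub>C x) = a *\<^sub>C T x)"
  unfolding Vector_Spaces.linear_def module_hom_def module_hom_axioms_def
  using complex_vector.module_axioms complex_vector.vector_space_axioms by (auto simp: vector_space_def)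

lemma bounded_clinearI:
  assumes "\<And>x y. T (x + y) = T x + T y" "\<And>a x. T (a *\<^sub>C x) = a *\<^sub>C T x"
    and "\<And>x. norm (T x) \<le> K * norm (x::'a::chilbert_space)"
  shows "bounded_clinear (T :: 'a \<Rightarrow> 'a)"
  unfolding bounded_clinear_def clinear_iff
  using assms by (auto intro!: bounded_linear_intro[of _ K] simp: scaleR_scaleC mult.commute)

lemma bounded_clinear_add: "bounded_clinear T \<Longrightarrow> T (x + y) = T x + T y"
  and bounded_clinear_scaleC: "bounded_clinear T \<Longrightarrow> T (a *\<^sub>C x) = a *\<^sub>C T x"
  by (simp_all add: bounded_clinear_def clinear_iff)

lemma bounded_clinear_bound:
  assumes "bounded_clinear T" obtains K where "K \<ge> 0" "\<And>x. norm (T x) \<le> K * norm x"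
proof -
  from assms have bl: "bounded_linear T" by (simp add: bounded_clinear_def)
  show thesis using bounded_linear.nonneg_bounded[OF bl] that by (auto simp: mult.commute)
qed

lemma bounded_clinear_adjoint:
  assumes "bounded_clinear (A :: 'a::chilbert_space \<Rightarrow> 'a)"
  obtains A' where "bounded_clinear A'" "\<And>x y. cinner (A x) y = cinner x (A' y)"
proof -
  obtain K where K: "K \<ge> 0" "\<And>x. norm (A x) \<le> K * norm x" using bounded_clinear_bound[OF assms] by blast
  have "\<exists>g. \<forall>x. cinner (A x) y = cinner x g" for y
  proof (rule riesz_representation[of "\<lambda>x. cinner (A x) y" "K * norm y"])
    show "cmod (cinner (A x) y) \<le> K * norm y * norm x" for x
      using order_trans[OF norm_cinner_le mult_right_mono[OF K(2), of "norm y"]] by (simp add: mult_ac)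
  qed (auto simp: bounded_clinear_add[OF assms] bounded_clinear_scaleC[OF assms] cinner_simps)
  then obtain A' where A': "\<And>x y. cinner (A x) y = cinner x (A' y)" by metis
  have ext: "u = v" if "\<And>x. cinner x u = cinner x v" for u v :: 'a
    using cinner_eq_0_imp_0[of "u - v"] that
    by (metis cinner_diff_right cinner_eq_zero_commute eq_iff_diff_eq_0)
  have "bounded_clinear A'"
  proof (rule bounded_clinearI[of _ K])
    show "A' (x + y) = A' x + A' y" for x y
      by (rule ext) (simp add: cinner_simps flip: A')
    show "A' (a *\<^sub>C x) = a *\<^sub>C A' x" for a x
      by (rule ext) (simp add: cinner_simps flip: A')
    show "norm (A' y) \<le> K * norm y" for y
    proof -
      have "(norm (A' y))\<^sup>2 = Re (cinner (A (A' y)) y)" by (simp add: A')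
      also have "\<dots> \<le> norm (A (A' y)) * norm y" by (rule Re_cinner_le)
      also have "\<dots> \<le> K * norm (A' y) * norm y" by (intro mult_right_mono K) simp
      finally have "norm (A' y) * norm (A' y) \<le> norm (A' y) * (K * norm y)"
        by (simp add: power2_eq_square mult_ac)
      then show ?thesis by (cases "norm (A' y) = 0") (auto simp: K(1) mult_nonneg_nonneg)
    qed
  qed
  then show thesis using that A' by blast
qed

lemma cinner_ext_left: "(\<And>f. cinner x f = cinner y f) \<Longrightarrow> x = y"
  using cinner_eq_0_imp_0[of "x - y"] by (simp add: cinner_diff_left)

lemma cinner_ext_right: "(\<And>f. cinner f x = cinner f y) \<Longrightarrow> x = y"
  by (rule cinner_ext_left) (metis cinner_commute)

section \<open>Compactness in the product topology and extreme points\<close>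

lemma continuous_on_eval [continuous_intros]: "continuous_on S (\<lambda>\<phi>. \<phi> x)"
  by (rule continuous_on_product_coordinates[THEN continuous_on_subset]) simp

text \<open>Tychonoff. Applied to discs of radius \<open>R * norm f\<close>, it replaces weak
  compactness of balls: functionals are treated as points of a product space.\<close>

lemma compact_PiE_UNIV:
  fixes K :: "'a \<Rightarrow> 'b::t2_space set"
  assumes "\<And>x. compact (K x)"
  shows "compact {\<phi>. \<forall>x. \<phi> x \<in> K x}"
proof -
  have "{\<phi>. \<forall>x. \<phi> x \<in> K x} = PiE UNIV K" by (auto simp: PiE_def Pi_def)
  moreover have "compactin (product_topology (\<lambda>_. euclidean) UNIV) (PiE UNIV K)"
    using assms by (simp add: compactin_PiE)
  ultimately show ?thesis by (simp add: euclidean_product_topology)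
qed

text \<open>Maximizing \<open>Re \<langle>\<cdot>, k\<rangle>\<close> and then, on the maximal face, the weakly continuous strictly convex
  function \<open>\<Sum>n. w n * (Re \<langle>\<cdot>, e n\<rangle>)\<^sup>2\<close> with \<open>e\<close> dense yields an extreme point.\<close>

lemma extremal_maximizer:
  fixes B :: "'h::{chilbert_space, second_countable_topology} set"
  assumes C: "closed C" and B: "B = {g. (\<lambda>f. cinner f g) \<in> C}"
    and bdd: "\<And>g. g \<in> B \<Longrightarrow> norm g \<le> R" and ne: "B \<noteq> {}"
  obtains u where "u \<in> B" "\<And>g. g \<in> B \<Longrightarrow> Re (cinner g k) \<le> Re (cinner u k)"
    "\<And>h. u + h \<in> B \<Longrightarrow> u - h \<in> B \<Longrightarrow> h = 0"
proof -
  have R0: "R \<ge> 0" using ne bdd norm_ge_zero order_trans by blast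
  \<comment> \<open>Linearity is preserved by pointwise limits, so K is compact, and Riesz
    representation identifies it with B.\<close>
  define K where "K = {\<phi>::'h \<Rightarrow> complex. \<forall>f. \<phi> f \<in> cball 0 (R * norm f)} \<inter>
    (C \<inter> ({\<phi>. \<forall>x y. \<phi> (x + y) = \<phi> x + \<phi> y} \<inter> {\<phi>. \<forall>a x. \<phi> (a *\<^sub>C x) = a * \<phi> x}))"
  have "closed {\<phi>::'h \<Rightarrow> complex. \<forall>x y. \<phi> (x + y) = \<phi> x + \<phi> y}"
    "closed {\<phi>::'h \<Rightarrow> complex. \<forall>a x. \<phi> (a *\<^sub>C x) = a * \<phi> x}"
    by (intro closed_Collect_all closed_Collect_eq continuous_intros)+
  then have compK: "compact K"
    unfolding K_def using C by (intro compact_Int_closed compact_PiE_UNIV closed_Int) auto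
  have K_iff: "\<phi> \<in> K \<longleftrightarrow> (\<exists>g\<in>B. \<phi> = (\<lambda>f. cinner f g))" for \<phi>
  proof
    assume \<phi>: "\<phi> \<in> K"
    obtain g where g: "\<And>x. \<phi> x = cinner x g"
      by (rule riesz_representation[of \<phi> R]) (use \<phi> in \<open>auto simp: K_def\<close>)
    then have "\<phi> = (\<lambda>f. cinner f g)" by auto
    with \<phi> show "\<exists>g\<in>B. \<phi> = (\<lambda>f. cinner f g)" by (auto simp: K_def B)
  next
    assume "\<exists>g\<in>B. \<phi> = (\<lambda>f. cinner f g)"
    then obtain g where g: "g \<in> B" "\<phi> = (\<lambda>f. cinner f g)" by blast
    have "cmod (cinner f g) \<le> R * norm f" for f
      using norm_cinner_le[of f g] mult_left_mono[OF bdd[OF g(1)], of "norm f"]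
      by (simp add: mult.commute)
    then show "\<phi> \<in> K" using g by (auto simp: K_def B cinner_simps)
  qed
  have neK: "K \<noteq> {}" using ne K_iff by blast
  obtain \<phi>0 where \<phi>0: "\<phi>0 \<in> K" "\<And>\<phi>. \<phi> \<in> K \<Longrightarrow> Re (\<phi> k) \<le> Re (\<phi>0 k)"
    using continuous_attains_sup[OF compK neK, of "\<lambda>\<phi>. Re (\<phi> k)"] by (force intro!: continuous_intros)
  define F where "F = K \<inter> {\<phi>. Re (\<phi> k) = Re (\<phi>0 k)}"
  have compF: "compact F"
    unfolding F_def by (intro compact_Int_closed compK closed_Collect_eq continuous_intros)
  have neF: "F \<noteq> {}" using \<phi>0 by (auto simp: F_def)
  obtain D :: "'h set" where D: "countable D" "\<And>X. open X \<Longrightarrow> X \<noteq> {} \<Longrightarrow> \<exists>d\<in>D. d \<in> X"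
    using countable_dense_setE by blast
  have neD: "D \<noteq> {}" using D(2)[of UNIV] by auto
  define e where "e = from_nat_into D"
  \<comment> \<open>The denominators make the n-th term at most (1/2)^n on F, so the series
    converges uniformly and \<Psi> is continuous.\<close>
  define w where "w n = (1/2)^n / (1 + (R * norm (e n))\<^sup>2)" for n :: nat
  have w0: "w n > 0" for n by (simp add: w_def add_pos_nonneg)
  define \<psi> where "\<psi> n \<phi> = w n * (Re (\<phi> (e n)))\<^sup>2" for n and \<phi> :: "'h \<Rightarrow> complex"
  have \<psi>_le: "norm (\<psi> n \<phi>) \<le> (1/2)^n" if "\<phi> \<in> F" for n \<phi>
  proof -
    have "\<bar>Re (\<phi> (e n))\<bar> \<le> R * norm (e n)"
      using that abs_Re_le_cmod[of "\<phi> (e n)"] by (auto simp: F_def K_def intro: order_trans)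
    then have "(Re (\<phi> (e n)))\<^sup>2 \<le> (R * norm (e n))\<^sup>2" using abs_le_square_iff[of "Re (\<phi> (e n))" "R * norm (e n)"] by simp
    then have "(Re (\<phi> (e n)))\<^sup>2 \<le> 1 + (R * norm (e n))\<^sup>2" by simp
    then have "w n * (Re (\<phi> (e n)))\<^sup>2 \<le> w n * (1 + (R * norm (e n))\<^sup>2)"
      using w0[of n] by (intro mult_left_mono) auto
    also have "\<dots> = (1/2)^n" using add_pos_nonneg[of 1 "(R * norm (e n))\<^sup>2"] by (simp add: w_def)
    finally show ?thesis using w0[of n] by (simp add: \<psi>_def)
  qed
  have geo: "summable (\<lambda>n. (1/2::real)^n)" by (rule summable_geometric) simp
  have summ: "summable (\<lambda>n. \<psi> n \<phi>)" if "\<phi> \<in> F" for \<phi>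
    by (rule summable_comparison_test'[OF geo]) (use \<psi>_le[OF that] in auto)
  define \<Psi> where "\<Psi> \<phi> = (\<Sum>n. \<psi> n \<phi>)" for \<phi>
  have "uniform_limit F (\<lambda>n \<phi>. \<Sum>i<n. \<psi> i \<phi>) \<Psi> sequentially"
    unfolding \<Psi>_def by (rule Weierstrass_m_test[OF \<psi>_le geo])
  then have "continuous_on F \<Psi>"
    by (rule uniform_limit_theorem[rotated])
      (auto simp: \<psi>_def intro!: always_eventually continuous_intros)
  then obtain \<phi>1 where \<phi>1: "\<phi>1 \<in> F" "\<And>\<phi>. \<phi> \<in> F \<Longrightarrow> \<Psi> \<phi> \<le> \<Psi> \<phi>1"
    using continuous_attains_sup[OF compF neF] by blast
  from \<phi>1 obtain u where u: "u \<in> B" "\<phi>1 = (\<lambda>f. cinner f u)" using K_iff by (auto simp: F_def)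
  have max: "Re (cinner g k) \<le> Re (cinner u k)" if "g \<in> B" for g
    using \<phi>0(2)[of "\<lambda>f. cinner f g"] that \<phi>1(1) K_iff
    by (auto simp: F_def u(2) Re_cinner_commute[of _ k])
  have "h = 0" if h: "u + h \<in> B" "u - h \<in> B" for h
  proof -
    have "Re (cinner h k) = 0"
      using max[OF h(1)] max[OF h(2)] by (simp add: cinner_simps)
    then have inF: "(\<lambda>f. cinner f (u + h)) \<in> F" "(\<lambda>f. cinner f (u - h)) \<in> F"
      using h \<phi>1(1) K_iff[of "\<lambda>f. cinner f (u + h)"] K_iff[of "\<lambda>f. cinner f (u - h)"]
      by (auto simp: F_def u(2) cinner_add_right[of k] cinner_diff_right[of k] Re_cinner_commute[of k h])
    let ?b = "\<lambda>n. w n * (Re (cinner (e n) h))\<^sup>2"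
    \<comment> \<open>Parallelogram identity: moving from u to u + h and u - h raises the average of
      the n-th term by exactly \<open>?b n\<close>, so maximality forces every \<open>?b n\<close>
      to vanish.\<close>
    have eq: "2 * ?b n = \<psi> n (\<lambda>f. cinner f (u + h)) + \<psi> n (\<lambda>f. cinner f (u - h)) - 2 * \<psi> n \<phi>1" for n
      by (simp add: \<psi>_def u(2) cinner_simps power2_eq_square algebra_simps)
    have "(\<lambda>n. 2 * ?b n) sums (\<Psi> (\<lambda>f. cinner f (u + h)) + \<Psi> (\<lambda>f. cinner f (u - h)) - 2 * \<Psi> \<phi>1)"
      unfolding eq \<Psi>_def
      by (intro sums_add sums_diff sums_mult summable_sums summ inF \<phi>1(1))
    moreover have "\<Psi> (\<lambda>f. cinner f (u + h)) + \<Psi> (\<lambda>f. cinner f (u - h)) - 2 * \<Psi> \<phi>1 \<le> 0"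
      using \<phi>1(2)[OF inF(1)] \<phi>1(2)[OF inF(2)] by simp
    moreover have b0: "2 * ?b n \<ge> 0" for n using w0[of n] by simp
    ultimately have "summable (\<lambda>n. 2 * ?b n)" "(\<Sum>n. 2 * ?b n) \<le> 0"
      by (auto simp: sums_iff)
    then have "2 * ?b n = 0" for n
      using suminf_eq_zero_iff[of "\<lambda>n. 2 * ?b n"] suminf_nonneg[of "\<lambda>n. 2 * ?b n"] b0
      by (metis (no_types, lifting) order_antisym)
    then have "Re (cinner (e n) h) = 0" for n using w0[of n] by (metis less_irrefl mult_eq_0_iff power2_eq_square zero_neq_numeral)
    then have *: "Re (cinner d h) = 0" if "d \<in> D" for d
      using from_nat_into_surj[OF D(1) that] by (auto simp: e_def)
    have "open {x. Re (cinner x h) \<noteq> 0}"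
      by (intro open_Collect_neq continuous_intros)
    then have "{x. Re (cinner x h) \<noteq> 0} = {}" using D(2) * by blast
    then have "Re (cinner h h) = 0" by blast
    then show ?thesis by simp
  qed
  with u(1) max show thesis using that by blast
qed

section \<open>Square-summable families\<close>

text \<open>Families are indexed by a whole type; those on \<Gamma> are extended by zero in
  \<open>coef\<close>, which avoids a type depending on \<Gamma>.\<close>

typedef 'a ell2 = "{a :: 'a \<Rightarrow> complex. (\<lambda>i. (cmod (a i))\<^sup>2) summable_on UNIV}"
  by (rule exI[of _ "\<lambda>_. 0"]) simp

setup_lifting type_definition_ell2

lemma square_summable_add:
  assumes "(\<lambda>i. (cmod (a i))\<^sup>2) summable_on S" "(\<lambda>i. (cmod (b i))\<^sup>2) summable_on S"
  shows "(\<lambda>i. (cmod (a i + b i))\<^sup>2) summable_on S"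
proof (rule summable_on_comparison_test)
  show "(\<lambda>i. 2 * (cmod (a i))\<^sup>2 + 2 * (cmod (b i))\<^sup>2) summable_on S"
    by (intro summable_on_add summable_on_cmult_right assms)
  show "(cmod (a i + b i))\<^sup>2 \<le> 2 * (cmod (a i))\<^sup>2 + 2 * (cmod (b i))\<^sup>2" for i
    using power_mono[OF norm_triangle_ineq[of "a i" "b i"], of 2] sum_squares_bound[of "cmod (a i)" "cmod (b i)"]
    by (simp add: power2_eq_square algebra_simps)
qed auto

lemma square_summable_prod:
  assumes "(\<lambda>i. (cmod (a i))\<^sup>2) summable_on S" "(\<lambda>i. (cmod (b i))\<^sup>2) summable_on S"
  shows "(\<lambda>i. a i * cnj (b i)) summable_on S"
proof (rule abs_summable_summable, rule summable_on_comparison_test)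
  show "(\<lambda>i. (cmod (a i))\<^sup>2 + (cmod (b i))\<^sup>2) summable_on S"
    by (intro summable_on_add assms)
  show "norm (a i * cnj (b i)) \<le> (cmod (a i))\<^sup>2 + (cmod (b i))\<^sup>2" for i
    unfolding norm_mult complex_mod_cnj
    using sum_squares_bound[of "cmod (a i)" "cmod (b i)"]
      mult_nonneg_nonneg[OF norm_ge_zero[of "a i"] norm_ge_zero[of "b i"]] by linarith
qed auto

instantiation ell2 :: (type) real_normed_vector
begin

lift_definition zero_ell2 :: "'a ell2" is "\<lambda>_. 0" by simp
lift_definition plus_ell2 :: "'a ell2 \<Rightarrow> 'a ell2 \<Rightarrow> 'a ell2" is "\<lambda>a b i. a i + b i"
  by (rule square_summable_add)
lift_definition uminus_ell2 :: "'a ell2 \<Rightarrow> 'a ell2" is "\<lambda>a i. - a i" by simp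
lift_definition minus_ell2 :: "'a ell2 \<Rightarrow> 'a ell2 \<Rightarrow> 'a ell2" is "\<lambda>a b i. a i - b i"
  subgoal for a b using square_summable_add[of a UNIV "\<lambda>i. - b i"] by simp done
lift_definition scaleR_ell2 :: "real \<Rightarrow> 'a ell2 \<Rightarrow> 'a ell2" is "\<lambda>r a i. of_real r * a i"
  by (simp add: norm_mult power_mult_distrib summable_on_cmult_right)
lift_definition norm_ell2 :: "'a ell2 \<Rightarrow> real" is "\<lambda>a. sqrt (\<Sum>\<^sub>\<infinity>i. (cmod (a i))\<^sup>2)" .
definition dist_ell2 :: "'a ell2 \<Rightarrow> 'a ell2 \<Rightarrow> real" where "dist_ell2 a b = norm (a - b)"
definition sgn_ell2 :: "'a ell2 \<Rightarrow> 'a ell2" where "sgn_ell2 a = inverse (norm a) *\<^sub>R a"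
definition uniformity_ell2 :: "('a ell2 \<times> 'a ell2) filter" where
  "uniformity_ell2 = (INF e\<in>{0<..}. principal {(x, y). dist x y < e})"
definition open_ell2 :: "'a ell2 set \<Rightarrow> bool" where
  "open_ell2 U = (\<forall>x\<in>U. \<forall>\<^sub>F (x', y) in uniformity. x' = x \<longrightarrow> y \<in> U)"

instance
proof
  fix a b c :: "'a ell2" and r s :: real
  show "a + b + c = a + (b + c)" by transfer (simp add: add.assoc)
  show "a + b = b + a" by transfer (simp add: add.commute)
  show "0 + a = a" by transfer simp
  show "- a + a = 0" by transfer simp
  show "a - b = a + - b" by transfer simp
  show "r *\<^sub>R (a + b) = r *\<^sub>R a + r *\<^sub>R b" by transfer (simp add: distrib_left)
  show "(r + s) *\<^sub>R a = r *\<^sub>R a + s *\<^sub>R a" by transfer (simp add: distrib_right)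
  show "r *\<^sub>R (s *\<^sub>R a) = (r * s) *\<^sub>R a" by transfer (simp add: mult.assoc)
  show "1 *\<^sub>R a = a" by transfer simp
  show "dist a b = norm (a - b)" by (rule dist_ell2_def)
  show "sgn a = inverse (norm a) *\<^sub>R a" by (rule sgn_ell2_def)
  show "uniformity = (INF e\<in>{0<..}. principal {(x, y). dist x (y::'a ell2) < e})"
    by (rule uniformity_ell2_def)
  show "open U = (\<forall>x\<in>U. \<forall>\<^sub>F (x', y) in uniformity. x' = x \<longrightarrow> y \<in> U)" for U :: "'a ell2 set"
    by (rule open_ell2_def)
  show "(norm a = 0) = (a = 0)"
  proof transfer
    fix a :: "'a \<Rightarrow> complex" assume a: "(\<lambda>i. (cmod (a i))\<^sup>2) summable_on UNIV"
    have "a = (\<lambda>_. 0)" if "(\<Sum>\<^sub>\<infinity>i. (cmod (a i))\<^sup>2) = 0"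
    proof
      fix i show "a i = 0"
        using nonneg_infsum_le_0D[of "\<lambda>i. (cmod (a i))\<^sup>2" UNIV i] a that by auto
    qed
    then show "(sqrt (\<Sum>\<^sub>\<infinity>i. (cmod (a i))\<^sup>2) = 0) = (a = (\<lambda>_. 0))" by auto
  qed
  show "norm (r *\<^sub>R a) = \<bar>r\<bar> * norm a"
    by transfer (simp add: norm_mult power_mult_distrib infsum_cmult_right' real_sqrt_mult)
  show "norm (a + b) \<le> norm a + norm b"
  proof transfer
    fix a b :: "'a \<Rightarrow> complex"
    assume a: "(\<lambda>i. (cmod (a i))\<^sup>2) summable_on UNIV" and b: "(\<lambda>i. (cmod (b i))\<^sup>2) summable_on UNIV"
    let ?n = "\<lambda>a. sqrt (\<Sum>\<^sub>\<infinity>i::'a. (cmod (a i))\<^sup>2)"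
    have le: "L2_set (\<lambda>i. cmod (a i)) F \<le> ?n a"
      if "finite F" "(\<lambda>i. (cmod (a i))\<^sup>2) summable_on UNIV" for F and a :: "'a \<Rightarrow> complex"
      using that by (auto simp: L2_set_def intro!: finite_sum_le_infsum)
    have "(\<Sum>\<^sub>\<infinity>i. (cmod (a i + b i))\<^sup>2) \<le> (?n a + ?n b)\<^sup>2"
    proof (rule infsum_le_finite_sums[OF square_summable_add[OF a b]])
      fix F :: "'a set" assume F: "finite F"
      have "L2_set (\<lambda>i. cmod (a i + b i)) F \<le> L2_set (\<lambda>i. cmod (a i) + cmod (b i)) F"
        by (rule L2_set_mono) (auto intro: norm_triangle_ineq)
      also have "\<dots> \<le> ?n a + ?n b"
        by (rule order_trans[OF L2_set_triangle_ineq add_mono[OF le[OF F a] le[OF F b]]])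
      finally have "sqrt (\<Sum>i\<in>F. (cmod (a i + b i))\<^sup>2) \<le> ?n a + ?n b" by (simp add: L2_set_def)
      then show "(\<Sum>i\<in>F. (cmod (a i + b i))\<^sup>2) \<le> (?n a + ?n b)\<^sup>2"
        using sqrt_le_D by blast
    qed
    then show "?n (\<lambda>i. a i + b i) \<le> ?n a + ?n b"
      by (intro real_le_lsqrt) (auto intro!: infsum_nonneg add_nonneg_nonneg)
  qed
qed

end

lemma square_summable_bounded:
  fixes y :: "'a \<Rightarrow> complex"
  assumes "\<And>F. finite F \<Longrightarrow> (\<Sum>i\<in>F. (cmod (y i))\<^sup>2) \<le> K"
  shows "(\<lambda>i. (cmod (y i))\<^sup>2) summable_on UNIV" "(\<Sum>\<^sub>\<infinity>i. (cmod (y i))\<^sup>2) \<le> K"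
proof -
  show 1: "(\<lambda>i. (cmod (y i))\<^sup>2) summable_on UNIV"
    using assms by (intro nonneg_bdd_above_summable_on bdd_aboveI[of _ K]) auto
  show "(\<Sum>\<^sub>\<infinity>i. (cmod (y i))\<^sup>2) \<le> K"
    using assms 1 by (intro infsum_le_finite_sums) auto
qed

lemma ell2_norm_sq: "(norm a)\<^sup>2 = (\<Sum>\<^sub>\<infinity>i. (cmod (Rep_ell2 a i))\<^sup>2)"
  by transfer (simp add: infsum_nonneg)

lemma ell2_summable: "(\<lambda>i. (cmod (Rep_ell2 a i))\<^sup>2) summable_on UNIV"
  using Rep_ell2[of a] by simp

lemma ell2_finite_sum_le: "finite F \<Longrightarrow> (\<Sum>i\<in>F. (cmod (Rep_ell2 a i))\<^sup>2) \<le> (norm a)\<^sup>2"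
  unfolding ell2_norm_sq by (intro finite_sum_le_infsum ell2_summable) auto

instance ell2 :: (type) banach
proof
  fix X :: "nat \<Rightarrow> 'a ell2"
  assume "Cauchy X"
  show "convergent X"
  proof -
    define x where "x n = Rep_ell2 (X n)" for n
    have bnd: "(\<Sum>i\<in>F. (cmod (x m i - x n i))\<^sup>2) \<le> (dist (X m) (X n))\<^sup>2" if "finite F" for F m n
      using ell2_finite_sum_le[OF that, of "X m - X n"] by (simp add: dist_norm minus_ell2.rep_eq x_def)
    have "\<exists>l. (\<lambda>n. x n i) \<longlonglongrightarrow> l" for i
    proof -
      have "Cauchy (\<lambda>n. x n i)"
      proof (rule metric_CauchyI)
        fix e :: real assume "e > 0"
        with \<open>Cauchy X\<close> obtain N where N: "\<And>m n. m \<ge> N \<Longrightarrow> n \<ge> N \<Longrightarrow> dist (X m) (X n) < e"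
          unfolding Cauchy_def by blast
        have "dist (x m i) (x n i) < e" if "m \<ge> N" "n \<ge> N" for m n
        proof -
          have "(cmod (x m i - x n i))\<^sup>2 \<le> (dist (X m) (X n))\<^sup>2" using bnd[of "{i}" m n] by simp
          then have "cmod (x m i - x n i) \<le> dist (X m) (X n)"
            by (rule power2_le_imp_le) (simp add: dist_norm)
          then show ?thesis using N[OF that] by (simp add: dist_norm)
        qed
        then show "\<exists>M. \<forall>m\<ge>M. \<forall>n\<ge>M. dist (x m i) (x n i) < e" by blast
      qed
      then show ?thesis using Cauchy_convergent_iff convergent_def by blast
    qed
    then obtain l where l: "\<And>i. (\<lambda>n. x n i) \<longlonglongrightarrow> l i" by metis
    \<comment> \<open>N is independent of the finite set F. For each F the limit in n is taken
      termwise, and only afterwards does F exhaust the index set.\<close>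
    have lim: "\<exists>N. \<forall>m\<ge>N. \<forall>F. finite F \<longrightarrow> (\<Sum>i\<in>F. (cmod (x m i - l i))\<^sup>2) \<le> e\<^sup>2" if "e > 0" for e
    proof -
      from \<open>Cauchy X\<close> \<open>e > 0\<close> obtain N where N: "\<And>m n. m \<ge> N \<Longrightarrow> n \<ge> N \<Longrightarrow> dist (X m) (X n) < e"
        unfolding Cauchy_def by blast
      have "(\<Sum>i\<in>F. (cmod (x m i - l i))\<^sup>2) \<le> e\<^sup>2" if "m \<ge> N" "finite F" for m F
      proof (rule LIMSEQ_le_const2)
        show "(\<lambda>n. \<Sum>i\<in>F. (cmod (x m i - x n i))\<^sup>2) \<longlonglongrightarrow> (\<Sum>i\<in>F. (cmod (x m i - l i))\<^sup>2)"
            by (intro tendsto_sum tendsto_power tendsto_norm tendsto_diff tendsto_const l)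
        have "(dist (X m) (X n))\<^sup>2 \<le> e\<^sup>2" if "n \<ge> N" for n
          using N[OF \<open>m \<ge> N\<close> that] by (intro power_mono) (auto simp: dist_norm)
        then show "\<exists>N. \<forall>n\<ge>N. (\<Sum>i\<in>F. (cmod (x m i - x n i))\<^sup>2) \<le> e\<^sup>2"
          using bnd[OF \<open>finite F\<close>, of m] by (meson order_trans)
      qed
      then show ?thesis by blast
    qed
    obtain N1 where "\<And>F. finite F \<Longrightarrow> (\<Sum>i\<in>F. (cmod (x N1 i - l i))\<^sup>2) \<le> 1\<^sup>2"
      using lim[of 1] by auto
    from square_summable_bounded(1)[OF this] have "(\<lambda>i. (cmod (- (x N1 i - l i)))\<^sup>2) summable_on UNIV"
      by (simp only: norm_minus_cancel)
    with ell2_summable[of "X N1"] have "(\<lambda>i. (cmod (x N1 i + - (x N1 i - l i)))\<^sup>2) summable_on UNIV"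
      unfolding x_def by (rule square_summable_add)
    then have lL: "Rep_ell2 (Abs_ell2 l) = l" by (simp add: Abs_ell2_inverse)
    have "X \<longlonglongrightarrow> Abs_ell2 l"
    proof (rule metric_LIMSEQ_I)
      fix e :: real assume "e > 0"
      then have "e / 2 > 0" by simp
      from lim[OF this] obtain N where N: "\<And>m F. m \<ge> N \<Longrightarrow> finite F \<Longrightarrow> (\<Sum>i\<in>F. (cmod (x m i - l i))\<^sup>2) \<le> (e/2)\<^sup>2"
        by blast
      have "dist (X m) (Abs_ell2 l) < e" if "m \<ge> N" for m
      proof -
        have "(dist (X m) (Abs_ell2 l))\<^sup>2 \<le> (e/2)\<^sup>2"
          using square_summable_bounded(2)[OF N[OF that]] by (simp add: dist_norm ell2_norm_sq minus_ell2.rep_eq lL x_def)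
        then have "dist (X m) (Abs_ell2 l) \<le> e/2"
          by (rule power2_le_imp_le) (use \<open>e > 0\<close> in simp)
        then show ?thesis using \<open>e > 0\<close> by simp
      qed
      then show "\<exists>no. \<forall>n\<ge>no. dist (X n) (Abs_ell2 l) < e" by blast
    qed
    then show ?thesis by (auto simp: convergent_def)
  qed
qed

instantiation ell2 :: (type) chilbert_space
begin

lift_definition scaleC_ell2 :: "complex \<Rightarrow> 'a ell2 \<Rightarrow> 'a ell2" is "\<lambda>c a i. c * a i"
  by (simp add: norm_mult power_mult_distrib summable_on_cmult_right)
lift_definition cinner_ell2 :: "'a ell2 \<Rightarrow> 'a ell2 \<Rightarrow> complex" is "\<lambda>a b. \<Sum>\<^sub>\<infinity>i. a i * cnj (b i)" .

instance
proof
  fix a b c :: "'a ell2" and r :: real and z w :: complex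
  show "z *\<^sub>C (a + b) = z *\<^sub>C a + z *\<^sub>C b" by transfer (simp add: distrib_left)
  show "(z + w) *\<^sub>C a = z *\<^sub>C a + w *\<^sub>C a" by transfer (simp add: distrib_right)
  show "z *\<^sub>C (w *\<^sub>C a) = (z * w) *\<^sub>C a" by transfer (simp add: mult.assoc)
  show "1 *\<^sub>C a = a" by transfer simp
  show "r *\<^sub>R a = of_real r *\<^sub>C a" by transfer simp
  show "cinner a b = cnj (cinner b a)"
    by transfer (simp add: mult.commute flip: infsum_cnj)
  show "cinner (a + b) c = cinner a c + cinner b c"
    by transfer (simp add: distrib_right infsum_add square_summable_prod)
  show "cinner (z *\<^sub>C a) b = z * cinner a b"
    by transfer (simp add: mult.assoc infsum_cmult_right square_summable_prod)
  show "cinner a a = of_real ((norm a)\<^sup>2)"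
  proof transfer
    fix a :: "'a \<Rightarrow> complex" assume a: "(\<lambda>i. (cmod (a i))\<^sup>2) summable_on UNIV"
    have "(\<Sum>\<^sub>\<infinity>i. a i * cnj (a i)) = (\<Sum>\<^sub>\<infinity>i. of_real ((cmod (a i))\<^sup>2))"
      by (simp only: complex_norm_square)
    also have "\<dots> = of_real (\<Sum>\<^sub>\<infinity>i. (cmod (a i))\<^sup>2)"
      using has_sum_of_real[OF has_sum_infsum[OF a]] by (rule infsumI)
    finally show "(\<Sum>\<^sub>\<infinity>i. a i * cnj (a i)) = of_real ((sqrt (\<Sum>\<^sub>\<infinity>i. (cmod (a i))\<^sup>2))\<^sup>2)"
      by (simp add: infsum_nonneg)
  qed
qed

end

section \<open>Orbits of a subgroup under a projective representation\<close>

lemma ell2_eqI: "(\<And>i. Rep_ell2 a i = Rep_ell2 b i) \<Longrightarrow> a = b"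
  by (metis Rep_ell2_inject ext)

text \<open>The data that involve no measure; measurability, \<mu> and the formal dimension enter in
  \<open>lattice_orbit\<close>.\<close>

locale projective_orbit =
  fixes \<Gamma> :: "'g::group_add set"
    and \<sigma> :: "'g \<Rightarrow> 'g \<Rightarrow> complex"
    and \<pi> :: "'g \<Rightarrow> 'h \<Rightarrow> 'h::{chilbert_space, second_countable_topology}"
  assumes subgroup: "is_subgroup \<Gamma>"
    and unitary: "\<And>x. unitary_operator (\<pi> x)"
    and pi_zero: "\<pi> 0 = id"
    and pi_pi: "\<And>x y f. \<pi> x (\<pi> y f) = \<sigma> x y *\<^sub>C \<pi> (x + y) f"
    and cmod_sigma: "\<And>x y. cmod (\<sigma> x y) = 1"
    and sigma_zero: "\<And>x. \<sigma> x 0 = 1" "\<And>x. \<sigma> 0 x = 1"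
begin

lemma zero_mem [simp]: "0 \<in> \<Gamma>"
  and add_mem: "x \<in> \<Gamma> \<Longrightarrow> y \<in> \<Gamma> \<Longrightarrow> x + y \<in> \<Gamma>"
  and uminus_mem: "x \<in> \<Gamma> \<Longrightarrow> - x \<in> \<Gamma>"
  using subgroup by (auto simp: is_subgroup_def)

lemma diff_mem: "x \<in> \<Gamma> \<Longrightarrow> y \<in> \<Gamma> \<Longrightarrow> x - y \<in> \<Gamma>"
  using add_mem[of x "- y"] uminus_mem by simp

lemma add_mem_cancel_left: "x \<in> \<Gamma> \<Longrightarrow> x + y \<in> \<Gamma> \<longleftrightarrow> y \<in> \<Gamma>"
  using add_mem[of "- x" "x + y"] add_mem[of x y] uminus_mem[of x] by (auto simp: add.assoc[symmetric])

lemma pi_add: "\<pi> x (f + g) = \<pi> x f + \<pi> x g"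
  and pi_scaleC: "\<pi> x (a *\<^sub>C f) = a *\<^sub>C \<pi> x f"
  and cinner_pi: "cinner (\<pi> x f) (\<pi> x g) = cinner f g"
  and surj_pi: "surj (\<pi> x)"
  using unitary[of x] by (simp_all add: unitary_operator_def clinear_iff)

lemma pi_zero_right [simp]: "\<pi> x 0 = 0"
  using pi_scaleC[of x 0 0] by simp

lemma pi_diff: "\<pi> x (f - g) = \<pi> x f - \<pi> x g"
  by (metis add_diff_cancel diff_add_cancel pi_add)

lemma norm_pi [simp]: "norm (\<pi> x f) = norm f"
proof -
  have "(norm (\<pi> x f))\<^sup>2 = (norm f)\<^sup>2" by (simp only: Re_cinner_self[symmetric] cinner_pi)
  then show ?thesis by (simp add: power2_eq_iff_nonneg)
qed

lemma inj_pi: "inj (\<pi> x)"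
proof (rule injI)
  fix f g assume "\<pi> x f = \<pi> x g"
  then have "norm (\<pi> x (f - g)) = 0" by (simp add: pi_diff)
  then show "f = g" by simp
qed

lemma pi_inv [simp]: "\<pi> x (inv (\<pi> x) f) = f"
  by (rule surj_f_inv_f[OF surj_pi])

lemma cinner_pi_left: "cinner (\<pi> x f) g = cinner f (inv (\<pi> x) g)"
  by (metis cinner_pi pi_inv)

lemma cinner_pi_right: "cinner f (\<pi> x g) = cinner (inv (\<pi> x) f) g"
  by (metis cinner_pi pi_inv)

lemma inv_pi: "inv (\<pi> x) f = cnj (\<sigma> x (- x)) *\<^sub>C \<pi> (- x) f"
proof -
  have "\<pi> x (cnj (\<sigma> x (- x)) *\<^sub>C \<pi> (- x) f) = f"
    using complex_norm_square[of "\<sigma> x (- x)"]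
    by (simp add: pi_scaleC pi_pi pi_zero scaleC_scaleC cmod_sigma mult.commute)
  then show ?thesis by (metis inv_f_f inj_pi)
qed

lemma sigma_cnj [simp]: "\<sigma> x y * cnj (\<sigma> x y) = 1" "cnj (\<sigma> x y) * \<sigma> x y = 1"
  using complex_norm_square[of "\<sigma> x y"] by (simp_all add: cmod_sigma mult.commute)

lemma pi_sum: "\<pi> (x + y) f = cnj (\<sigma> x y) *\<^sub>C \<pi> x (\<pi> y f)"
  by (simp add: pi_pi scaleC_scaleC)

text \<open>Only finite partial sums occur, so the condition presupposes no summability and is
  preserved by weak limits of h; the latter gives a compact unit ball.\<close>

definition bbound :: "real \<Rightarrow> 'h \<Rightarrow> bool" where
  "bbound M h \<longleftrightarrow> (\<forall>f F. finite F \<and> F \<subseteq> \<Gamma> \<longrightarrow> (\<Sum>\<gamma>\<in>F. (cmod (cinner f (\<pi> \<gamma> h)))\<^sup>2) \<le> M * (norm f)\<^sup>2)"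

definition bessel :: "'h \<Rightarrow> bool" where
  "bessel h \<longleftrightarrow> (\<exists>M. bbound M h)"

text \<open>The analysis operator of the orbit of h, linear in f and conjugate linear in h.
  \<open>Abs_ell2\<close> is meaningful only for square-summable families, hence the recurring
  hypothesis \<open>bessel h\<close>.\<close>

definition coef :: "'h \<Rightarrow> 'h \<Rightarrow> 'g ell2" where
  "coef h f = Abs_ell2 (\<lambda>\<gamma>. if \<gamma> \<in> \<Gamma> then cinner f (\<pi> \<gamma> h) else 0)"

lemma bbound_bessel: "bbound M h \<Longrightarrow> bessel h" by (auto simp: bessel_def)

lemma bbound_sum:
  assumes "bbound M h" "finite F"
  shows "(\<Sum>\<gamma>\<in>F. (cmod (if \<gamma> \<in> \<Gamma> then cinner f (\<pi> \<gamma> h) else 0))\<^sup>2) \<le> M * (norm f)\<^sup>2"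
proof -
  have "(\<Sum>\<gamma>\<in>F. (cmod (if \<gamma> \<in> \<Gamma> then cinner f (\<pi> \<gamma> h) else 0))\<^sup>2)
      = (\<Sum>\<gamma>\<in>F \<inter> \<Gamma>. (cmod (cinner f (\<pi> \<gamma> h)))\<^sup>2)"
    using assms(2) by (intro sum.mono_neutral_cong_right) auto
  also have "\<dots> \<le> M * (norm f)\<^sup>2" using assms by (auto simp: bbound_def)
  finally show ?thesis .
qed

lemma Rep_coef:
  assumes "bessel h"
  shows "Rep_ell2 (coef h f) = (\<lambda>\<gamma>. if \<gamma> \<in> \<Gamma> then cinner f (\<pi> \<gamma> h) else 0)"
proof -
  from assms obtain M where "bbound M h" by (auto simp: bessel_def)
  from square_summable_bounded(1)[OF bbound_sum[OF this]]
  show ?thesis by (simp add: coef_def Abs_ell2_inverse)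
qed

lemma bbound_iff:
  assumes "bessel h"
  shows "bbound M h \<longleftrightarrow> (\<forall>f. (norm (coef h f))\<^sup>2 \<le> M * (norm f)\<^sup>2)"
proof
  assume "bbound M h"
  then show "\<forall>f. (norm (coef h f))\<^sup>2 \<le> M * (norm f)\<^sup>2"
    using square_summable_bounded(2)[OF bbound_sum] by (simp add: ell2_norm_sq Rep_coef assms)
next
  assume *: "\<forall>f. (norm (coef h f))\<^sup>2 \<le> M * (norm f)\<^sup>2"
  show "bbound M h"
    unfolding bbound_def
  proof (intro allI impI)
    fix f F assume F: "finite F \<and> F \<subseteq> \<Gamma>"
    have "(\<Sum>\<gamma>\<in>F. (cmod (cinner f (\<pi> \<gamma> h)))\<^sup>2) = (\<Sum>\<gamma>\<in>F. (cmod (Rep_ell2 (coef h f) \<gamma>))\<^sup>2)"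
      using F by (intro sum.cong) (auto simp: Rep_coef assms)
    also have "\<dots> \<le> (norm (coef h f))\<^sup>2" using F by (intro ell2_finite_sum_le) simp
    finally show "(\<Sum>\<gamma>\<in>F. (cmod (cinner f (\<pi> \<gamma> h)))\<^sup>2) \<le> M * (norm f)\<^sup>2"
      using * order_trans by blast
  qed
qed

lemma bessel_bound:
  assumes "bessel h" obtains M where "M \<ge> 0" "\<And>f. norm (coef h f) \<le> M * norm f"
proof -
  from assms obtain M where M: "bbound M h" by (auto simp: bessel_def)
  have "norm (coef h f) \<le> sqrt \<bar>M\<bar> * norm f" for f
  proof (rule power2_le_imp_le)
    have "(norm (coef h f))\<^sup>2 \<le> M * (norm f)\<^sup>2" using M bbound_iff[OF assms] by blast
    also have "\<dots> \<le> \<bar>M\<bar> * (norm f)\<^sup>2" by (intro mult_right_mono) auto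
    finally show "(norm (coef h f))\<^sup>2 \<le> (sqrt \<bar>M\<bar> * norm f)\<^sup>2" by (simp add: power_mult_distrib)
  qed simp
  then show thesis using that[of "sqrt \<bar>M\<bar>"] by simp
qed

lemma besselI:
  assumes "\<And>f. \<exists>a. (\<forall>\<gamma>\<in>\<Gamma>. cinner f (\<pi> \<gamma> h) = Rep_ell2 a \<gamma>) \<and> norm a \<le> K * norm f"
  shows "bessel h"
proof -
  have "bbound (K\<^sup>2) h"
    unfolding bbound_def
  proof (intro allI impI)
    fix f F assume F: "finite F \<and> F \<subseteq> \<Gamma>"
    obtain a where a: "\<forall>\<gamma>\<in>\<Gamma>. cinner f (\<pi> \<gamma> h) = Rep_ell2 a \<gamma>" "norm a \<le> K * norm f"
      using assms by blast
    have "(\<Sum>\<gamma>\<in>F. (cmod (cinner f (\<pi> \<gamma> h)))\<^sup>2) = (\<Sum>\<gamma>\<in>F. (cmod (Rep_ell2 a \<gamma>))\<^sup>2)"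
      using F a by (intro sum.cong) auto
    also have "\<dots> \<le> (norm a)\<^sup>2" using F by (intro ell2_finite_sum_le) simp
    also have "\<dots> \<le> (K * norm f)\<^sup>2" using a by (intro power_mono) auto
    finally show "(\<Sum>\<gamma>\<in>F. (cmod (cinner f (\<pi> \<gamma> h)))\<^sup>2) \<le> K\<^sup>2 * (norm f)\<^sup>2"
      by (simp add: power_mult_distrib)
  qed
  then show ?thesis by (rule bbound_bessel)
qed

lemma bessel_0 [simp]: "bessel 0"
  unfolding bessel_def bbound_def by (auto intro: exI[of _ 0])

lemma bessel_add:
  assumes "bessel h" "bessel k" shows "bessel (h + k)"
proof -
  obtain M N where "\<And>f. norm (coef h f) \<le> M * norm f" "\<And>f. norm (coef k f) \<le> N * norm f"
    using assms bessel_bound by metis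
  then have "norm (coef h f + coef k f) \<le> (M + N) * norm f" for f
    by (metis add_mono distrib_right norm_triangle_le)
  then show ?thesis
    by (intro besselI[of _ "M + N"] exI[of _ "coef h _ + coef k _"])
      (auto simp: plus_ell2.rep_eq Rep_coef assms pi_add cinner_simps)
qed

lemma bessel_scaleC:
  assumes "bessel h" shows "bessel (a *\<^sub>C h)"
proof -
  obtain M where "\<And>f. norm (coef h f) \<le> M * norm f" using assms bessel_bound by metis
  then have "norm (cnj a *\<^sub>C coef h f) \<le> (cmod a * M) * norm f" for f
    by (simp add: norm_scaleC mult.assoc mult_left_mono)
  then show ?thesis
    by (intro besselI[of _ "cmod a * M"] exI[of _ "cnj a *\<^sub>C coef h _"])
      (auto simp: scaleC_ell2.rep_eq Rep_coef assms pi_scaleC cinner_simps)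
qed

lemma bessel_uminus: "bessel h \<Longrightarrow> bessel (- h)"
  using bessel_scaleC[of h "-1"] by (simp add: scaleC_minus1)

lemma bessel_diff: "bessel h \<Longrightarrow> bessel k \<Longrightarrow> bessel (h - k)"
  using bessel_add[of h "- k"] bessel_uminus by simp

lemma coef_add_left: "bessel h \<Longrightarrow> bessel k \<Longrightarrow> coef (h + k) f = coef h f + coef k f"
  by (rule ell2_eqI) (simp add: Rep_coef bessel_add plus_ell2.rep_eq pi_add cinner_simps)

lemma coef_diff_left: "bessel h \<Longrightarrow> bessel k \<Longrightarrow> coef (h - k) f = coef h f - coef k f"
  by (rule ell2_eqI) (simp add: Rep_coef bessel_diff minus_ell2.rep_eq pi_diff cinner_simps)

lemma coef_scaleC_left: "bessel h \<Longrightarrow> coef (a *\<^sub>C h) f = cnj a *\<^sub>C coef h f"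
  by (rule ell2_eqI) (simp add: Rep_coef bessel_scaleC scaleC_ell2.rep_eq pi_scaleC cinner_simps)

lemma coef_scaleR_left: "bessel h \<Longrightarrow> coef (r *\<^sub>R h) f = r *\<^sub>R coef h f"
  by (simp add: scaleR_scaleC coef_scaleC_left)

lemma bessel_scaleR: "bessel h \<Longrightarrow> bessel (r *\<^sub>R h)"
  by (simp add: scaleR_scaleC bessel_scaleC)

lemma coef_add: "bessel h \<Longrightarrow> coef h (f + g) = coef h f + coef h g"
  by (rule ell2_eqI) (simp add: Rep_coef plus_ell2.rep_eq cinner_simps)

lemma coef_diff: "bessel h \<Longrightarrow> coef h (f - g) = coef h f - coef h g"
  by (rule ell2_eqI) (simp add: Rep_coef minus_ell2.rep_eq cinner_simps)

lemma coef_scaleC: "bessel h \<Longrightarrow> coef h (a *\<^sub>C f) = a *\<^sub>C coef h f"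
  by (rule ell2_eqI) (simp add: Rep_coef scaleC_ell2.rep_eq cinner_simps)

lemma coef_scaleR: "bessel h \<Longrightarrow> coef h (r *\<^sub>R f) = r *\<^sub>R coef h f"
  by (simp add: scaleR_scaleC coef_scaleC)

lemma coef_0_left [simp]: "coef 0 f = 0"
  by (rule ell2_eqI) (simp add: Rep_coef zero_ell2.rep_eq)

text \<open>The mixed frame operator: formally, f is sent to the sum over \<gamma> of <f, \<pi>
  \<gamma> h> times \<pi> \<gamma> u. The weak definition avoids the convergence of that
  series.\<close>

definition pairing :: "'h \<Rightarrow> 'h \<Rightarrow> 'h \<Rightarrow> 'h" where
  "pairing h u f = (SOME v. \<forall>f'. cinner v f' = cinner (coef h f) (coef u f'))"

lemma cinner_pairing:
  assumes h: "bessel h" and u: "bessel u"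
  shows "cinner (pairing h u f) f' = cinner (coef h f) (coef u f')"
proof -
  obtain M where M: "M \<ge> 0" "\<And>f. norm (coef u f) \<le> M * norm f" using bessel_bound[OF u] by blast
  obtain v where v: "\<And>x. cinner (coef u x) (coef h f) = cinner x v"
  proof (rule riesz_representation[of "\<lambda>x. cinner (coef u x) (coef h f)" "M * norm (coef h f)"])
    fix x
    have "cmod (cinner (coef u x) (coef h f)) \<le> norm (coef u x) * norm (coef h f)" by (rule norm_cinner_le)
    also have "\<dots> \<le> (M * norm x) * norm (coef h f)" by (intro mult_right_mono M) simp
    finally show "cmod (cinner (coef u x) (coef h f)) \<le> M * norm (coef h f) * norm x" by (simp add: mult_ac)
  qed (auto simp: coef_add coef_scaleC u cinner_simps)
  have "\<exists>v. \<forall>f'. cinner v f' = cinner (coef h f) (coef u f')"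
    by (rule exI[of _ v]) (metis v cinner_commute)
  from someI_ex[OF this] show ?thesis by (simp add: pairing_def)
qed

text \<open>A relation instead of an operation: adjoints are exhibited, such as
  \<open>pairing u h\<close> for \<open>pairing h u\<close>.\<close>

definition adj :: "('h \<Rightarrow> 'h) \<Rightarrow> ('h \<Rightarrow> 'h) \<Rightarrow> bool" where
  "adj A A' \<longleftrightarrow> bounded_clinear A' \<and> (\<forall>x y. cinner (A x) y = cinner x (A' y))
    \<and> (\<forall>\<gamma>\<in>\<Gamma>. \<forall>f. A (\<pi> \<gamma> f) = \<pi> \<gamma> (A f))"

lemma cinner_adj: "adj A A' \<Longrightarrow> cinner (A x) y = cinner x (A' y)"
  by (simp add: adj_def)

text \<open>Since A commutes with each \<pi> \<gamma>, it moves across the inner product: <f, \<pi>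
  \<gamma> (A h)> = <A' f, \<pi> \<gamma> h>. So the commutant acts on Bessel vectors.\<close>

lemma adj_coef:
  assumes "adj A A'" "bessel h"
  shows "bessel (A h)" "coef (A h) f = coef h (A' f)"
proof -
  have eq: "cinner f (\<pi> \<gamma> (A h)) = cinner (A' f) (\<pi> \<gamma> h)" if "\<gamma> \<in> \<Gamma>" for \<gamma> f
    using assms(1) that by (metis adj_def cinner_commute)
  obtain M where M: "M \<ge> 0" "\<And>f. norm (coef h f) \<le> M * norm f" using bessel_bound[OF assms(2)] by blast
  obtain K where K: "K \<ge> 0" "\<And>x. norm (A' x) \<le> K * norm x"
    using assms(1) bounded_clinear_bound[of A'] by (auto simp: adj_def)
  have "norm (coef h (A' f)) \<le> (M * K) * norm f" for f
    using order_trans[OF M(2)[of "A' f"] mult_left_mono[OF K(2) M(1)]] by (simp add: mult_ac)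
  then show b: "bessel (A h)"
    by (intro besselI[of _ "M * K"] exI[of _ "coef h (A' _)"]) (auto simp: Rep_coef assms(2) eq)
  show "coef (A h) f = coef h (A' f)"
    by (rule ell2_eqI) (simp add: Rep_coef b assms(2) eq)
qed

lemma pairing_left:
  assumes "adj A A'" "bessel h" "bessel u"
  shows "pairing (A h) u f = pairing h u (A' f)"
  by (rule cinner_ext_left) (simp add: cinner_pairing adj_coef[OF assms(1,2)] assms)

lemma pairing_right:
  assumes "adj A A'" "bessel h" "bessel u"
  shows "pairing h (A u) f = A (pairing h u f)"
  by (rule cinner_ext_left) (simp add: cinner_pairing adj_coef[OF assms(1,3)] cinner_adj[OF assms(1)] assms)

lemma coef_pi:
  assumes "bessel h" "x \<in> \<Gamma>"
  shows "Rep_ell2 (coef h (\<pi> x f)) (x + \<delta>) = \<sigma> x \<delta> * Rep_ell2 (coef h f) \<delta>"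
  using assms by (simp add: Rep_coef add_mem_cancel_left pi_sum cinner_simps cinner_pi)

text \<open>By \<open>coef_pi\<close>, \<pi> x acts on both coefficient families by the same
  translation and the same unimodular factor, which cancels against its conjugate.\<close>

lemma cinner_coef_pi:
  assumes "bessel h" "bessel u" "x \<in> \<Gamma>"
  shows "cinner (coef h (\<pi> x f)) (coef u (\<pi> x f')) = cinner (coef h f) (coef u f')"
proof -
  let ?a = "\<lambda>\<gamma>. Rep_ell2 (coef h (\<pi> x f)) \<gamma> * cnj (Rep_ell2 (coef u (\<pi> x f')) \<gamma>)"
  have b: "bij_betw (\<lambda>\<delta>. x + \<delta>) UNIV UNIV"
    by (rule bij_betw_byWitness[of _ "\<lambda>\<delta>. - x + \<delta>"]) (auto simp: add.assoc[symmetric])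
  have "cinner (coef h (\<pi> x f)) (coef u (\<pi> x f')) = (\<Sum>\<^sub>\<infinity>\<delta>. ?a (x + \<delta>))"
    unfolding cinner_ell2.rep_eq by (rule infsum_reindex_bij_betw[OF b, symmetric])
  also have "\<dots> = (\<Sum>\<^sub>\<infinity>\<delta>. Rep_ell2 (coef h f) \<delta> * cnj (Rep_ell2 (coef u f') \<delta>))"
  proof (rule infsum_cong)
    fix \<delta>
    have "?a (x + \<delta>) = (\<sigma> x \<delta> * cnj (\<sigma> x \<delta>)) * (Rep_ell2 (coef h f) \<delta> * cnj (Rep_ell2 (coef u f') \<delta>))"
      unfolding coef_pi[OF assms(1,3)] coef_pi[OF assms(2,3)] complex_cnj_mult by (simp only: mult_ac)
    then show "?a (x + \<delta>) = Rep_ell2 (coef h f) \<delta> * cnj (Rep_ell2 (coef u f') \<delta>)" by simp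
  qed
  finally show ?thesis by (simp add: cinner_ell2.rep_eq)
qed

text \<open>The form that defines the mixed frame operator is invariant under \<Gamma> by
  \<open>cinner_coef_pi\<close>, so the operator commutes with \<pi>(\<Gamma>).\<close>

lemma pairing_pi:
  assumes "bessel h" "bessel u" "x \<in> \<Gamma>"
  shows "pairing h u (\<pi> x f) = \<pi> x (pairing h u f)"
proof (rule cinner_ext_left)
  fix g
  have "cinner (pairing h u (\<pi> x f)) (\<pi> x (inv (\<pi> x) g)) = cinner (\<pi> x (pairing h u f)) (\<pi> x (inv (\<pi> x) g))"
    unfolding cinner_pi cinner_pairing[OF assms(1,2)] cinner_coef_pi[OF assms] ..
  then show "cinner (pairing h u (\<pi> x f)) g = cinner (\<pi> x (pairing h u f)) g" by simp
qed

lemma bounded_clinear_pairing: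
  assumes h: "bessel h" and u: "bessel u"
  shows "bounded_clinear (pairing h u)"
proof -
  obtain M N where M: "M \<ge> 0" "\<And>f. norm (coef u f) \<le> M * norm f"
    and N: "N \<ge> 0" "\<And>f. norm (coef h f) \<le> N * norm f" using bessel_bound h u by metis
  show ?thesis
  proof (rule bounded_clinearI[of _ "N * M"])
    show "pairing h u (x + y) = pairing h u x + pairing h u y" for x y
      by (rule cinner_ext_left) (simp add: cinner_pairing cinner_simps coef_add h u)
    show "pairing h u (a *\<^sub>C x) = a *\<^sub>C pairing h u x" for a x
      by (rule cinner_ext_left) (simp add: cinner_pairing cinner_simps coef_scaleC h u)
    fix x
    let ?p = "pairing h u x"
    have "(norm ?p)\<^sup>2 = Re (cinner (coef h x) (coef u ?p))"
      by (simp only: Re_cinner_self[symmetric] cinner_pairing h u)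
    also have "\<dots> \<le> norm (coef h x) * norm (coef u ?p)" by (rule Re_cinner_le)
    also have "\<dots> \<le> (N * norm x) * (M * norm ?p)" by (intro mult_mono M N mult_nonneg_nonneg) auto
    finally have "norm ?p * norm ?p \<le> norm ?p * (N * M * norm x)"
      by (simp add: power2_eq_square mult_ac)
    then show "norm ?p \<le> N * M * norm x"
      using M N by (cases "norm ?p = 0") auto
  qed
qed

lemma cinner_pairing_adj:
  assumes "bessel h" "bessel u"
  shows "cinner (pairing h u f) f' = cinner f (pairing u h f')"
proof -
  have "cinner f (pairing u h f') = cnj (cinner (pairing u h f') f)" by (rule cinner_commute)
  then show ?thesis
    using assms cinner_commute[of "coef h f" "coef u f'"] by (simp add: cinner_pairing)
qed

lemma adj_pairing:
  assumes "bessel h" "bessel u"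
  shows "adj (pairing h u) (pairing u h)"
  unfolding adj_def using assms
  by (auto simp: bounded_clinear_pairing pairing_pi cinner_pairing_adj)

lemma commutant_adj:
  assumes "A \<in> commutant (\<pi> ` \<Gamma>)"
  obtains A' where "adj A A'" "adj A' A"
proof -
  have bA: "bounded_clinear A" and comm: "\<And>\<gamma> f. \<gamma> \<in> \<Gamma> \<Longrightarrow> A (\<pi> \<gamma> f) = \<pi> \<gamma> (A f)"
    using assms by (auto simp: commutant_def fun_eq_iff)
  obtain A' where A': "bounded_clinear A'" "\<And>x y. cinner (A x) y = cinner x (A' y)"
    using bounded_clinear_adjoint[OF bA] by blast
  have "A' (\<pi> \<gamma> f) = \<pi> \<gamma> (A' f)" if "\<gamma> \<in> \<Gamma>" for \<gamma> f
  proof (rule cinner_ext_right)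
    fix g
    have "cinner (\<pi> \<gamma> (inv (\<pi> \<gamma>) g)) (A' (\<pi> \<gamma> f)) = cinner (\<pi> \<gamma> (inv (\<pi> \<gamma>) g)) (\<pi> \<gamma> (A' f))"
      unfolding cinner_pi A'(2)[symmetric] comm[OF that] ..
    then show "cinner g (A' (\<pi> \<gamma> f)) = cinner g (\<pi> \<gamma> (A' f))" by simp
  qed
  moreover have "cinner (A' x) y = cinner x (A y)" for x y
    using A'(2)[of y x] cinner_commute[of "A' x" y] cinner_commute[of x "A y"] by simp
  ultimately have "adj A' A" "adj A A'" using A' bA comm by (simp_all add: adj_def)
  then show thesis using that by blast
qed

lemma bbound_1_norm: "bbound 1 g \<Longrightarrow> norm g \<le> 1"
proof -
  assume "bbound 1 g"
  \<comment> \<open>The single coefficient at 0, tested on g itself, bounds the fourth power of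
    \<open>norm g\<close> by its square.\<close>
  from this[unfolded bbound_def, rule_format, of "{0}" g]
  have "(norm g)\<^sup>2 * (norm g)\<^sup>2 \<le> 1 * (norm g)\<^sup>2"
    by (simp add: pi_zero cinner_self power2_eq_square norm_mult)
  then have "(norm g)\<^sup>2 \<le> 1 \<or> (norm g)\<^sup>2 \<le> 0"
    by (metis mult_le_cancel_right_pos not_le)
  then show ?thesis by (auto simp: abs_square_le_1)
qed

end

context projective_orbit
begin

lemma cinner_pairing_self: "bessel h \<Longrightarrow> cinner (pairing h h f) f = complex_of_real ((norm (coef h f))\<^sup>2)"
  by (simp only: cinner_pairing cinner_self)

lemma Re_pairing_self: "bessel h \<Longrightarrow> Re (cinner (pairing h h f) f) = (norm (coef h f))\<^sup>2"
  by (simp add: cinner_pairing_self)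

lemma bessel_extremal_maximizer:
  obtains u where "bbound 1 u" "\<And>g. bbound 1 g \<Longrightarrow> Re (cinner g k) \<le> Re (cinner u k)"
    "\<And>h. bbound 1 (u + h) \<Longrightarrow> bbound 1 (u - h) \<Longrightarrow> h = 0"
proof -
  \<comment> \<open>Moving \<pi> \<gamma> to the argument turns each constraint into one on finitely
    many values of \<phi>, hence closed under pointwise limits.\<close>
  define C where "C = {\<phi> :: 'h \<Rightarrow> complex. \<forall>f F. finite F \<and> F \<subseteq> \<Gamma> \<longrightarrow>
    (\<Sum>\<gamma>\<in>F. (cmod (\<phi> (inv (\<pi> \<gamma>) f)))\<^sup>2) \<le> 1 * (norm f)\<^sup>2}"
  have C: "closed C"
    unfolding C_def by (intro closed_Collect_all closed_Collect_imp open_Collect_const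
      closed_Collect_le continuous_on_sum continuous_on_power continuous_on_norm continuous_on_eval
      continuous_on_const)
  have B: "{g. bbound 1 g} = {g. (\<lambda>f. cinner f g) \<in> C}"
    by (simp add: C_def bbound_def cinner_pi_right)
  have 0: "{g. bbound 1 g} \<noteq> {}"
    by (auto simp: bbound_def intro: exI[of _ 0])
  show thesis
    by (rule extremal_maximizer[OF C B _ 0, of 1 k]) (use bbound_1_norm that in auto)
qed

end

section \<open>The extremal Bessel vector and its frame operator\<close>

locale polar_part = projective_orbit +
  fixes k u
  assumes bb: "bbound 1 u"
    and maximal: "\<And>g. bbound 1 g \<Longrightarrow> Re (cinner g k) \<le> Re (cinner u k)"
    and extreme: "\<And>h. bbound 1 (u + h) \<Longrightarrow> bbound 1 (u - h) \<Longrightarrow> h = 0"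
begin

lemma bessel_u [simp]: "bessel u" using bb by (rule bbound_bessel)

abbreviation X where "X \<equiv> pairing u u"

lemma norm_coef_u: "norm (coef u f) \<le> norm f"
  using bbound_iff[of u 1] bb by (auto intro: power2_le_imp_le)

lemma norm_X_le: "norm (X f) \<le> norm f"
proof -
  have "(norm (X f))\<^sup>2 = Re (cinner (coef u f) (coef u (X f)))"
    by (simp only: Re_cinner_self[symmetric] cinner_pairing bessel_u)
  also have "\<dots> \<le> norm (coef u f) * norm (coef u (X f))" by (rule Re_cinner_le)
  also have "\<dots> \<le> norm f * norm (X f)" by (intro mult_mono norm_coef_u) auto
  finally show ?thesis by (cases "norm (X f) = 0") (auto simp: power2_eq_square)
qed

lemma X_sym: "cinner (X f) g = cinner f (X g)" by (simp add: cinner_pairing_adj)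

lemma X_add: "X (f + g) = X f + X g" and X_scaleC: "X (a *\<^sub>C f) = a *\<^sub>C X f"
  using bounded_clinear_pairing[of u u] by (simp_all add: bounded_clinear_add bounded_clinear_scaleC)

lemma X_diff: "X (f - g) = X f - X g"
  by (metis X_add add_diff_cancel diff_add_cancel)

lemma X_scaleR: "X (r *\<^sub>R f) = r *\<^sub>R X f" by (simp add: scaleR_scaleC X_scaleC)

lemma Re_X: "Re (cinner (X f) f) = (norm (coef u f))\<^sup>2"
  by (simp add: Re_pairing_self)

lemma coef_Xu: "coef (X h) f = coef h (X f)" if "bessel h"
  using adj_coef(2)[OF adj_pairing that, of u u] by simp

lemma bessel_X: "bessel h \<Longrightarrow> bessel (X h)"
  using adj_coef(1)[OF adj_pairing, of u u] by simp

text \<open>The perturbation \<open>u \<plusminus> (u - X u) / 2\<close> is a Newton--Schulz step towards the polar part; it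
  stays in the unit ball because \<open>1 - x (3 - x)\<^sup>2 / 4 = (1 - x)\<^sup>2 (4 - x) / 4\<close>.\<close>

lemma X_u: "X u = u"
proof -
  define h where "h = (1/2) *\<^sub>R (u - X u)"
  have bh: "bessel h" by (simp add: h_def bessel_scaleR bessel_diff bessel_X)
  have coefh: "coef h f = coef u ((1/2) *\<^sub>R (f - X f))" for f
    by (simp add: h_def coef_scaleR_left coef_diff_left bessel_diff bessel_X coef_Xu coef_scaleR coef_diff)
  have "bbound 1 (u + h)"
  proof (subst bbound_iff, simp add: bessel_add bh, intro allI)
    fix f
    define e where "e = f - X f"
    have f: "f = X f + e" by (simp add: e_def)
    have "coef (u + h) f = coef u (f + (1/2) *\<^sub>R e)"
      by (simp add: coef_add_left bh coefh coef_add e_def)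
    then have "(norm (coef (u + h) f))\<^sup>2 = Re (cinner (X (f + (1/2) *\<^sub>R e)) (f + (1/2) *\<^sub>R e))"
      by (simp only: Re_X)
    also have "\<dots> = Re (cinner (X f) f) + Re (cinner (X f) e) + 1/4 * Re (cinner (X e) e)"
    proof -
      have "Re (cinner (X e) f) = Re (cinner (X f) e)" by (simp only: X_sym[of f e] Re_cinner_commute[of f "X e"])
      then show ?thesis by (simp add: X_add X_scaleR cinner_simps add_divide_distrib)
    qed
    \<comment> \<open>With e = (1 - X) f this is the quadratic form of x (3 - x)^2 / 4 = 1 - (1 -
      x)^2 + x (1 - x)^2 / 4; the last term is dominated because X is a contraction.\<close>
    also have "\<dots> = (norm f)\<^sup>2 - (norm e)\<^sup>2 + 1/4 * Re (cinner (X e) e)"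
    proof -
      have "(norm e)\<^sup>2 = (norm f)\<^sup>2 - Re (cinner (X f) f) - Re (cinner (X f) e)"
      proof -
        have "(norm e)\<^sup>2 = Re (cinner f e) - Re (cinner (X f) e)"
          by (simp only: Re_cinner_self[symmetric]) (simp add: e_def cinner_simps)
        moreover have "Re (cinner f e) = (norm f)\<^sup>2 - Re (cinner (X f) f)"
          by (simp add: e_def cinner_simps Re_cinner_commute[of f])
        ultimately show ?thesis by simp
      qed
      then show ?thesis by simp
    qed
    also have "\<dots> \<le> (norm f)\<^sup>2"
      using power_mono[OF norm_coef_u[of e] norm_ge_zero, of 2] Re_X[of e] zero_le_power2[of "norm e"] by linarith
    finally show "(norm (coef (u + h) f))\<^sup>2 \<le> 1 * (norm f)\<^sup>2" by simp
  qed
  moreover have "bbound 1 (u - h)"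
  proof (subst bbound_iff, simp add: bessel_diff bh, intro allI)
    fix f
    \<comment> \<open>On this side the analysis operator is the average of 1 and X followed by
      \<open>coef u\<close>, a composition of contractions.\<close>
    have "2 *\<^sub>R (f - (1/2) *\<^sub>R (f - X f)) = 2 *\<^sub>R ((1/2) *\<^sub>R (f + X f))"
      by (simp add: scaleR_diff_right scaleR_2)
    then have "f - (1/2) *\<^sub>R (f - X f) = (1/2) *\<^sub>R (f + X f)" by (simp only: scaleR_cancel_left) simp
    then have "coef (u - h) f = coef u ((1/2) *\<^sub>R (f + X f))"
      by (simp add: coef_diff_left bh coefh flip: coef_diff)
    then have "norm (coef (u - h) f) \<le> norm ((1/2) *\<^sub>R (f + X f))" by (simp only: norm_coef_u)
    also have "\<dots> \<le> norm f" using norm_triangle_ineq[of f "X f"] norm_X_le[of f] by simp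
    finally show "(norm (coef (u - h) f))\<^sup>2 \<le> 1 * (norm f)\<^sup>2" by (simp add: power_mono)
  qed
  ultimately have "h = 0" by (rule extreme)
  then show ?thesis by (simp add: h_def)
qed

text \<open>As X is in the commutant, \<open>pairing u (X u)\<close> is the square of X, and X u =
  u. So \<open>coef u\<close> is a partial isometry with initial projection X.\<close>

lemma X_X: "X (X f) = X f"
  using pairing_right[OF adj_pairing[OF bessel_u bessel_u] bessel_u bessel_u, of f] by (simp add: X_u)

lemma coef_u_sq: "(norm (coef u f))\<^sup>2 = (norm (X f))\<^sup>2"
proof -
  have "(norm (coef u f))\<^sup>2 = Re (cinner (X (X f)) f)" by (simp only: Re_X X_X)
  also have "\<dots> = (norm (X f))\<^sup>2" by (simp only: X_sym[of "X f"] Re_cinner_self)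
  finally show ?thesis .
qed

lemma norm_split: "(norm f)\<^sup>2 = (norm (X f))\<^sup>2 + (norm (f - X f))\<^sup>2"
proof -
  have "cinner (X f) (f - X f) = 0" by (simp add: X_sym X_diff X_X)
  then show ?thesis using norm_add_sq[of "X f" "f - X f"] by simp
qed

text \<open>If X h = 0, then \<open>coef h\<close> kills the range of X, because
  \<open>coef h (X f) = coef (X h) f\<close>.\<close>

lemma coef_compl: "bessel h \<Longrightarrow> X h = 0 \<Longrightarrow> coef h f = coef h (f - X f)"
  using coef_Xu[of h f] by (simp add: coef_diff)

lemma cinner_coef_zero: "bessel h \<Longrightarrow> (\<And>f. pairing h u f = 0) \<Longrightarrow> cinner (coef h f) (coef u f') = 0"
  by (simp flip: cinner_pairing)

text \<open>\<open>coef u\<close> sees only X f and \<open>coef h\<close> only f - X f, so after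
  shrinking h the two squared norms fit into the orthogonal splitting of f.\<close>

lemma corner_contraction:
  assumes h: "bessel h" and X0: "X h = 0"
  obtains t where "t > 0" "\<And>f. (norm (coef u f))\<^sup>2 + (norm (t *\<^sub>R coef h f))\<^sup>2 \<le> (norm f)\<^sup>2"
proof -
  obtain M where M: "M \<ge> 0" "\<And>f. norm (coef h f) \<le> M * norm f" using bessel_bound[OF h] by blast
  define t where "t = 1 / (M + 1)"
  have t: "t > 0" "t * M \<le> 1" using M by (auto simp: t_def field_simps)
  have "(norm (coef u f))\<^sup>2 + (norm (t *\<^sub>R coef h f))\<^sup>2 \<le> (norm f)\<^sup>2" for f
  proof -
    have "norm (t *\<^sub>R coef h f) = t * norm (coef h (f - X f))" using t coef_compl[OF h X0, of f] by simp
    also have "\<dots> \<le> t * (M * norm (f - X f))" using t M by (intro mult_left_mono) auto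
    also have "\<dots> \<le> norm (f - X f)" using mult_right_mono[OF t(2), of "norm (f - X f)"] by (simp add: mult_ac)
    finally show ?thesis
      using norm_split[of f] coef_u_sq[of f] by (simp add: power_mono)
  qed
  with t(1) show thesis using that by blast
qed

text \<open>Kadison's criterion for extreme points in vector form. X h = 0 makes the initial spaces
  of \<open>coef u\<close> and \<open>coef h\<close> orthogonal, the vanishing pairing does this for
  their ranges, so a small multiple of h may be added to and subtracted from u.\<close>

lemma corner_trivial:
  assumes h: "bessel h" and X0: "X h = 0" and p0: "\<And>f. pairing h u f = 0"
  shows "h = 0"
proof -
  obtain t where t: "t > 0" and le: "\<And>f. (norm (coef u f))\<^sup>2 + (norm (t *\<^sub>R coef h f))\<^sup>2 \<le> (norm f)\<^sup>2"
    using corner_contraction[OF h X0] by blast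
  have z: "Re (cinner (coef u f) (t *\<^sub>R coef h f)) = 0" for f
    using cinner_coef_zero[OF h p0, of f f] by (simp add: cinner_simps Re_cinner_commute[of "coef u f"])
  have "bbound 1 (u + t *\<^sub>R h)" "bbound 1 (u - t *\<^sub>R h)"
    using le by (simp_all add: bbound_iff bessel_add bessel_diff bessel_scaleR h coef_add_left
      coef_diff_left coef_scaleR_left norm_add_sq norm_diff_sq z del: norm_scaleR)
  then have "t *\<^sub>R h = 0" by (rule extreme)
  then show ?thesis using t by simp
qed

text \<open>Dividing u + t h by sqrt (1 + t^2 m) returns it to the unit ball, where maximality of u
  applies for both signs of t.\<close>

lemma first_variation:
  assumes h: "bessel h" and m: "m \<ge> 0"
    and le: "\<And>t f. (norm (coef u f + t *\<^sub>R coef h f))\<^sup>2 \<le> (1 + t\<^sup>2 * m) * (norm f)\<^sup>2"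
  shows "Re (cinner h k) = 0"
proof (rule le_sqrt_imp_zero[OF _ m])
  show "Re (cinner u k) \<ge> 0" using maximal[of 0] by (simp add: bbound_def)
  fix t :: real
  define s where "s = sqrt (1 + t\<^sup>2 * m)"
  have s2: "s\<^sup>2 = 1 + t\<^sup>2 * m" using m by (simp add: s_def)
  have s: "s > 0" using m by (simp add: s_def add_pos_nonneg)
  have "bbound 1 ((1/s) *\<^sub>R (u + t *\<^sub>R h))"
  proof (subst bbound_iff, simp add: bessel_scaleR bessel_add h, intro allI)
    fix f
    have "(norm (coef ((1/s) *\<^sub>R (u + t *\<^sub>R h)) f))\<^sup>2 = (norm (coef u f + t *\<^sub>R coef h f))\<^sup>2 / s\<^sup>2"
      using s by (simp add: coef_scaleR_left bessel_add bessel_scaleR h coef_add_left power_divide)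
    also have "\<dots> \<le> (norm f)\<^sup>2"
      using le[of f t] s unfolding s2[symmetric] by (simp add: divide_le_eq mult.commute)
    finally show "(norm (coef ((1/s) *\<^sub>R (u + t *\<^sub>R h)) f))\<^sup>2 \<le> 1 * (norm f)\<^sup>2" by simp
  qed
  from maximal[OF this] have "(Re (cinner u k) + t * Re (cinner h k)) / s \<le> Re (cinner u k)"
    by (simp add: cinner_simps add_divide_distrib)
  then show "Re (cinner u k) + t * Re (cinner h k) \<le> sqrt (1 + t\<^sup>2 * m) * Re (cinner u k)"
    using s by (simp add: divide_le_eq mult.commute s_def)
qed

lemma Re_cinner_zeroI:
  assumes "\<And>a. Re (cinner (a *\<^sub>C h) k) = 0" shows "cinner h k = 0"
  using assms[of 1] assms[of \<i>] by (simp add: cinner_simps complex_eq_iff)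

text \<open>The vanishing pairing removes the cross term, so perturbing u along h changes the
  squared bound only by a multiple of t^2.\<close>

lemma orthogonal_right:
  assumes h: "bessel h" and p0: "\<And>f. pairing h u f = 0"
  shows "cinner h k = 0"
proof (rule Re_cinner_zeroI)
  fix a
  let ?h = "a *\<^sub>C h"
  have bh: "bessel ?h" by (simp add: bessel_scaleC h)
  obtain M where M: "M \<ge> 0" "\<And>f. norm (coef ?h f) \<le> M * norm f" using bessel_bound[OF bh] by blast
  show "Re (cinner ?h k) = 0"
  proof (rule first_variation[OF bh, of "M\<^sup>2"])
    fix t :: real and f
    have "Re (cinner (coef u f) (t *\<^sub>R coef ?h f)) = 0"
      using cinner_coef_zero[OF h p0, of f f] cinner_eq_zero_commute[of "coef u f" "coef h f"]
      by (simp add: cinner_simps coef_scaleC_left h)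
    then have "(norm (coef u f + t *\<^sub>R coef ?h f))\<^sup>2 = (norm (coef u f))\<^sup>2 + t\<^sup>2 * (norm (coef ?h f))\<^sup>2"
      by (simp add: norm_add_sq power_mult_distrib)
    also have "\<dots> \<le> (norm f)\<^sup>2 + t\<^sup>2 * (M * norm f)\<^sup>2"
      using M by (intro add_mono power_mono mult_left_mono norm_coef_u) auto
    finally show "(norm (coef u f + t *\<^sub>R coef ?h f))\<^sup>2 \<le> (1 + t\<^sup>2 * M\<^sup>2) * (norm f)\<^sup>2"
      by (simp add: power_mult_distrib algebra_simps)
  qed simp
qed

text \<open>Here the ranges in \<open>ell2\<close> may overlap, but \<open>coef u\<close> and
  \<open>coef h\<close> act on orthogonal parts of f, which again gives a bound quadratic in
  t.\<close>

lemma orthogonal_left: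
  assumes h: "bessel h" and X0: "X h = 0"
  shows "cinner h k = 0"
proof (rule Re_cinner_zeroI)
  fix a
  let ?h = "a *\<^sub>C h"
  have bh: "bessel ?h" and X0': "X ?h = 0" by (simp_all add: bessel_scaleC h X_scaleC X0)
  obtain M where M: "M \<ge> 0" "\<And>f. norm (coef ?h f) \<le> M * norm f" using bessel_bound[OF bh] by blast
  show "Re (cinner ?h k) = 0"
  proof (rule first_variation[OF bh, of "M\<^sup>2"])
    fix t :: real and f
    let ?x = "norm (X f)" and ?y = "norm (f - X f)"
    have "norm (t *\<^sub>R coef ?h f) \<le> \<bar>t\<bar> * (M * ?y)"
      using M(2)[of "f - X f"] coef_compl[OF bh X0', of f] by (simp add: mult_left_mono)
    moreover have "norm (coef u f) = ?x" using coef_u_sq[of f] by (simp add: power2_eq_iff_nonneg)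
    ultimately have "norm (coef u f + t *\<^sub>R coef ?h f) \<le> ?x + \<bar>t\<bar> * (M * ?y)"
      using norm_triangle_ineq[of "coef u f" "t *\<^sub>R coef ?h f"] by linarith
    then have "(norm (coef u f + t *\<^sub>R coef ?h f))\<^sup>2 \<le> (?x + \<bar>t\<bar> * (M * ?y))\<^sup>2" by (intro power_mono) auto
    \<comment> \<open>The added square is the defect in Cauchy-Schwarz for the pairs (1, |t| M) and
      (?x, ?y); Lagrange's identity factors the sum.\<close>
    also have "\<dots> \<le> (?x + \<bar>t\<bar> * (M * ?y))\<^sup>2 + (\<bar>t\<bar> * M * ?x - ?y)\<^sup>2" by simp
    also have "\<dots> = (1 + \<bar>t\<bar>\<^sup>2 * M\<^sup>2) * (?x\<^sup>2 + ?y\<^sup>2)" by algebra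
    finally show "(norm (coef u f + t *\<^sub>R coef ?h f))\<^sup>2 \<le> (1 + t\<^sup>2 * M\<^sup>2) * (norm f)\<^sup>2"
      by (simp add: norm_split[of f])
  qed simp
qed

text \<open>With P the projection onto the range of \<open>coef u\<close>, the analysis operator of
  \<open>pairing u h u\<close> is \<open>coef h\<close> followed by P. Subtracting leaves the part
  of \<open>coef h\<close> in the range of 1 - P, which the adjoint of \<open>coef u\<close>
  kills.\<close>

lemma pairing_compl:
  assumes h: "bessel h"
  shows "bessel (h - pairing u h u)" "pairing (h - pairing u h u) u f = 0"
proof -
  have a: "adj (pairing u h) (pairing h u)" using h by (simp add: adj_pairing)
  show b: "bessel (h - pairing u h u)" by (simp add: bessel_diff h adj_coef(1)[OF a])
  show "pairing (h - pairing u h u) u f = 0"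
  proof (rule cinner_eq_0_imp_0)
    fix g
    have "X (pairing h u f) = pairing h u f"
      using pairing_right[OF adj_pairing[OF bessel_u bessel_u] h bessel_u, of f] by (simp add: X_u)
    moreover have "pairing (pairing u h u) u f = X (pairing h u f)"
      by (rule pairing_left[OF a bessel_u bessel_u])
    ultimately show "cinner (pairing (h - pairing u h u) u f) g = 0"
      using cinner_pairing[OF adj_coef(1)[OF a bessel_u] bessel_u, of f g] cinner_pairing[OF h bessel_u, of f g]
      by (simp add: cinner_pairing b coef_diff_left h adj_coef(1)[OF a] cinner_simps)
  qed
qed

text \<open>The remainder \<open>v - pairing u v u\<close> meets both hypotheses of
  \<open>corner_trivial\<close>: X kills it because X v = 0, and its pairing with u vanishes by
  \<open>pairing_compl\<close>.\<close>

lemma complement_expansion: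
  assumes v: "bessel v" and X0: "X v = 0"
  shows "v = pairing u v u"
proof -
  have "X (pairing u v u) = pairing u (X v) u"
    using pairing_right[OF adj_pairing[OF bessel_u bessel_u] bessel_u v, of u] by simp
  also have "\<dots> = 0"
    by (rule cinner_eq_0_imp_0) (simp add: X0 cinner_pairing)
  finally have "X (v - pairing u v u) = 0" by (simp add: X_diff X0)
  from corner_trivial[OF pairing_compl(1)[OF v] this pairing_compl(2)[OF v]] show ?thesis by simp
qed

end

section \<open>Kleppner's condition\<close>

lift_definition ell2_delta :: "'a \<Rightarrow> 'a ell2" is "\<lambda>i j. if j = i then 1 else 0"
proof -
  fix i :: 'a
  have "(\<lambda>j. (cmod (if j = i then 1 else 0))\<^sup>2) summable_on {i}" by simp
  then show "(\<lambda>j. (cmod (if j = i then 1 else 0))\<^sup>2) summable_on UNIV"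
    by (rule summable_on_cong_neutral[THEN iffD1, rotated -1]) auto
qed

lemma cinner_ell2_delta: "cinner a (ell2_delta i) = Rep_ell2 a i"
proof -
  have "cinner a (ell2_delta i) = (\<Sum>\<^sub>\<infinity>j\<in>{i}. Rep_ell2 a j)"
    unfolding cinner_ell2.rep_eq by (rule infsum_cong_neutral) (auto simp: ell2_delta.rep_eq)
  then show ?thesis by simp
qed

context projective_orbit
begin

lemma bessel_pi:
  assumes "bessel h" "x \<in> \<Gamma>" shows "bessel (\<pi> x h)"
proof -
  obtain M where M: "bbound M h" using assms(1) by (auto simp: bessel_def)
  have "bbound M (\<pi> x h)"
    unfolding bbound_def
  proof (intro allI impI)
    fix f F assume F: "finite F \<and> F \<subseteq> \<Gamma>"
    have "(\<Sum>\<gamma>\<in>F. (cmod (cinner f (\<pi> \<gamma> (\<pi> x h))))\<^sup>2) = (\<Sum>\<gamma>\<in>F. (cmod (cinner f (\<pi> (\<gamma> + x) h)))\<^sup>2)"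
      by (simp add: pi_pi cinner_simps norm_mult cmod_sigma)
    also have "\<dots> = (\<Sum>\<gamma>\<in>(\<lambda>\<gamma>. \<gamma> + x) ` F. (cmod (cinner f (\<pi> \<gamma> h)))\<^sup>2)"
      by (subst sum.reindex) (auto simp: inj_on_def)
    also have "\<dots> \<le> M * (norm f)\<^sup>2"
      using M F assms(2) by (auto simp: bbound_def add_mem intro!: M[unfolded bbound_def, rule_format])
    finally show "(\<Sum>\<gamma>\<in>F. (cmod (cinner f (\<pi> \<gamma> (\<pi> x h))))\<^sup>2) \<le> M * (norm f)\<^sup>2" .
  qed
  then show ?thesis by (rule bbound_bessel)
qed

lemma bessel_inv_pi: "bessel h \<Longrightarrow> x \<in> \<Gamma> \<Longrightarrow> bessel (inv (\<pi> x) h)"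
  by (simp add: inv_pi bessel_scaleC bessel_pi uminus_mem)

lemma conj_mem: "x \<in> \<Gamma> \<Longrightarrow> - x + y + x \<in> \<Gamma> \<longleftrightarrow> y \<in> \<Gamma>"
  by (metis add_mem add_mem_cancel_left diff_mem uminus_mem add_diff_cancel add.assoc)

lemma bij_conj: "bij (\<lambda>\<gamma>::'g. x + \<gamma> - x)"
  by (rule bij_betw_byWitness[of _ "\<lambda>\<gamma>. - x + \<gamma> + x"]) (auto simp: add.assoc diff_conv_add_uminus simp del: add_uminus_conv_diff)

lemma bij_conj': "bij (\<lambda>\<gamma>::'g. - x + \<gamma> + x)"
  using bij_conj[of "- x"] by simp

text \<open>The scalar in \<open>\<pi> x (\<pi> \<gamma> (inv (\<pi> x) v)) = phase x \<gamma>
  *\<^sub>C \<pi> (x + \<gamma> - x) v\<close>, that is, the twist picked up by \<gamma> under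
  conjugation by x.\<close>

definition phase :: "'g \<Rightarrow> 'g \<Rightarrow> complex" where
  "phase x \<gamma> = \<sigma> x \<gamma> * cnj (\<sigma> (x + \<gamma> - x) x)"

lemma cmod_phase: "cmod (phase x \<gamma>) = 1"
  by (simp add: phase_def norm_mult cmod_sigma)

lemma phase_cinner:
  "phase x \<gamma> * cinner (\<pi> (x + \<gamma> - x) v) f = cinner (\<pi> \<gamma> (inv (\<pi> x) v)) (inv (\<pi> x) f)"
proof -
  let ?w = "inv (\<pi> x) v"
  have "\<pi> (x + \<gamma> - x) v = \<pi> (x + \<gamma> - x) (\<pi> x ?w)" by simp
  also have "\<dots> = \<sigma> (x + \<gamma> - x) x *\<^sub>C \<pi> (x + \<gamma>) ?w" by (subst pi_pi) simp
  also have "\<dots> = (\<sigma> (x + \<gamma> - x) x * cnj (\<sigma> x \<gamma>)) *\<^sub>C \<pi> x (\<pi> \<gamma> ?w)"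
    by (simp add: pi_sum scaleC_scaleC)
  finally have "phase x \<gamma> * cinner (\<pi> (x + \<gamma> - x) v) f
      = (\<sigma> x \<gamma> * cnj (\<sigma> x \<gamma>)) * (\<sigma> (x + \<gamma> - x) x * cnj (\<sigma> (x + \<gamma> - x) x)) * cinner (\<pi> x (\<pi> \<gamma> ?w)) f"
    unfolding phase_def by (simp only: cinner_scaleC_left mult_ac)
  then show ?thesis by (simp add: cinner_pi_left)
qed

text \<open>The element of \<open>V\<close> closest to \<open>ell2_delta 0\<close> is invariant under the twisted conjugation
  action of \<open>\<Gamma>\<close>, so by Kleppner's condition it is a multiple of \<open>ell2_delta 0\<close>.\<close>

lemma kleppner_annihilator:
  assumes kl: "kleppner_condition \<sigma> \<Gamma>"
    and vb: "\<And>v. v \<in> W \<Longrightarrow> bessel v"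
    and vi: "\<And>v x. v \<in> W \<Longrightarrow> x \<in> \<Gamma> \<Longrightarrow> inv (\<pi> x) v \<in> W"
    and ne: "w \<in> W" "w \<noteq> 0"
    and a: "\<And>\<gamma>. \<gamma> \<notin> \<Gamma> \<Longrightarrow> Rep_ell2 a \<gamma> = 0" "\<And>v f. v \<in> W \<Longrightarrow> cinner a (coef v f) = 0"
  shows "Rep_ell2 a 0 = 0"
proof -
  define V where "V = {a. (\<forall>\<gamma>\<in>-\<Gamma>. cinner a (ell2_delta \<gamma>) = 0) \<and> (\<forall>v\<in>W. \<forall>f. cinner a (coef v f) = 0)}"
  have V: "csubspace V" by (auto simp: V_def csubspace_iff cinner_simps)
  have "V = (\<Inter>\<gamma>\<in>-\<Gamma>. {a. cinner a (ell2_delta \<gamma>) = 0}) \<inter> (\<Inter>v\<in>W. \<Inter>f. {a. cinner a (coef v f) = 0})"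
    by (auto simp: V_def)
  then have cV: "closed V" by (simp only:) (intro closed_Int closed_INT ballI closed_orthogonal)
  obtain z where z: "z \<in> V" "\<And>v. v \<in> V \<Longrightarrow> cinner (ell2_delta 0 - z) v = 0"
    using csubspace_projection[OF V cV] by blast
  have zout: "Rep_ell2 z \<gamma> = 0" if "\<gamma> \<notin> \<Gamma>" for \<gamma>
    using z(1) that by (auto simp: V_def cinner_ell2_delta)
  have inv: "Rep_ell2 z (x + \<gamma> - x) = phase x \<gamma> * Rep_ell2 z \<gamma>" if x: "x \<in> \<Gamma>" for x \<gamma>
  proof -
    \<comment> \<open>The twisted conjugate of z by x. It has the norm of z, lies in V because W is
      invariant, and keeps the coordinate at 0, where the phase is 1; so it is another closest
      point.\<close>
    define b where "b y = phase x (- x + y + x) * Rep_ell2 z (- x + y + x)" for y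
    have b2: "(cmod (b y))\<^sup>2 = (cmod (Rep_ell2 z (- x + y + x)))\<^sup>2" for y
      by (simp add: b_def norm_mult cmod_phase)
    have "(\<lambda>y. (cmod (b y))\<^sup>2) summable_on UNIV"
      unfolding b2 using summable_on_reindex_bij_betw[OF bij_conj'[of x], of "\<lambda>y. (cmod (Rep_ell2 z y))\<^sup>2"]
        ell2_summable[of z] by simp
    then have Rb: "Rep_ell2 (Abs_ell2 b) = b" by (simp add: Abs_ell2_inverse)
    have bc: "b (x + \<gamma> - x) = phase x \<gamma> * Rep_ell2 z \<gamma>" for \<gamma>
    proof -
      have "- x + (x + \<gamma> - x) + x = \<gamma>" by (simp add: add.assoc diff_conv_add_uminus del: add_uminus_conv_diff)
      then show ?thesis by (simp add: b_def)
    qed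
    have nrm: "norm (Abs_ell2 b) = norm z"
    proof -
      have "(norm (Abs_ell2 b))\<^sup>2 = (norm z)\<^sup>2"
        unfolding ell2_norm_sq Rb b2
        by (rule infsum_reindex_bij_betw[OF bij_conj'[of x], of "\<lambda>y. (cmod (Rep_ell2 z y))\<^sup>2"])
      then show ?thesis by (simp add: power2_eq_iff_nonneg)
    qed
    have "Abs_ell2 b \<in> V"
      unfolding V_def
    proof (intro CollectI conjI ballI allI)
      fix \<gamma> assume "\<gamma> \<in> - \<Gamma>"
      then show "cinner (Abs_ell2 b) (ell2_delta \<gamma>) = 0"
        using conj_mem[OF x, of \<gamma>] by (simp add: cinner_ell2_delta Rb b_def zout)
    next
      fix v f assume v: "v \<in> W"
      let ?w = "inv (\<pi> x) v" and ?f = "inv (\<pi> x) f"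
      have "cinner (Abs_ell2 b) (coef v f) = (\<Sum>\<^sub>\<infinity>y. b y * cnj (Rep_ell2 (coef v f) y))"
        by (simp add: cinner_ell2.rep_eq Rb)
      also have "\<dots> = (\<Sum>\<^sub>\<infinity>\<gamma>. b (x + \<gamma> - x) * cnj (Rep_ell2 (coef v f) (x + \<gamma> - x)))"
        by (rule infsum_reindex_bij_betw[OF bij_conj[of x], symmetric])
      also have "\<dots> = (\<Sum>\<^sub>\<infinity>\<gamma>. Rep_ell2 z \<gamma> * cnj (Rep_ell2 (coef ?w ?f) \<gamma>))"
      proof (rule infsum_cong)
        fix \<gamma>
        show "b (x + \<gamma> - x) * cnj (Rep_ell2 (coef v f) (x + \<gamma> - x)) = Rep_ell2 z \<gamma> * cnj (Rep_ell2 (coef ?w ?f) \<gamma>)"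
        proof (cases "\<gamma> \<in> \<Gamma>")
          case True
          then have "x + \<gamma> - x \<in> \<Gamma>" using x by (simp add: add_mem diff_mem)
          then show ?thesis
            using True x v phase_cinner[of x \<gamma> v f]
            by (simp add: bc Rep_coef vb bessel_inv_pi cinner_commute[of _ "\<pi> _ _", symmetric] mult_ac
              flip: cinner_commute)
        next
          case False
          then show ?thesis by (simp add: bc zout)
        qed
      qed
      also have "\<dots> = cinner z (coef ?w ?f)" by (simp add: cinner_ell2.rep_eq)
      also have "\<dots> = 0" using z(1) vi[OF v x] by (auto simp: V_def)
      finally show "cinner (Abs_ell2 b) (coef v f) = 0" .
    qed
    moreover have "norm (ell2_delta 0 - Abs_ell2 b) \<le> norm (ell2_delta 0 - z)"
    proof -
      have "b 0 = Rep_ell2 z 0" by (simp add: b_def phase_def sigma_zero)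
      then have "Re (cinner (ell2_delta 0) (Abs_ell2 b)) = Re (cinner (ell2_delta 0) z)"
        by (simp add: Re_cinner_commute[of "ell2_delta 0"] cinner_ell2_delta Rb)
      then have "(norm (ell2_delta 0 - Abs_ell2 b))\<^sup>2 \<le> (norm (ell2_delta 0 - z))\<^sup>2"
        by (simp add: norm_diff_sq nrm)
      then show ?thesis by (rule power2_le_imp_le) simp
    qed
    ultimately have "Abs_ell2 b = z" using closest_point_unique[OF V z] by blast
    then show ?thesis using bc[of \<gamma>] Rb by simp
  qed
  have zero: "Rep_ell2 z \<gamma> = 0" if \<gamma>: "\<gamma> \<in> \<Gamma> - {0}" for \<gamma>
  proof (cases "\<forall>x\<in>\<Gamma>. x + \<gamma> = \<gamma> + x \<longrightarrow> \<sigma> \<gamma> x = \<sigma> x \<gamma>")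
    case True
    then have inf: "infinite {x + \<gamma> - x | x. x \<in> \<Gamma>}" using kl \<gamma> by (simp add: kleppner_condition_def)
    show ?thesis
    proof (rule ccontr)
      assume nz: "Rep_ell2 z \<gamma> \<noteq> 0"
      let ?c = "(cmod (Rep_ell2 z \<gamma>))\<^sup>2"
      have c: "?c > 0" using nz by simp
      \<comment> \<open>The modulus of z is constant and nonzero on an infinite conjugacy class, so
        finitely many of its points already exceed the norm of z.\<close>
      obtain n :: nat where n: "real n * ?c > (norm z)\<^sup>2" using c reals_Archimedean3 by blast
      obtain F where F: "finite F" "card F = n" "F \<subseteq> {x + \<gamma> - x | x. x \<in> \<Gamma>}"
        using infinite_arbitrarily_large[OF inf] by blast
      have "(cmod (Rep_ell2 z y))\<^sup>2 = ?c" if "y \<in> F" for y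
        using F(3) that inv by (force simp: norm_mult cmod_phase)
      then have "(\<Sum>y\<in>F. (cmod (Rep_ell2 z y))\<^sup>2) = real n * ?c" using F by simp
      then show False using ell2_finite_sum_le[OF F(1), of z] n by simp
    qed
  next
    case False
    then obtain x where x: "x \<in> \<Gamma>" "x + \<gamma> = \<gamma> + x" "\<sigma> \<gamma> x \<noteq> \<sigma> x \<gamma>" by blast
    have e: "x + \<gamma> - x = \<gamma>" using x(2) by simp
    \<comment> \<open>Here x commutes with \<gamma>, so invariance says that the coordinate of z at
      \<gamma> equals itself times a phase other than 1.\<close>
    have "phase x \<gamma> \<noteq> 1"
    proof
      assume "phase x \<gamma> = 1"
      then have "\<sigma> x \<gamma> * (cnj (\<sigma> \<gamma> x) * \<sigma> \<gamma> x) = \<sigma> \<gamma> x" by (simp add: phase_def e mult.assoc[symmetric] del: sigma_cnj)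
      with x(3) show False by simp
    qed
    then show ?thesis using inv[OF x(1), of \<gamma>] by (simp add: e)
  qed
  have zd: "z = Rep_ell2 z 0 *\<^sub>C ell2_delta 0"
  proof (rule ell2_eqI)
    fix i show "Rep_ell2 z i = Rep_ell2 (Rep_ell2 z 0 *\<^sub>C ell2_delta 0) i"
      by (cases "i = 0"; cases "i \<in> \<Gamma>") (auto simp: scaleC_ell2.rep_eq ell2_delta.rep_eq zero zout)
  qed
  \<comment> \<open>Otherwise \<open>ell2_delta 0\<close> would be orthogonal to
    \<open>coef w w\<close>, whose coordinate at 0 is the squared norm of w.\<close>
  have "Rep_ell2 z 0 = 0"
  proof (rule ccontr)
    assume nz: "Rep_ell2 z 0 \<noteq> 0"
    have "cinner z (coef w w) = 0" using z(1) ne by (auto simp: V_def)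
    then have "Rep_ell2 z 0 * cinner (ell2_delta 0) (coef w w) = 0"
      by (subst (asm) zd) (simp add: cinner_simps)
    then have "cinner (coef w w) (ell2_delta 0) = 0" using nz cinner_eq_zero_commute by auto
    then have "cinner w w = 0" by (simp add: cinner_ell2_delta Rep_coef vb[OF ne(1)] pi_zero)
    then show False using ne(2) by (simp add: cinner_self)
  qed
  then have "z = 0" using zd by simp
  moreover have "a \<in> V" using a by (auto simp: V_def cinner_ell2_delta)
  ultimately have "cinner (ell2_delta 0) a = 0" using z(2)[of a] by simp
  then have "cinner a (ell2_delta 0) = 0" using cinner_eq_zero_commute by blast
  then show ?thesis by (simp add: cinner_ell2_delta)
qed

text \<open>The adjoint of \<open>coef u\<close> sends \<open>ell2_delta 0\<close> to u. So
  \<open>ell2_delta 0 - coef u u\<close> is 1 - P applied to \<open>ell2_delta 0\<close>, and its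
  coordinate at 0, which is 1 minus the squared norm of u, acts as the trace of 1 - P.\<close>

lemma cinner_delta_coef:
  assumes "bessel u" "bessel v"
  shows "cinner (ell2_delta 0 - coef u u) (coef v f) = cinner (v - pairing u v u) f"
proof -
  have "cinner (ell2_delta 0) (coef v f) = cnj (Rep_ell2 (coef v f) 0)"
    using cinner_commute[of "ell2_delta 0" "coef v f"] by (simp add: cinner_ell2_delta)
  also have "\<dots> = cinner v f"
    using cinner_commute[of v f] by (simp add: Rep_coef assms pi_zero)
  finally show ?thesis by (simp add: cinner_simps cinner_pairing assms)
qed

lemma delta_coef_zero:
  assumes "bessel u" "Rep_ell2 (ell2_delta 0 - coef u u) 0 = 0"
  shows "norm u = 1"
proof -
  have "complex_of_real ((norm u)\<^sup>2) = 1"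
    using assms by (simp add: minus_ell2.rep_eq ell2_delta.rep_eq Rep_coef pi_zero cinner_self)
  then have "(norm u)\<^sup>2 = 1" using of_real_eq_1_iff by blast
  then show ?thesis by (simp add: power2_eq_1_iff) (use norm_ge_zero[of u] in linarith)
qed

text \<open>The fixed point equations put \<open>ell2_delta 0 - coef u u\<close> orthogonal to all
  coefficients of W. As in a factor, a nonzero invariant W then leaves no room for 1 - P.\<close>

lemma kleppner_unit:
  assumes kl: "kleppner_condition \<sigma> \<Gamma>"
    and vb: "\<And>v. v \<in> W \<Longrightarrow> bessel v"
    and vi: "\<And>v x. v \<in> W \<Longrightarrow> x \<in> \<Gamma> \<Longrightarrow> inv (\<pi> x) v \<in> W"
    and ne: "w \<in> W" "w \<noteq> 0"
    and u: "bessel u" and fixed: "\<And>v. v \<in> W \<Longrightarrow> pairing u v u = v"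
  shows "norm u = 1"
proof (rule delta_coef_zero[OF u])
  show "Rep_ell2 (ell2_delta 0 - coef u u) 0 = 0"
  proof (rule kleppner_annihilator[OF kl vb vi ne])
    fix \<gamma> assume "\<gamma> \<notin> \<Gamma>"
    then show "Rep_ell2 (ell2_delta 0 - coef u u) \<gamma> = 0"
      by (auto simp: minus_ell2.rep_eq ell2_delta.rep_eq Rep_coef u)
  next
    fix v f assume "v \<in> W"
    then show "cinner (ell2_delta 0 - coef u u) (coef v f) = 0"
      by (simp add: cinner_delta_coef u vb fixed)
  qed
qed

text \<open>Tested on u, the Bessel bound is exhausted by the coefficient at 0, so every other
  coefficient vanishes.\<close>

lemma unit_orthonormal:
  assumes b: "bbound 1 u" and n: "norm u = 1"
  shows "orthonormal_system \<pi> \<Gamma> u"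
proof -
  have 0: "cinner u (\<pi> \<gamma> u) = 0" if "\<gamma> \<in> \<Gamma>" "\<gamma> \<noteq> 0" for \<gamma>
    using b[unfolded bbound_def, rule_format, of "{0, \<gamma>}" u] that n
    by (simp add: pi_zero cinner_self)
  have "cinner (\<pi> \<gamma> u) (\<pi> \<gamma>' u) = 0" if "\<gamma> \<in> \<Gamma>" "\<gamma>' \<in> \<Gamma>" "\<gamma> \<noteq> \<gamma>'" for \<gamma> \<gamma>'
  proof -
    have "- \<gamma> + \<gamma>' \<in> \<Gamma>" "- \<gamma> + \<gamma>' \<noteq> 0"
      using that by (auto simp: add_mem uminus_mem) (metis add.right_neutral add_minus_cancel)
    then show ?thesis
      using 0 by (simp add: cinner_pi_left inv_pi pi_pi cinner_simps)
  qed
  then show ?thesis by (auto simp: orthonormal_system_def cinner_pi cinner_self n)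
qed

end

section \<open>Consequences for cyclic, separating and Riesz vectors\<close>

context projective_orbit
begin

text \<open>Duality: an upper bound for synthesis is also one for analysis.\<close>

lemma bessel_if_riesz:
  assumes "riesz_sequence \<pi> \<Gamma> k" shows "bessel k"
proof -
  obtain B where B: "B > 0" and le: "\<And>c :: 'g \<Rightarrow> complex. (\<lambda>\<gamma>. (cmod (c \<gamma>))\<^sup>2) summable_on \<Gamma> \<Longrightarrow>
      (norm (\<Sum>\<^sub>\<infinity>\<gamma>\<in>\<Gamma>. c \<gamma> *\<^sub>C \<pi> \<gamma> k))\<^sup>2 \<le> B * (\<Sum>\<^sub>\<infinity>\<gamma>\<in>\<Gamma>. (cmod (c \<gamma>))\<^sup>2)"
    using assms unfolding riesz_sequence_def by blast
  have "bbound B k"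
    unfolding bbound_def
  proof (intro allI impI)
    fix f F assume F: "finite F \<and> F \<subseteq> \<Gamma>"
    \<comment> \<open>With the coefficients of f as weights, the inner product of f with the
      synthesized vector s equals N, and Cauchy-Schwarz against \<open>s_le\<close> bounds
      N.\<close>
    define c where "c \<gamma> = (if \<gamma> \<in> F then cinner f (\<pi> \<gamma> k) else 0)" for \<gamma>
    define s where "s = (\<Sum>\<gamma>\<in>F. c \<gamma> *\<^sub>C \<pi> \<gamma> k)"
    define N where "N = (\<Sum>\<gamma>\<in>F. (cmod (cinner f (\<pi> \<gamma> k)))\<^sup>2)"
    have N: "((\<lambda>\<gamma>. (cmod (c \<gamma>))\<^sup>2) has_sum N) \<Gamma>"
    proof -
      have "((\<lambda>\<gamma>. (cmod (c \<gamma>))\<^sup>2) has_sum N) F" unfolding N_def c_def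
        using F by (intro has_sum_finiteI) auto
      then show ?thesis
        by (rule has_sum_cong_neutral[THEN iffD1, rotated -1]) (use F in \<open>auto simp: c_def\<close>)
    qed
    have "((\<lambda>\<gamma>. c \<gamma> *\<^sub>C \<pi> \<gamma> k) has_sum s) F" unfolding s_def using F by (intro has_sum_finiteI) auto
    then have "((\<lambda>\<gamma>. c \<gamma> *\<^sub>C \<pi> \<gamma> k) has_sum s) \<Gamma>"
      by (rule has_sum_cong_neutral[THEN iffD1, rotated -1]) (use F in \<open>auto simp: c_def\<close>)
    then have s_le: "(norm s)\<^sup>2 \<le> B * N"
      using le[of c] N by (auto simp: infsumI has_sum_imp_summable)
    have "complex_of_real N = cinner f s"
      unfolding N_def s_def c_def cinner_sum_right of_real_sum
      by (intro sum.cong) (auto simp: cinner_simps mult.commute complex_norm_square simp del: of_real_power)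
    then have "N = Re (cinner f s)" by (metis Re_complex_of_real)
    then have "N \<le> norm f * norm s" using Re_cinner_le[of f s] by simp
    moreover have "N \<ge> 0" by (simp add: N_def sum_nonneg)
    ultimately have "N\<^sup>2 \<le> (norm f * norm s)\<^sup>2" by (intro power_mono)
    also have "\<dots> \<le> (norm f)\<^sup>2 * (B * N)" using s_le by (simp add: power_mult_distrib mult_left_mono)
    finally have "N * N \<le> N * (B * (norm f)\<^sup>2)" by (simp add: power2_eq_square mult_ac)
    then have "N \<le> B * (norm f)\<^sup>2"
      using \<open>N \<ge> 0\<close> B by (cases "N = 0") (auto simp: zero_le_mult_iff)
    then show "(\<Sum>\<gamma>\<in>F. (cmod (cinner f (\<pi> \<gamma> k)))\<^sup>2) \<le> B * (norm f)\<^sup>2" by (simp add: N_def)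
  qed
  then show ?thesis by (rule bbound_bessel)
qed

text \<open>The projection onto the closure of \<open>S\<close> lies in \<open>\<pi>(\<Gamma>)''\<close> and annihilates \<open>k\<close>.\<close>

lemma separating_not_orthogonal:
  assumes sep: "separating_vector (commutant (commutant (\<pi> ` \<Gamma>))) k"
    and S0: "csubspace S" and inv: "\<And>A s. A \<in> commutant (\<pi> ` \<Gamma>) \<Longrightarrow> s \<in> S \<Longrightarrow> A s \<in> S"
    and orth: "\<And>s. s \<in> S \<Longrightarrow> cinner s k = 0" and s: "s \<in> S"
  shows "s = 0"
proof -
  let ?S = "closure S"
  have S: "csubspace ?S" "closed ?S" using S0 by (simp_all add: csubspace_closure)
  have "\<exists>p. p \<in> ?S \<and> (\<forall>v\<in>?S. cinner (x - p) v = 0)" for x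
    using csubspace_projection[OF S, of x] by metis
  then obtain E where E: "\<And>x. E x \<in> ?S" "\<And>x v. v \<in> ?S \<Longrightarrow> cinner (x - E x) v = 0" by metis
  \<comment> \<open>Linearity of E, its commutation with A and its values at k and s are all read
    off from this characterization.\<close>
  have uniq: "E x = p" if "p \<in> ?S" "\<And>v. v \<in> ?S \<Longrightarrow> cinner (x - p) v = 0" for x p
  proof -
    have m: "p - E x \<in> ?S" using that(1) E(1) S(1) by (simp add: csubspace_diff)
    have "cinner (p - E x) (p - E x) = cinner (x - E x) (p - E x) - cinner (x - p) (p - E x)"
      by (simp add: cinner_simps)
    also have "\<dots> = 0" using E(2)[OF m] that(2)[OF m] by simp
    finally show ?thesis by (simp add: cinner_self)
  qed
  have Eadd: "E (x + y) = E x + E y" for x y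
  proof (rule uniq)
    show "E x + E y \<in> ?S" using S(1) E(1) by (simp add: csubspace_iff)
    show "cinner (x + y - (E x + E y)) v = 0" if "v \<in> ?S" for v
      using E(2)[OF that, of x] E(2)[OF that, of y] by (simp add: cinner_simps)
  qed
  have Escale: "E (a *\<^sub>C x) = a *\<^sub>C E x" for a x
  proof (rule uniq)
    show "a *\<^sub>C E x \<in> ?S" using S(1) E(1) by (simp add: csubspace_iff)
    show "cinner (a *\<^sub>C x - a *\<^sub>C E x) v = 0" if "v \<in> ?S" for v
      using E(2)[OF that, of x] by (simp add: cinner_simps)
  qed
  have bE: "bounded_clinear E"
  proof (rule bounded_clinearI[of _ 1, OF Eadd Escale])
    fix x
    have "(norm (E x))\<^sup>2 \<le> (norm ((x - E x) + E x))\<^sup>2"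
      unfolding norm_add_sq[of "x - E x" "E x"] using E(2)[OF E(1)[of x], of x] by simp
    then show "norm (E x) \<le> 1 * norm x" by (auto intro: power2_le_imp_le)
  qed
  have inv': "A v \<in> ?S" if A: "A \<in> commutant (\<pi> ` \<Gamma>)" and v: "v \<in> ?S" for A v
  proof -
    have "bounded_linear A" using A by (simp add: commutant_def bounded_clinear_def)
    then have "A ` ?S \<subseteq> closure (A ` S)"
      by (intro image_closure_subset continuous_on_subset[OF linear_continuous_on] closure_subset) auto
    moreover have "closure (A ` S) \<subseteq> ?S" using inv[OF A] by (intro closure_mono) auto
    ultimately show ?thesis using v by blast
  qed
  have "E \<in> commutant (commutant (\<pi> ` \<Gamma>))"
    unfolding commutant_def[of "commutant _"]
  proof (intro CollectI conjI ballI bE ext)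
    fix A x assume A: "A \<in> commutant (\<pi> ` \<Gamma>)"
    \<comment> \<open>Commutation with E also needs A to preserve the orthogonal complement of
      \<open>?S\<close>, which is the invariance of \<open>?S\<close> under A'.\<close>
    obtain A' where A': "adj A A'" "adj A' A" using commutant_adj[OF A] by blast
    have A'c: "A' \<in> commutant (\<pi> ` \<Gamma>)" using A' by (auto simp: adj_def commutant_def fun_eq_iff)
    have bA: "bounded_clinear A" using A by (simp add: commutant_def)
    have "E (A x) = A (E x)"
    proof (rule uniq)
      show "A (E x) \<in> ?S" using inv'[OF A E(1)] .
      fix v assume v: "v \<in> ?S"
      have "cinner (A x - A (E x)) v = cinner (x - E x) (A' v)"
        using A'(1) by (simp add: cinner_simps cinner_adj)
      then show "cinner (A x - A (E x)) v = 0" using E(2)[OF inv'[OF A'c v]] by simp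
    qed
    then show "(E \<circ> A) x = (A \<circ> E) x" by simp
  qed
  moreover have "E k = 0"
  proof (rule uniq)
    show "0 \<in> ?S" using S(1) by (simp add: csubspace_iff)
    have "?S \<subseteq> {v. cinner k v = 0}"
      using orth cinner_eq_zero_commute by (intro closure_minimal closed_orthogonal') auto
    then show "cinner (k - 0) v = 0" if "v \<in> ?S" for v using that by auto
  qed
  ultimately have E0: "E = (\<lambda>f. 0)" using sep by (simp add: separating_vector_def)
  have "E s = s" by (rule uniq) (use s closure_subset in auto)
  with E0 show ?thesis by simp
qed

end

text \<open>\<open>dense\<close> says that the Bessel vectors are total; for lattices it is supplied
  by \<open>bessel_dense\<close>.\<close>

locale kleppner_polar_part = polar_part +
  assumes kleppner: "kleppner_condition \<sigma> \<Gamma>"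
    and dense: "\<And>f. (\<And>h. bessel h \<Longrightarrow> cinner h f = 0) \<Longrightarrow> f = 0"
    and nontrivial: "(UNIV :: 'b set) \<noteq> {0}"
begin

text \<open>X is a self-adjoint projection, so testing f - X f against h amounts to testing f
  against h - X h, a Bessel vector killed by X.\<close>

lemma eq_X_if_orthogonal:
  assumes "\<And>h. bessel h \<Longrightarrow> X h = 0 \<Longrightarrow> cinner h f = 0"
  shows "X f = f"
proof -
  have "f - X f = 0"
  proof (rule dense)
    fix h assume h: "bessel h"
    have "cinner h (f - X f) = cinner (h - X h) f" by (simp add: cinner_simps X_sym)
    also have "\<dots> = 0" using assms[of "h - X h"] h by (simp add: bessel_diff bessel_X X_diff X_X)
    finally show "cinner h (f - X f) = 0" .
  qed
  then show ?thesis by simp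
qed

lemma X_pi: "x \<in> \<Gamma> \<Longrightarrow> X (\<pi> x f) = \<pi> x (X f)"
  by (simp add: pairing_pi)

text \<open>If X is not the identity, the Bessel vectors killed by X form a nonzero
  \<Gamma>-invariant set, and \<open>complement_expansion\<close> is the fixed point equation
  required by \<open>kleppner_unit\<close>.\<close>

lemma dichotomy:
  assumes "X f \<noteq> f"
  shows "norm u = 1" "\<exists>v. bessel v \<and> v \<noteq> 0 \<and> X v = 0"
proof -
  show ex: "\<exists>v. bessel v \<and> v \<noteq> 0 \<and> X v = 0"
    using eq_X_if_orthogonal[of f] assms by force
  then obtain w where w: "bessel w" "w \<noteq> 0" "X w = 0" by blast
  show "norm u = 1"
  proof (rule kleppner_unit[OF kleppner, of "{v. bessel v \<and> X v = 0}" w])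
    fix v x assume "v \<in> {v. bessel v \<and> X v = 0}" "x \<in> \<Gamma>"
    then show "inv (\<pi> x) v \<in> {v. bessel v \<and> X v = 0}"
      by (simp add: bessel_inv_pi) (simp add: inv_pi X_scaleC X_pi uminus_mem)
  qed (use w complement_expansion in auto)
qed

lemma parseval_if_X_id:
  assumes "\<And>f. X f = f" shows "parseval_frame \<pi> \<Gamma> u"
proof -
  have "(\<lambda>\<gamma>. (cmod (cinner f (\<pi> \<gamma> u)))\<^sup>2) summable_on \<Gamma>
      \<and> (\<Sum>\<^sub>\<infinity>\<gamma>\<in>\<Gamma>. (cmod (cinner f (\<pi> \<gamma> u)))\<^sup>2) = (norm f)\<^sup>2" for f
  proof
    show "(\<lambda>\<gamma>. (cmod (cinner f (\<pi> \<gamma> u)))\<^sup>2) summable_on \<Gamma>"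
      by (rule summable_on_cong_neutral[THEN iffD1, OF _ _ _ ell2_summable[of "coef u f"]])
        (auto simp: Rep_coef)
    have "(\<Sum>\<^sub>\<infinity>\<gamma>\<in>\<Gamma>. (cmod (cinner f (\<pi> \<gamma> u)))\<^sup>2) = (norm (coef u f))\<^sup>2"
      unfolding ell2_norm_sq by (rule infsum_cong_neutral) (auto simp: Rep_coef)
    then show "(\<Sum>\<^sub>\<infinity>\<gamma>\<in>\<Gamma>. (cmod (cinner f (\<pi> \<gamma> u)))\<^sup>2) = (norm f)\<^sup>2"
      by (simp add: coef_u_sq assms)
  qed
  then show ?thesis by (simp add: parseval_frame_def frame_bounds_def)
qed

lemma orbit_total_if_X_id:
  assumes "\<And>f. X f = f" shows "closure (cspan ((\<lambda>\<gamma>. \<pi> \<gamma> u) ` \<Gamma>)) = UNIV"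
proof (rule csubspace_eq_UNIV)
  show "csubspace (closure (cspan ((\<lambda>\<gamma>. \<pi> \<gamma> u) ` \<Gamma>)))"
    by (intro csubspace_closure complex_vector.subspace_span)
  fix f assume f: "\<And>v. v \<in> closure (cspan ((\<lambda>\<gamma>. \<pi> \<gamma> u) ` \<Gamma>)) \<Longrightarrow> cinner f v = 0"
  have "cinner f (\<pi> \<gamma> u) = 0" if "\<gamma> \<in> \<Gamma>" for \<gamma>
    by (rule f[OF subsetD[OF closure_subset complex_vector.span_base]]) (rule imageI[OF that])
  then have "coef u f = 0" by (intro ell2_eqI) (simp add: Rep_coef zero_ell2.rep_eq)
  then show "f = 0" using coef_u_sq[of f] by (simp add: assms)
qed simp

text \<open>By \<open>orthogonal_left\<close>, k is orthogonal to the Bessel vectors killed by X,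
  hence lies in the range of X. That range is closed and \<Gamma>-invariant, so it contains all that
  k generates.\<close>

lemma X_id_if_cyclic:
  assumes "cyclic_vector \<pi> \<Gamma> k" shows "X f = f"
proof -
  have Xk: "X k = k" by (rule eq_X_if_orthogonal, rule orthogonal_left)
  let ?V = "{f. X f = f}"
  have "X 0 = 0" using X_scaleC[of 0 0] by simp
  then have "csubspace ?V" by (simp add: csubspace_iff X_add X_scaleC)
  moreover have "(\<lambda>\<gamma>. \<pi> \<gamma> k) ` \<Gamma> \<subseteq> ?V" by (auto simp: X_pi Xk)
  ultimately have "cspan ((\<lambda>\<gamma>. \<pi> \<gamma> k) ` \<Gamma>) \<subseteq> ?V" by (intro complex_vector.span_minimal)
  moreover have "bounded_linear X"
    using bounded_clinear_pairing[OF bessel_u bessel_u] by (simp add: bounded_clinear_def)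
  then have "closed ?V"
    by (intro closed_Collect_eq[OF linear_continuous_on continuous_on_id])
  ultimately have "closure (cspan ((\<lambda>\<gamma>. \<pi> \<gamma> k) ` \<Gamma>)) \<subseteq> ?V" by (rule closure_minimal)
  then show ?thesis using assms by (auto simp: cyclic_vector_def)
qed

text \<open>The Bessel vectors with coefficients orthogonal to the range of \<open>coef u\<close>
  form a subspace that is invariant under the commutant and orthogonal to k. A separating k forces
  it to be zero, so P fixes the coefficients of every Bessel vector.\<close>

lemma unit_if_separating:
  assumes sep: "separating_vector (commutant (commutant (\<pi> ` \<Gamma>))) k"
  shows "norm u = 1"
proof -
  define S where "S = {h. bessel h \<and> (\<forall>f f'. cinner (coef h f) (coef u f') = 0)}"
  have S_iff: "h \<in> S \<longleftrightarrow> bessel h \<and> (\<forall>f. pairing h u f = 0)" for h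
    unfolding S_def using cinner_pairing[OF _ bessel_u, of h] cinner_eq_0_imp_0 by fastforce
  have S: "csubspace S"
    by (auto simp: S_def csubspace_iff bessel_add bessel_scaleC coef_add_left coef_scaleC_left cinner_simps)
  have S0: "h = 0" if "h \<in> S" for h
  proof (rule separating_not_orthogonal[OF sep S _ _ that])
    fix A s assume A: "A \<in> commutant (\<pi> ` \<Gamma>)" and s: "s \<in> S"
    obtain A' where A': "adj A A'" using commutant_adj[OF A] by blast
    show "A s \<in> S"
      using s pairing_left[OF A', of s u] adj_coef(1)[OF A', of s] by (simp add: S_iff)
  next
    fix s assume "s \<in> S" then show "cinner s k = 0" using orthogonal_right by (simp add: S_iff)
  qed
  have "\<exists>w. bessel w \<and> w \<noteq> 0"
  proof (rule ccontr)
    assume "\<nexists>w. bessel w \<and> w \<noteq> 0"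
    then have "f = 0" for f :: 'b using dense[of f] by force
    then show False using nontrivial by auto
  qed
  then obtain w where w: "bessel w" "w \<noteq> 0" by blast
  show ?thesis
  proof (rule kleppner_unit[OF kleppner, of "{v. bessel v}" w])
    fix v assume "v \<in> {v. bessel v}"
    then have "v - pairing u v u = 0" using pairing_compl by (intro S0) (simp add: S_iff)
    then show "pairing u v u = v" by simp
  qed (use w in \<open>auto simp: bessel_inv_pi\<close>)
qed

text \<open>Assumption \<open>tr\<close> is the trace property of the inner product: a vanishing
  mixed frame operator has trace zero. For lattices it is
  \<open>orthogonal_if_pairing_zero\<close>.\<close>

lemma unit_if_riesz:
  assumes rs: "riesz_sequence \<pi> \<Gamma> k"
    and tr: "\<And>h w. bessel h \<Longrightarrow> bessel w \<Longrightarrow> (\<And>f. pairing h w f = 0) \<Longrightarrow> cinner h w = 0"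
  shows "norm u = 1"
proof -
  have k: "bessel k" using bessel_if_riesz[OF rs] .
  define h where "h = k - pairing u k u"
  have h: "bessel h" "\<And>f. pairing h u f = 0" unfolding h_def using pairing_compl[OF k] by auto
  have a: "adj (pairing u k) (pairing k u)" using k by (simp add: adj_pairing)
  \<comment> \<open>h is orthogonal to k by optimality and to \<open>pairing u k u\<close> by
    \<open>tr\<close>; being their difference, it vanishes.\<close>
  have "cinner h k = 0" by (rule orthogonal_right) (use h in auto)
  moreover have "cinner h (pairing u k u) = 0"
  proof (rule tr[OF h(1) adj_coef(1)[OF a bessel_u]])
    fix f
    have "pairing u k 0 = 0"
      using bounded_clinear_scaleC[OF bounded_clinear_pairing[OF bessel_u k], of 0 0] by simp
    then show "pairing h (pairing u k u) f = 0" by (simp add: pairing_right[OF a h(1) bessel_u] h(2))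
  qed
  ultimately have "cinner h h = 0" by (subst (2) h_def) (simp add: cinner_simps)
  then have h0: "h = 0" by (simp add: cinner_self)
  define b where "b = ell2_delta 0 - coef u u"
  have b_out: "Rep_ell2 b \<gamma> = 0" if "\<gamma> \<notin> \<Gamma>" for \<gamma>
    using that by (auto simp: b_def minus_ell2.rep_eq ell2_delta.rep_eq Rep_coef)
  obtain A where A: "A > 0" and rsA: "\<And>c :: 'a \<Rightarrow> complex. (\<lambda>\<gamma>. (cmod (c \<gamma>))\<^sup>2) summable_on \<Gamma> \<Longrightarrow>
      (\<lambda>\<gamma>. c \<gamma> *\<^sub>C \<pi> \<gamma> k) summable_on \<Gamma> \<and>
      A * (\<Sum>\<^sub>\<infinity>\<gamma>\<in>\<Gamma>. (cmod (c \<gamma>))\<^sup>2) \<le> (norm (\<Sum>\<^sub>\<infinity>\<gamma>\<in>\<Gamma>. c \<gamma> *\<^sub>C \<pi> \<gamma> k))\<^sup>2"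
    using rs unfolding riesz_sequence_def by blast
  have sb: "(\<lambda>\<gamma>. (cmod (Rep_ell2 b \<gamma>))\<^sup>2) summable_on \<Gamma>"
    by (rule summable_on_subset_banach[OF ell2_summable]) simp
  \<comment> \<open>Synthesizing with the coefficients b tests b against every
    \<open>coef k f\<close>. The result vanishes since h = 0, and the lower Riesz bound then kills
    b.\<close>
  let ?s = "\<Sum>\<^sub>\<infinity>\<gamma>\<in>\<Gamma>. Rep_ell2 b \<gamma> *\<^sub>C \<pi> \<gamma> k"
  have "?s = 0"
  proof (rule cinner_eq_0_imp_0)
    fix f
    have "((\<lambda>\<gamma>. Rep_ell2 b \<gamma> *\<^sub>C \<pi> \<gamma> k) has_sum ?s) \<Gamma>" using rsA[OF sb] by (simp add: has_sum_infsum)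
    from has_sum_bounded_linear[OF bounded_linear_cinner_left this, of f]
    have "cinner ?s f = (\<Sum>\<^sub>\<infinity>\<gamma>\<in>\<Gamma>. cinner (Rep_ell2 b \<gamma> *\<^sub>C \<pi> \<gamma> k) f)" by (simp add: infsumI o_def)
    also have "\<dots> = cinner b (coef k f)"
      unfolding cinner_ell2.rep_eq
      by (rule infsum_cong_neutral) (auto simp: b_out cinner_simps Rep_coef k cinner_commute[of "\<pi> _ k" f])
    also have "\<dots> = cinner h f" unfolding b_def h_def by (simp add: cinner_delta_coef k)
    finally show "cinner ?s f = 0" by (simp add: h0)
  qed
  then have "(\<Sum>\<^sub>\<infinity>\<gamma>\<in>\<Gamma>. (cmod (Rep_ell2 b \<gamma>))\<^sup>2) \<le> 0"
    using rsA[OF sb] A by (simp add: mult_le_0_iff)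
  from nonneg_infsum_le_0D[OF this sb, of 0] have "Rep_ell2 b 0 = 0" by simp
  then show ?thesis unfolding b_def by (rule delta_coef_zero[OF bessel_u])
qed

end

lemma (in projective_orbit) cyclic_if_frame:
  assumes "frame \<pi> \<Gamma> k" shows "cyclic_vector \<pi> \<Gamma> k"
  unfolding cyclic_vector_def
proof (rule csubspace_eq_UNIV)
  show "csubspace (closure (cspan ((\<lambda>\<gamma>. \<pi> \<gamma> k) ` \<Gamma>)))"
    by (intro csubspace_closure complex_vector.subspace_span)
  fix f assume f: "\<And>v. v \<in> closure (cspan ((\<lambda>\<gamma>. \<pi> \<gamma> k) ` \<Gamma>)) \<Longrightarrow> cinner f v = 0"
  have 0: "cinner f (\<pi> \<gamma> k) = 0" if "\<gamma> \<in> \<Gamma>" for \<gamma>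
    by (rule f[OF subsetD[OF closure_subset complex_vector.span_base]]) (rule imageI[OF that])
  obtain A where A: "A > 0" "A * (norm f)\<^sup>2 \<le> (\<Sum>\<^sub>\<infinity>\<gamma>\<in>\<Gamma>. (cmod (cinner f (\<pi> \<gamma> k)))\<^sup>2)"
    using assms unfolding frame_def frame_bounds_def by blast
  have "(\<Sum>\<^sub>\<infinity>\<gamma>\<in>\<Gamma>. (cmod (cinner f (\<pi> \<gamma> k)))\<^sup>2) = 0" by (rule infsum_0) (simp add: 0)
  with A show "f = 0" by (simp add: mult_le_0_iff)
qed simp

section \<open>Integration over a fundamental domain\<close>

lemma countable_if_discrete:
  fixes S :: "'a::second_countable_topology set"
  assumes "discrete S" shows "countable S"
proof -
  obtain B :: "'a set set" where B: "countable B" "topological_basis B" using ex_countable_basis by blast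
  have "\<exists>b\<in>B. b \<inter> S = {x}" if "x \<in> S" for x
  proof -
    from discreteD[OF assms that] obtain T where T: "open T" "T \<inter> S = {x}"
      by (auto simp: isolated_in_def)
    then obtain b where "b \<in> B" "x \<in> b" "b \<subseteq> T" using B(2) that by (metis IntD1 insertI1 topological_basisE)
    with T that show ?thesis by (intro bexI[of _ b]) auto
  qed
  then obtain b where b: "\<And>x. x \<in> S \<Longrightarrow> b x \<in> B \<and> b x \<inter> S = {x}" by metis
  then have "inj_on b S" by (intro inj_onI) (metis singleton_inject)
  moreover have "countable (b ` S)" using b by (intro countable_subset[OF _ B(1)]) blast
  ultimately show ?thesis by (rule countable_image_inj_on[rotated])
qed

lemma measurable_translate [measurable]:
  "(\<lambda>x::'a::topological_group_add. x + y) \<in> borel_measurable borel"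
  by (intro borel_measurable_continuous_onI continuous_intros)

lemma nn_integral_right_translate:
  fixes \<mu> :: "'g::topological_group_add measure"
  assumes \<mu>: "sets \<mu> = sets borel" "right_invariant \<mu>"
    and F: "F \<in> borel_measurable borel"
  shows "(\<integral>\<^sup>+x. F (x + y) \<partial>\<mu>) = (\<integral>\<^sup>+x. F x \<partial>\<mu>)"
proof -
  have T: "(\<lambda>x. x + y) \<in> measurable \<mu> borel"
    using measurable_translate by (simp add: measurable_cong_sets[OF \<mu>(1) refl])
  have "distr \<mu> borel (\<lambda>x. x + y) = \<mu>"
  proof (rule measure_eqI)
    show "sets (distr \<mu> borel (\<lambda>x. x + y)) = sets \<mu>" by (simp add: \<mu>)
    fix A assume "A \<in> sets (distr \<mu> borel (\<lambda>x. x + y))"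
    then have A: "A \<in> sets borel" by simp
    have "space \<mu> = UNIV" using sets_eq_imp_space_eq[OF \<mu>(1)] by simp
    moreover have "(\<lambda>x. x + y) -` A = (\<lambda>x. x + - y) ` A"
      by (auto simp: image_iff) (metis add_diff_cancel)
    moreover have "emeasure \<mu> ((\<lambda>x. x + - y) ` A) = emeasure \<mu> A"
      using \<mu>(2) A unfolding right_invariant_def by blast
    ultimately show "emeasure (distr \<mu> borel (\<lambda>x. x + y)) A = emeasure \<mu> A"
      using A by (simp only: emeasure_distr[OF T] Int_UNIV_right)
  qed
  then show ?thesis using nn_integral_distr[OF T, of F] F by (simp add: measurable_cong_sets[OF \<mu>(1) refl])
qed

text \<open>The group element here is the inverse of the one in x = \<omega> + \<gamma>, which suits
  the indicator of \<Omega> in the unfolding.\<close>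

lemma fundamental_domain_unique:
  assumes "is_subgroup \<Gamma>" "fundamental_domain \<mu> \<Gamma> \<Omega>"
  shows "\<exists>\<gamma>. \<gamma> \<in> \<Gamma> \<and> x + \<gamma> \<in> \<Omega> \<and> (\<forall>\<gamma>'\<in>\<Gamma>. x + \<gamma>' \<in> \<Omega> \<longrightarrow> \<gamma>' = \<gamma>)"
proof -
  have "x \<in> {\<omega> + \<gamma> | \<omega> \<gamma>. \<omega> \<in> \<Omega> \<and> \<gamma> \<in> \<Gamma>}" using assms(2) by (simp add: fundamental_domain_def)
  then obtain \<omega> \<gamma> where *: "x = \<omega> + \<gamma>" "\<omega> \<in> \<Omega>" "\<gamma> \<in> \<Gamma>" by blast
  have "\<gamma>' = - \<gamma>" if "\<gamma>' \<in> \<Gamma>" "x + \<gamma>' \<in> \<Omega>" for \<gamma>'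
  proof (rule ccontr)
    assume "\<gamma>' \<noteq> - \<gamma>"
    then have "- \<gamma>' \<noteq> \<gamma>" by auto
    moreover have "- \<gamma>' \<in> \<Gamma>" using that assms(1) by (simp add: is_subgroup_def)
    ultimately have "(\<lambda>\<omega>. \<omega> + - \<gamma>') ` \<Omega> \<inter> (\<lambda>\<omega>. \<omega> + \<gamma>) ` \<Omega> = {}"
      using assms(2) *(3) unfolding fundamental_domain_def by blast
    moreover have "x \<in> (\<lambda>\<omega>. \<omega> + - \<gamma>') ` \<Omega>" using that by (intro image_eqI[of _ _ "x + \<gamma>'"]) (auto simp: add.assoc)
    moreover have "x \<in> (\<lambda>\<omega>. \<omega> + \<gamma>) ` \<Omega>" using * by blast
    ultimately show False by blast
  qed
  moreover have "- \<gamma> \<in> \<Gamma>" "x + - \<gamma> \<in> \<Omega>" using * assms(1) by (auto simp: is_subgroup_def)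
  ultimately show ?thesis by blast
qed

lemma nn_integral_fundamental_domain_indicator:
  assumes "is_subgroup \<Gamma>" "fundamental_domain \<mu> \<Gamma> \<Omega>"
  shows "(\<integral>\<^sup>+\<gamma>. a * indicator \<Omega> (x + \<gamma>) \<partial>count_space \<Gamma>) = a"
proof -
  obtain \<gamma> where \<gamma>: "\<gamma> \<in> \<Gamma>" "x + \<gamma> \<in> \<Omega>" "\<And>\<gamma>'. \<gamma>' \<in> \<Gamma> \<Longrightarrow> x + \<gamma>' \<in> \<Omega> \<Longrightarrow> \<gamma>' = \<gamma>"
    using fundamental_domain_unique[OF assms, of x] by blast
  have "a * indicator \<Omega> (x + \<gamma>') = 0" if "\<gamma>' \<in> \<Gamma>" "\<gamma>' \<notin> {\<gamma>}" for \<gamma>'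
    using \<gamma>(3)[OF that(1)] that(2) by (auto simp: indicator_def)
  then have "(\<integral>\<^sup>+\<gamma>. a * indicator \<Omega> (x + \<gamma>) \<partial>count_space \<Gamma>) = (\<Sum>\<gamma>\<in>{\<gamma>}. a * indicator \<Omega> (x + \<gamma>))"
    using \<gamma>(1) by (intro nn_integral_count_space') simp_all
  then show ?thesis using \<gamma>(2) by simp
qed

text \<open>Write 1 as the sum over \<gamma> of the indicator of \<Omega> at x + \<gamma>,
  interchange by Tonelli, translate each term by right invariance and replace \<gamma> by its
  inverse.\<close>

lemma nn_integral_unfold_sum:
  fixes \<mu> :: "'g::topological_group_add measure"
  assumes \<mu>: "sets \<mu> = sets borel" "right_invariant \<mu>"
    and \<Gamma>: "is_subgroup \<Gamma>" "countable \<Gamma>" and \<Omega>: "fundamental_domain \<mu> \<Gamma> \<Omega>"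
    and F [measurable]: "F \<in> borel_measurable borel"
  shows "(\<integral>\<^sup>+x. F x \<partial>\<mu>) = (\<integral>\<^sup>+\<gamma>. (\<integral>\<^sup>+\<omega>. F (\<omega> + \<gamma>) * indicator \<Omega> \<omega> \<partial>\<mu>) \<partial>count_space \<Gamma>)"
proof -
  have \<Omega>m [measurable]: "\<Omega> \<in> sets borel" using \<Omega> by (simp add: fundamental_domain_def)
  have meas: "f \<in> borel_measurable \<mu>" if "f \<in> borel_measurable borel" for f :: "'g \<Rightarrow> ennreal"
    using that by (simp add: measurable_cong_sets[OF \<mu>(1) refl])
  have bij: "bij_betw uminus \<Gamma> \<Gamma>"
    using \<Gamma>(1) by (intro bij_betw_byWitness[of _ uminus]) (auto simp: is_subgroup_def)
  have "(\<integral>\<^sup>+x. F x \<partial>\<mu>) = (\<integral>\<^sup>+x. (\<integral>\<^sup>+\<gamma>. F x * indicator \<Omega> (x + \<gamma>) \<partial>count_space \<Gamma>) \<partial>\<mu>)"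
    by (simp only: nn_integral_fundamental_domain_indicator[OF \<Gamma>(1) \<Omega>])
  also have "\<dots> = (\<integral>\<^sup>+\<gamma>. (\<integral>\<^sup>+x. F x * indicator \<Omega> (x + \<gamma>) \<partial>\<mu>) \<partial>count_space \<Gamma>)"
    by (rule nn_integral_count_space_nn_integral[OF \<Gamma>(2)]) (intro meas, measurable)
  also have "\<dots> = (\<integral>\<^sup>+\<gamma>. (\<integral>\<^sup>+x. F (x + - \<gamma>) * indicator \<Omega> x \<partial>\<mu>) \<partial>count_space \<Gamma>)"
  proof (rule nn_integral_cong)
    fix \<gamma>
    have "(\<integral>\<^sup>+x. F (x + \<gamma> + - \<gamma>) * indicator \<Omega> (x + \<gamma>) \<partial>\<mu>) = (\<integral>\<^sup>+x. F (x + - \<gamma>) * indicator \<Omega> x \<partial>\<mu>)"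
      by (rule nn_integral_right_translate[OF \<mu>, of "\<lambda>x. F (x + - \<gamma>) * indicator \<Omega> x"]) measurable
    then show "(\<integral>\<^sup>+x. F x * indicator \<Omega> (x + \<gamma>) \<partial>\<mu>) = (\<integral>\<^sup>+x. F (x + - \<gamma>) * indicator \<Omega> x \<partial>\<mu>)"
      by (simp add: add.assoc)
  qed
  also have "\<dots> = (\<integral>\<^sup>+\<gamma>. (\<integral>\<^sup>+x. F (x + \<gamma>) * indicator \<Omega> x \<partial>\<mu>) \<partial>count_space \<Gamma>)"
    by (rule nn_integral_bij_count_space[OF bij, of "\<lambda>\<gamma>. \<integral>\<^sup>+x. F (x + \<gamma>) * indicator \<Omega> x \<partial>\<mu>"])
  finally show ?thesis .
qed

lemma nn_integral_unfold:
  fixes \<mu> :: "'g::topological_group_add measure"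
  assumes \<mu>: "sets \<mu> = sets borel" "right_invariant \<mu>"
    and \<Gamma>: "is_subgroup \<Gamma>" "countable \<Gamma>" and \<Omega>: "fundamental_domain \<mu> \<Gamma> \<Omega>"
    and F [measurable]: "F \<in> borel_measurable borel"
  shows "(\<integral>\<^sup>+x. F x \<partial>\<mu>) = (\<integral>\<^sup>+\<omega>. (\<integral>\<^sup>+\<gamma>. F (\<omega> + \<gamma>) \<partial>count_space \<Gamma>) * indicator \<Omega> \<omega> \<partial>\<mu>)"
proof -
  have [measurable]: "\<Omega> \<in> sets borel" using \<Omega> by (simp add: fundamental_domain_def)
  have meas: "f \<in> borel_measurable \<mu>" if "f \<in> borel_measurable borel" for f :: "'g \<Rightarrow> ennreal"
    using that by (simp add: measurable_cong_sets[OF \<mu>(1) refl])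
  have "(\<integral>\<^sup>+x. F x \<partial>\<mu>) = (\<integral>\<^sup>+\<gamma>. (\<integral>\<^sup>+\<omega>. F (\<omega> + \<gamma>) * indicator \<Omega> \<omega> \<partial>\<mu>) \<partial>count_space \<Gamma>)"
    by (rule nn_integral_unfold_sum[OF assms])
  also have "\<dots> = (\<integral>\<^sup>+x. (\<integral>\<^sup>+\<gamma>. F (x + \<gamma>) * indicator \<Omega> x \<partial>count_space \<Gamma>) \<partial>\<mu>)"
    by (rule nn_integral_count_space_nn_integral[OF \<Gamma>(2), symmetric]) (intro meas, measurable)
  also have "\<dots> = (\<integral>\<^sup>+\<omega>. (\<integral>\<^sup>+\<gamma>. F (\<omega> + \<gamma>) \<partial>count_space \<Gamma>) * indicator \<Omega> \<omega> \<partial>\<mu>)"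
    by (simp add: nn_integral_multc)
  finally show ?thesis .
qed

text \<open>Unfolding the indicator of another domain over \<Omega> gives the weight 1 on \<Omega>,
  so all fundamental domains have the same measure.\<close>

lemma covolume_eq:
  fixes \<mu> :: "'g::topological_group_add measure"
  assumes \<mu>: "sets \<mu> = sets borel" "right_invariant \<mu>"
    and \<Gamma>: "is_subgroup \<Gamma>" "countable \<Gamma>" and \<Omega>: "fundamental_domain \<mu> \<Gamma> \<Omega>"
  shows "covolume \<mu> \<Gamma> = measure \<mu> \<Omega>"
proof -
  have eq: "measure \<mu> \<Omega>' = measure \<mu> \<Omega>" if \<Omega>': "fundamental_domain \<mu> \<Gamma> \<Omega>'" for \<Omega>'
  proof -
    have sets [measurable]: "\<Omega> \<in> sets borel" "\<Omega>' \<in> sets borel" using \<Omega> \<Omega>' by (auto simp: fundamental_domain_def)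
    have "emeasure \<mu> \<Omega>' = (\<integral>\<^sup>+x. indicator \<Omega>' x \<partial>\<mu>)" using sets \<mu> by simp
    also have "\<dots> = (\<integral>\<^sup>+\<omega>. (\<integral>\<^sup>+\<gamma>. 1 * indicator \<Omega>' (\<omega> + \<gamma>) \<partial>count_space \<Gamma>) * indicator \<Omega> \<omega> \<partial>\<mu>)"
      unfolding mult_1 by (rule nn_integral_unfold[OF \<mu> \<Gamma> \<Omega>]) measurable
    also have "\<dots> = (\<integral>\<^sup>+\<omega>. indicator \<Omega> \<omega> \<partial>\<mu>)"
      unfolding nn_integral_fundamental_domain_indicator[OF \<Gamma>(1) \<Omega>'] by simp
    also have "\<dots> = emeasure \<mu> \<Omega>" using sets \<mu> by simp
    finally show ?thesis by (simp add: measure_def)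
  qed
  show ?thesis unfolding covolume_def
    by (rule the_equality) (use \<Omega> eq in blast)+
qed

section \<open>Orthogonality relations and density inequalities for a lattice\<close>

locale lattice_orbit = projective_orbit \<Gamma> \<sigma> \<pi>
  for \<Gamma> :: "'g::topological_group_add set" and \<sigma>
    and \<pi> :: "'g \<Rightarrow> 'h \<Rightarrow> 'h::{chilbert_space, second_countable_topology}" +
  fixes \<mu> :: "'g measure" and \<Omega> :: "'g set" and d :: real
  assumes sets_mu: "sets \<mu> = sets borel" and right_inv: "right_invariant \<mu>"
    and fd: "fundamental_domain \<mu> \<Gamma> \<Omega>" and countable: "countable \<Gamma>"
    and meas_pi: "\<And>f g. (\<lambda>x. cinner (\<pi> x f) g) \<in> borel_measurable borel"
    and formal: "formal_dimension \<mu> \<pi> d"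
begin

lemma d_pos: "d > 0" using formal by (simp add: formal_dimension_def)

lemma measurable_mu: "f \<in> borel_measurable borel \<Longrightarrow> f \<in> borel_measurable \<mu>"
  by (simp add: measurable_cong_sets[OF sets_mu refl])

lemmas meas_pi' [measurable] = meas_pi

lemma meas_pi_right [measurable]: "(\<lambda>x. cinner g (\<pi> x f)) \<in> borel_measurable borel"
  using measurable_compose[OF meas_pi borel_measurable_continuous_onI[OF continuous_on_cnj[OF continuous_on_id]]]
  by (subst cinner_commute)

lemma sets_Omega [measurable]: "\<Omega> \<in> sets borel" using fd by (simp add: fundamental_domain_def)

lemma integrable_pi: "integrable \<mu> (\<lambda>x. cinner (\<pi> x f1) g1 * cnj (cinner (\<pi> x f2) g2))"
  using formal unfolding formal_dimension_def by (blast intro: integrable.intros)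

lemma nn_integral_pi:
  "(\<integral>\<^sup>+x. ennreal ((cmod (cinner (\<pi> x f) g))\<^sup>2) \<partial>\<mu>) = ennreal ((norm f)\<^sup>2 * (norm g)\<^sup>2 / d)"
proof -
  have "has_bochner_integral \<mu> (\<lambda>x. cinner (\<pi> x f) g * cnj (cinner (\<pi> x f) g))
      (complex_of_real (inverse d) * cinner f f * cnj (cinner g g))"
    using formal by (auto simp: formal_dimension_def)
  from has_bochner_integral_bounded_linear[OF bounded_linear_Re this]
  have "has_bochner_integral \<mu> (\<lambda>x. (cmod (cinner (\<pi> x f) g))\<^sup>2) ((norm f)\<^sup>2 * (norm g)\<^sup>2 / d)"
    by (simp add: cinner_self complex_norm_square[symmetric] divide_inverse mult_ac
        del: of_real_power of_real_inverse of_real_mult flip: of_real_mult)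
  then show ?thesis
    by (subst nn_integral_eq_integral) (auto simp: has_bochner_integral_iff)
qed

lemma nn_integral_coef:
  assumes u: "bessel u"
  shows "(\<integral>\<^sup>+\<gamma>. ennreal ((cmod (cinner (inv (\<pi> \<omega>) f) (\<pi> \<gamma> u)))\<^sup>2) \<partial>count_space \<Gamma>)
    = ennreal ((norm (coef u (inv (\<pi> \<omega>) f)))\<^sup>2)"
proof -
  let ?f = "inv (\<pi> \<omega>) f"
  let ?a = "\<lambda>\<gamma>. (cmod (cinner ?f (\<pi> \<gamma> u)))\<^sup>2"
  have "?a summable_on \<Gamma>"
    by (rule summable_on_cong_neutral[THEN iffD1, OF _ _ _ ell2_summable[of "coef u ?f"]])
      (auto simp: Rep_coef u)
  then have s: "Infinite_Set_Sum.abs_summable_on ?a \<Gamma>" by (subst abs_summable_equivalent[symmetric]) simp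
  have "(norm (coef u ?f))\<^sup>2 = infsum ?a \<Gamma>"
    unfolding ell2_norm_sq by (rule infsum_cong_neutral) (auto simp: Rep_coef u)
  then show ?thesis
    using nn_integral_conv_infsetsum[OF s] infsetsum_infsum[OF s] by simp
qed

lemma cmod_cinner_translate:
  "cmod (cinner f (\<pi> (\<omega> + \<gamma>) u)) = cmod (cinner (inv (\<pi> \<omega>) f) (\<pi> \<gamma> u))"
  by (simp add: pi_sum cinner_simps norm_mult cmod_sigma flip: cinner_pi_right)

text \<open>The orthogonality relations folded onto \<Omega>. Two vectors are carried along because
  the applications compare sums of squares; \<open>v = 0\<close> covers a single one.\<close>

lemma nn_integral_coef_sum:
  assumes u: "bessel u" and v: "bessel v"
  shows "(\<integral>\<^sup>+\<omega>. ennreal ((norm (coef u (inv (\<pi> \<omega>) f)))\<^sup>2 + (norm (coef v (inv (\<pi> \<omega>) f)))\<^sup>2) * indicator \<Omega> \<omega> \<partial>\<mu>)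
    = ennreal ((norm f)\<^sup>2 * ((norm u)\<^sup>2 + (norm v)\<^sup>2) / d)"
proof -
  let ?F = "\<lambda>x. ennreal ((cmod (cinner f (\<pi> x u)))\<^sup>2) + ennreal ((cmod (cinner f (\<pi> x v)))\<^sup>2)"
  have "(\<integral>\<^sup>+x. ?F x \<partial>\<mu>) = (\<integral>\<^sup>+x. ennreal ((cmod (cinner f (\<pi> x u)))\<^sup>2) \<partial>\<mu>) + (\<integral>\<^sup>+x. ennreal ((cmod (cinner f (\<pi> x v)))\<^sup>2) \<partial>\<mu>)"
    by (intro nn_integral_add measurable_mu) measurable
  also have "\<dots> = (\<integral>\<^sup>+x. ennreal ((cmod (cinner (\<pi> x u) f))\<^sup>2) \<partial>\<mu>) + (\<integral>\<^sup>+x. ennreal ((cmod (cinner (\<pi> x v) f))\<^sup>2) \<partial>\<mu>)"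
    by (simp add: cinner_commute[of f])
  also have "\<dots> = ennreal ((norm f)\<^sup>2 * ((norm u)\<^sup>2 + (norm v)\<^sup>2) / d)"
    unfolding nn_integral_pi using d_pos
    by (simp add: distrib_left add_divide_distrib mult.commute flip: ennreal_plus)
  finally have 1: "(\<integral>\<^sup>+x. ?F x \<partial>\<mu>) = ennreal ((norm f)\<^sup>2 * ((norm u)\<^sup>2 + (norm v)\<^sup>2) / d)" .
  have "(\<integral>\<^sup>+x. ?F x \<partial>\<mu>) = (\<integral>\<^sup>+\<omega>. (\<integral>\<^sup>+\<gamma>. ?F (\<omega> + \<gamma>) \<partial>count_space \<Gamma>) * indicator \<Omega> \<omega> \<partial>\<mu>)"
    by (rule nn_integral_unfold[OF sets_mu right_inv subgroup countable fd]) measurable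
  also have "\<dots> = (\<integral>\<^sup>+\<omega>. ennreal ((norm (coef u (inv (\<pi> \<omega>) f)))\<^sup>2 + (norm (coef v (inv (\<pi> \<omega>) f)))\<^sup>2) * indicator \<Omega> \<omega> \<partial>\<mu>)"
    by (simp add: cmod_cinner_translate nn_integral_add nn_integral_coef u v)
  finally show ?thesis using 1 by simp
qed

lemma nn_integral_norm:
  "(\<integral>\<^sup>+\<omega>. ennreal ((norm (inv (\<pi> \<omega>) f))\<^sup>2) * indicator \<Omega> \<omega> \<partial>\<mu>) = ennreal ((norm f)\<^sup>2 * measure \<mu> \<Omega>)"
proof -
  have n: "norm (inv (\<pi> \<omega>) f) = norm f" for \<omega> by (metis norm_pi pi_inv)
  have "(\<integral>\<^sup>+\<omega>. ennreal ((norm f)\<^sup>2) * indicator \<Omega> \<omega> \<partial>\<mu>) = ennreal ((norm f)\<^sup>2) * emeasure \<mu> \<Omega>"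
    by (rule nn_integral_cmult_indicator) (simp add: sets_mu)
  also have "emeasure \<mu> \<Omega> = ennreal (measure \<mu> \<Omega>)"
    using fd by (intro emeasure_eq_ennreal_measure) (auto simp: fundamental_domain_def)
  finally show ?thesis by (simp add: n ennreal_mult')
qed

text \<open>The pointwise bound is integrated over \<Omega>. A nonzero v next to u is what later
  makes the density inequality strict.\<close>

lemma density_le:
  assumes u: "bessel u" and v: "bessel v" and nontriv: "(UNIV :: 'h set) \<noteq> {0}"
    and le: "\<And>f. (norm (coef u f))\<^sup>2 + (norm (coef v f))\<^sup>2 \<le> (norm f)\<^sup>2"
  shows "(norm u)\<^sup>2 + (norm v)\<^sup>2 \<le> measure \<mu> \<Omega> * d"
proof -
  obtain f :: 'h where f: "f \<noteq> 0" using nontriv by auto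
  have "ennreal ((norm f)\<^sup>2 * ((norm u)\<^sup>2 + (norm v)\<^sup>2) / d) \<le> ennreal ((norm f)\<^sup>2 * measure \<mu> \<Omega>)"
    unfolding nn_integral_coef_sum[OF u v, symmetric] nn_integral_norm[symmetric]
    by (intro nn_integral_mono mult_right_mono ennreal_leI le) auto
  then have "(norm f)\<^sup>2 * ((norm u)\<^sup>2 + (norm v)\<^sup>2) / d \<le> (norm f)\<^sup>2 * measure \<mu> \<Omega>"
    by (simp add: ennreal_le_iff)
  then have "(norm f)\<^sup>2 * ((norm u)\<^sup>2 + (norm v)\<^sup>2) \<le> (norm f)\<^sup>2 * (measure \<mu> \<Omega> * d)"
    using d_pos by (simp add: divide_le_eq mult.assoc)
  then show ?thesis using f by (simp add: mult_le_cancel_left_pos)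
qed

lemma density_eq:
  assumes u: "bessel u" and nontriv: "(UNIV :: 'h set) \<noteq> {0}"
    and eq: "\<And>f. norm (coef u f) = norm f"
  shows "(norm u)\<^sup>2 = measure \<mu> \<Omega> * d"
proof -
  obtain f :: 'h where f: "f \<noteq> 0" using nontriv by auto
  have "ennreal ((norm f)\<^sup>2 * (norm u)\<^sup>2 / d) = ennreal ((norm f)\<^sup>2 * measure \<mu> \<Omega>)"
    using nn_integral_coef_sum[OF u bessel_0, of f] nn_integral_norm[of f] by (simp add: eq)
  then have "(norm f)\<^sup>2 * (norm u)\<^sup>2 / d = (norm f)\<^sup>2 * measure \<mu> \<Omega>"
    using d_pos by (subst (asm) ennreal_inj) auto
  then show ?thesis using f d_pos by (simp add: field_simps)
qed

text \<open>The vanishing pairing is Pythagoras in \<open>ell2\<close> for the coefficients of h and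
  of multiples of w; integrated over \<Omega> it becomes Pythagoras for the vectors
  themselves.\<close>

lemma orthogonal_if_pairing_zero:
  assumes h: "bessel h" and w: "bessel w" and p0: "\<And>f. pairing h w f = 0"
  shows "cinner h w = 0"
proof (cases "h = 0")
  case False
  have Re0: "Re (cinner h (a *\<^sub>C w)) = 0" for a
  proof -
    let ?w = "a *\<^sub>C w"
    have bw: "bessel ?w" and bs: "bessel (h + ?w)" by (simp_all add: h w bessel_scaleC bessel_add)
    have "cinner (coef h f) (coef w f) = 0" for f
      using cinner_pairing[OF h w, of f f] p0 by simp
    then have eq: "(norm (coef (h + ?w) f))\<^sup>2 = (norm (coef h f))\<^sup>2 + (norm (coef ?w f))\<^sup>2" for f
      by (simp add: coef_add_left h bw norm_add_sq coef_scaleC_left w cinner_simps)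
    have "ennreal ((norm h)\<^sup>2 * (norm (h + ?w))\<^sup>2 / d) = ennreal ((norm h)\<^sup>2 * ((norm h)\<^sup>2 + (norm ?w)\<^sup>2) / d)"
      using nn_integral_coef_sum[OF bs bessel_0, of h] nn_integral_coef_sum[OF h bw, of h] by (simp add: eq)
    then have "(norm h)\<^sup>2 * (norm (h + ?w))\<^sup>2 / d = (norm h)\<^sup>2 * ((norm h)\<^sup>2 + (norm ?w)\<^sup>2) / d"
      using d_pos by (subst (asm) ennreal_inj) auto
    then have "(norm (h + ?w))\<^sup>2 = (norm h)\<^sup>2 + (norm ?w)\<^sup>2" using False d_pos by simp
    then show ?thesis by (simp add: norm_add_sq)
  qed
  show ?thesis using Re0[of 1] Re0[of \<i>] by (simp add: cinner_simps complex_eq_iff)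
qed simp

end

section \<open>Totality of the Bessel vectors\<close>

context lattice_orbit
begin

lemma sum_indicator_translates_le:
  assumes "finite F" "F \<subseteq> \<Gamma>"
  shows "(\<Sum>\<gamma>\<in>F. a * indicator \<Omega> (x + \<gamma>)) \<le> (a :: ennreal)"
proof -
  obtain \<gamma>0 where "\<And>\<gamma>. \<gamma> \<in> \<Gamma> \<Longrightarrow> x + \<gamma> \<in> \<Omega> \<Longrightarrow> \<gamma> = \<gamma>0"
    using fundamental_domain_unique[OF subgroup fd, of x] by blast
  then have "(\<Sum>\<gamma>\<in>F. a * indicator \<Omega> (x + \<gamma>)) \<le> (\<Sum>\<gamma>\<in>F. if \<gamma> = \<gamma>0 then a else 0)"
    using assms(2) by (intro sum_mono) (auto simp: indicator_def)
  also have "\<dots> \<le> a" using assms(1) by simp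
  finally show ?thesis .
qed

text \<open>The right translates of \<Omega> by inverses of the elements of F are disjoint, so these
  integrals are pieces of a single integral over G.\<close>

lemma sum_nn_integral_translates_le:
  assumes F: "finite F" "F \<subseteq> \<Gamma>"
  shows "(\<Sum>\<gamma>\<in>F. \<integral>\<^sup>+\<omega>. ennreal ((cmod (cinner (\<pi> \<omega> (inv (\<pi> \<gamma>) f)) g))\<^sup>2) * indicator \<Omega> \<omega> \<partial>\<mu>)
    \<le> ennreal ((norm f)\<^sup>2 * (norm g)\<^sup>2 / d)"
proof -
  let ?e = "\<lambda>x. ennreal ((cmod (cinner (\<pi> x f) g))\<^sup>2)"
  have "(\<integral>\<^sup>+\<omega>. ennreal ((cmod (cinner (\<pi> \<omega> (inv (\<pi> \<gamma>) f)) g))\<^sup>2) * indicator \<Omega> \<omega> \<partial>\<mu>)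
      = (\<integral>\<^sup>+x. ?e x * indicator \<Omega> (x + \<gamma>) \<partial>\<mu>)" for \<gamma>
  proof -
    have "(\<integral>\<^sup>+x. ?e (x + \<gamma> + - \<gamma>) * indicator \<Omega> (x + \<gamma>) \<partial>\<mu>) = (\<integral>\<^sup>+\<omega>. ?e (\<omega> + - \<gamma>) * indicator \<Omega> \<omega> \<partial>\<mu>)"
      by (rule nn_integral_right_translate[OF sets_mu right_inv, of "\<lambda>x. ?e (x + - \<gamma>) * indicator \<Omega> x"]) measurable
    moreover have "?e (\<omega> + - \<gamma>) = ennreal ((cmod (cinner (\<pi> \<omega> (inv (\<pi> \<gamma>) f)) g))\<^sup>2)" for \<omega>
      by (simp add: inv_pi pi_scaleC pi_pi cinner_simps norm_mult cmod_sigma del: pi_inv)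
    ultimately show ?thesis by (simp add: add.assoc)
  qed
  then have "(\<Sum>\<gamma>\<in>F. \<integral>\<^sup>+\<omega>. ennreal ((cmod (cinner (\<pi> \<omega> (inv (\<pi> \<gamma>) f)) g))\<^sup>2) * indicator \<Omega> \<omega> \<partial>\<mu>)
      = (\<Sum>\<gamma>\<in>F. \<integral>\<^sup>+x. ?e x * indicator \<Omega> (x + \<gamma>) \<partial>\<mu>)" by simp
  also have "\<dots> = (\<integral>\<^sup>+x. (\<Sum>\<gamma>\<in>F. ?e x * indicator \<Omega> (x + \<gamma>)) \<partial>\<mu>)"
    by (rule nn_integral_sum[symmetric]) (intro measurable_mu, measurable)
  also have "\<dots> \<le> (\<integral>\<^sup>+x. ?e x \<partial>\<mu>)"
    by (intro nn_integral_mono sum_indicator_translates_le F)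
  finally show ?thesis by (simp only: nn_integral_pi)
qed

text \<open>b is the weak integral over \<Omega> of <\<pi> \<omega> f0, g> times the adjoint of
  \<pi> \<omega> applied to g. Cauchy-Schwarz splits off a factor depending on f0 only, and the
  remaining integrals, summed along the orbit, are controlled by packing.\<close>

lemma exists_bessel:
  obtains b where "bessel b"
    "\<And>f. cinner f b = (LINT \<omega>|\<mu>. indicator \<Omega> \<omega> *\<^sub>R (cinner (\<pi> \<omega> f) g * cnj (cinner (\<pi> \<omega> f0) g)))"
proof -
  let ?i = "\<lambda>f \<omega>. indicator \<Omega> \<omega> *\<^sub>R (cinner (\<pi> \<omega> f) g * cnj (cinner (\<pi> \<omega> f0) g))"
  let ?P = "\<lambda>f. \<integral>\<^sup>+\<omega>. ennreal ((cmod (cinner (\<pi> \<omega> f) g))\<^sup>2) * indicator \<Omega> \<omega> \<partial>\<mu>"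
  define K where "K = (norm f0)\<^sup>2 * (norm g)\<^sup>2 / d"
  define L where "L = (norm g)\<^sup>2 / d"
  have KL: "K \<ge> 0" "L \<ge> 0" using d_pos by (simp_all add: K_def L_def)
  have int: "integrable \<mu> (?i f)" for f
    by (rule integrable_mult_indicator[OF _ integrable_pi]) (simp add: sets_mu)
  define \<phi> where "\<phi> f = integral\<^sup>L \<mu> (?i f)" for f
  have CS: "ennreal ((cmod (\<phi> f))\<^sup>2) \<le> ?P f * ennreal K" for f
  proof -
    let ?p = "\<lambda>\<omega>. ennreal (cmod (cinner (\<pi> \<omega> f) g)) * indicator \<Omega> \<omega>"
      and ?q = "\<lambda>\<omega>. ennreal (cmod (cinner (\<pi> \<omega> f0) g))"
    have "ennreal (cmod (\<phi> f)) \<le> (\<integral>\<^sup>+\<omega>. ennreal (cmod (?i f \<omega>)) \<partial>\<mu>)"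
      unfolding \<phi>_def by (rule integral_norm_bound_ennreal[OF int])
    also have "\<dots> = (\<integral>\<^sup>+\<omega>. ?p \<omega> * ?q \<omega> \<partial>\<mu>)"
      by (intro nn_integral_cong) (auto simp: indicator_def norm_mult ennreal_mult)
    finally have "(ennreal (cmod (\<phi> f)))\<^sup>2 \<le> (\<integral>\<^sup>+\<omega>. ?p \<omega> * ?q \<omega> \<partial>\<mu>)\<^sup>2" by (rule power_mono) simp
    also have "\<dots> \<le> (\<integral>\<^sup>+\<omega>. (?p \<omega>)\<^sup>2 \<partial>\<mu>) * (\<integral>\<^sup>+\<omega>. (?q \<omega>)\<^sup>2 \<partial>\<mu>)"
      by (rule Cauchy_Schwarz_nn_integral) (intro measurable_mu, measurable)+
    also have "(\<integral>\<^sup>+\<omega>. (?p \<omega>)\<^sup>2 \<partial>\<mu>) = ?P f"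
      by (intro nn_integral_cong) (auto simp: indicator_def ennreal_power)
    also have "(\<integral>\<^sup>+\<omega>. (?q \<omega>)\<^sup>2 \<partial>\<mu>) = ennreal K"
      by (simp only: ennreal_power norm_ge_zero nn_integral_pi K_def)
    finally show ?thesis by (simp add: ennreal_power)
  qed
  have P_le: "?P f \<le> ennreal (L * (norm f)\<^sup>2)" for f
  proof -
    have "?P f \<le> (\<integral>\<^sup>+\<omega>. ennreal ((cmod (cinner (\<pi> \<omega> f) g))\<^sup>2) \<partial>\<mu>)"
      by (intro nn_integral_mono) (auto simp: indicator_def)
    then show ?thesis by (simp add: nn_integral_pi L_def mult.commute)
  qed
  obtain b where b: "\<And>f. \<phi> f = cinner f b"
  proof (rule riesz_representation[of \<phi> "sqrt (L * K)"])
    show "\<phi> (x + y) = \<phi> x + \<phi> y" for x y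
      using Bochner_Integration.integral_add[OF int[of x] int[of y]]
      by (simp add: \<phi>_def pi_add cinner_simps algebra_simps)
    show "\<phi> (a *\<^sub>C x) = a * \<phi> x" for a x
      by (simp add: \<phi>_def pi_scaleC cinner_simps mult.assoc flip: integral_mult_right_zero)
    show "cmod (\<phi> x) \<le> sqrt (L * K) * norm x" for x
    proof (rule power2_le_imp_le)
      have "ennreal ((cmod (\<phi> x))\<^sup>2) \<le> ennreal (L * (norm x)\<^sup>2) * ennreal K"
        using CS[of x] mult_right_mono[OF P_le[of x], of "ennreal K"] order_trans by simp
      then have "(cmod (\<phi> x))\<^sup>2 \<le> L * (norm x)\<^sup>2 * K"
        using KL by (simp flip: ennreal_mult)
      then show "(cmod (\<phi> x))\<^sup>2 \<le> (sqrt (L * K) * norm x)\<^sup>2"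
        using KL by (simp add: power_mult_distrib mult_ac)
    qed (use KL in simp)
  qed blast
  have "bbound (L * K) b"
    unfolding bbound_def
  proof (intro allI impI)
    fix f F assume F: "finite F \<and> F \<subseteq> \<Gamma>"
    have "ennreal (\<Sum>\<gamma>\<in>F. (cmod (cinner f (\<pi> \<gamma> b)))\<^sup>2) = (\<Sum>\<gamma>\<in>F. ennreal ((cmod (\<phi> (inv (\<pi> \<gamma>) f)))\<^sup>2))"
      by (simp add: cinner_pi_right b)
    also have "\<dots> \<le> (\<Sum>\<gamma>\<in>F. ?P (inv (\<pi> \<gamma>) f) * ennreal K)" by (intro sum_mono CS)
    also have "\<dots> = (\<Sum>\<gamma>\<in>F. ?P (inv (\<pi> \<gamma>) f)) * ennreal K" by (rule sum_distrib_right[symmetric])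
    also have "\<dots> \<le> ennreal ((norm f)\<^sup>2 * (norm g)\<^sup>2 / d) * ennreal K"
      using F by (intro mult_right_mono sum_nn_integral_translates_le) auto
    also have "\<dots> = ennreal (L * K * (norm f)\<^sup>2)"
      using KL d_pos by (simp add: L_def mult_ac flip: ennreal_mult)
    finally show "(\<Sum>\<gamma>\<in>F. (cmod (cinner f (\<pi> \<gamma> b)))\<^sup>2) \<le> L * K * (norm f)\<^sup>2"
      using KL by (subst (asm) ennreal_le_iff) auto
  qed
  then show thesis using that[of b] b by (simp add: bbound_bessel \<phi>_def)
qed

text \<open>Choosing g = f and f0 = \<pi> \<gamma> f in \<open>exists_bessel\<close> makes the
  matrix coefficient of f vanish in square mean on each translate of \<Omega>. By unfolding it
  vanishes on G, and the orthogonality relations give f = 0.\<close>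

lemma bessel_dense:
  assumes f: "\<And>h. bessel h \<Longrightarrow> cinner h f = 0"
  shows "f = 0"
proof -
  have 0: "(\<integral>\<^sup>+\<omega>. ennreal ((cmod (cinner (\<pi> (\<omega> + \<gamma>) f) f))\<^sup>2) * indicator \<Omega> \<omega> \<partial>\<mu>) = 0" if \<gamma>: "\<gamma> \<in> \<Gamma>" for \<gamma>
  proof -
    let ?f = "\<pi> \<gamma> f"
    obtain b where b: "bessel b" "\<And>f'. cinner f' b = (LINT \<omega>|\<mu>. indicator \<Omega> \<omega> *\<^sub>R (cinner (\<pi> \<omega> f') f * cnj (cinner (\<pi> \<omega> ?f) f)))"
      using exists_bessel[of f ?f] by blast
    let ?r = "\<lambda>\<omega>. indicator \<Omega> \<omega> * (cmod (cinner (\<pi> \<omega> ?f) f))\<^sup>2"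
    have int: "integrable \<mu> (\<lambda>\<omega>. indicator \<Omega> \<omega> *\<^sub>R (cinner (\<pi> \<omega> ?f) f * cnj (cinner (\<pi> \<omega> ?f) f)))"
      by (rule integrable_mult_indicator[OF _ integrable_pi]) (simp add: sets_mu)
    have r: "indicator \<Omega> \<omega> *\<^sub>R (cinner (\<pi> \<omega> ?f) f * cnj (cinner (\<pi> \<omega> ?f) f)) = complex_of_real (?r \<omega>)" for \<omega>
      by (simp only: complex_norm_square[symmetric] scaleR_conv_of_real of_real_mult)
    \<comment> \<open>The translate of b is again Bessel, so orthogonality of f to it becomes
      orthogonality of \<pi> \<gamma> f to b.\<close>
    have "cinner (inv (\<pi> \<gamma>) b) f = 0" using f bessel_inv_pi[OF b(1) \<gamma>] by blast
    then have "cinner ?f b = 0" by (metis cinner_eq_zero_commute cinner_pi_right)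
    then have "complex_of_real (integral\<^sup>L \<mu> ?r) = 0" unfolding b(2) r integral_complex_of_real .
    then have I0: "integral\<^sup>L \<mu> ?r = 0" using of_real_eq_0_iff by blast
    have "integrable \<mu> ?r" using int unfolding r by (rule complex_of_real_integrable_eq[THEN iffD1])
    from nn_integral_eq_integral[OF this] have "(\<integral>\<^sup>+\<omega>. ennreal (?r \<omega>) \<partial>\<mu>) = 0" by (simp add: I0)
    moreover have "ennreal (?r \<omega>) = ennreal ((cmod (cinner (\<pi> (\<omega> + \<gamma>) f) f))\<^sup>2) * indicator \<Omega> \<omega>" for \<omega>
      by (simp add: pi_pi cinner_simps norm_mult cmod_sigma indicator_def)
    ultimately show ?thesis by simp
  qed
  have "(\<integral>\<^sup>+x. ennreal ((cmod (cinner (\<pi> x f) f))\<^sup>2) \<partial>\<mu>)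
      = (\<integral>\<^sup>+\<gamma>. (\<integral>\<^sup>+\<omega>. ennreal ((cmod (cinner (\<pi> (\<omega> + \<gamma>) f) f))\<^sup>2) * indicator \<Omega> \<omega> \<partial>\<mu>) \<partial>count_space \<Gamma>)"
    by (rule nn_integral_unfold_sum[OF sets_mu right_inv subgroup countable fd]) measurable
  also have "\<dots> = (\<integral>\<^sup>+\<gamma>. 0 \<partial>count_space \<Gamma>)" by (rule nn_integral_cong) (simp add: 0)
  finally have "ennreal ((norm f)\<^sup>2 * (norm f)\<^sup>2 / d) = 0" by (simp only: nn_integral_pi nn_integral_const) simp
  then have "(norm f)\<^sup>2 * (norm f)\<^sup>2 / d \<le> 0" by (simp only: ennreal_eq_0_iff)
  then show ?thesis using d_pos by (simp add: divide_le_0_iff mult_le_0_iff)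
qed

end

section \<open>The three density regimes\<close>

locale kleppner_lattice_orbit = lattice_orbit +
  assumes klep: "kleppner_condition \<sigma> \<Gamma>"
    and nontriv: "(UNIV :: 'b set) \<noteq> {0}"
begin

lemma obtain_polar_part:
  obtains u where "kleppner_polar_part \<Gamma> \<sigma> \<pi> k u"
proof -
  obtain u where u: "bbound 1 u" "\<And>g. bbound 1 g \<Longrightarrow> Re (cinner g k) \<le> Re (cinner u k)"
    "\<And>h. bbound 1 (u + h) \<Longrightarrow> bbound 1 (u - h) \<Longrightarrow> h = 0"
    using bessel_extremal_maximizer by blast
  have "kleppner_polar_part \<Gamma> \<sigma> \<pi> k u"
    by unfold_locales (use u klep nontriv bessel_dense in blast)+
  then show thesis by (rule that)
qed

lemma polar_part_cases:
  assumes "kleppner_polar_part \<Gamma> \<sigma> \<pi> k u"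
  shows "(\<forall>f. pairing u u f = f) \<and> (norm u)\<^sup>2 = measure \<mu> \<Omega> * d \<and> measure \<mu> \<Omega> * d \<le> 1
    \<or> \<not> (\<forall>f. pairing u u f = f) \<and> norm u = 1 \<and> measure \<mu> \<Omega> * d > 1"
proof -
  interpret P: kleppner_polar_part \<Gamma> \<sigma> \<pi> k u by fact
  show ?thesis
  proof (cases "\<forall>f. pairing u u f = f")
    case True
    have "norm (coef u f) = norm f" for f
      using P.coef_u_sq[of f] True by (simp add: power2_eq_iff_nonneg)
    then have "(norm u)\<^sup>2 = measure \<mu> \<Omega> * d" by (rule density_eq[OF P.bessel_u nontriv])
    moreover have "(norm u)\<^sup>2 \<le> 1" using bbound_1_norm[OF P.bb] by (simp add: power_le_one)
    ultimately show ?thesis using True by simp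
  next
    case False
    then obtain f where f: "pairing u u f \<noteq> f" by blast
    obtain v where v: "bessel v" "v \<noteq> 0" "pairing u u v = 0" using P.dichotomy(2)[OF f] by blast
    obtain t where t: "t > 0" "\<And>f. (norm (coef u f))\<^sup>2 + (norm (t *\<^sub>R coef v f))\<^sup>2 \<le> (norm f)\<^sup>2"
      using P.corner_contraction[OF v(1,3)] by blast
    \<comment> \<open>u already has norm 1, so the nonzero multiple of v that fits beside it pushes
      the density strictly above 1.\<close>
    have "(norm u)\<^sup>2 + (norm (t *\<^sub>R v))\<^sup>2 \<le> measure \<mu> \<Omega> * d"
      using t(2) v(1) by (intro density_le nontriv P.bessel_u) (auto simp: bessel_scaleR coef_scaleR_left)
    moreover have "(norm (t *\<^sub>R v))\<^sup>2 > 0" using t v by simp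
    moreover have u1: "norm u = 1" using P.dichotomy(1)[OF f] .
    ultimately have "measure \<mu> \<Omega> * d > 1" by (simp only: u1 one_power2)
    with False u1 show ?thesis by blast
  qed
qed

text \<open>k is an arbitrary candidate, refuted by means of its own polar part.\<close>

lemma subcritical:
  assumes "measure \<mu> \<Omega> * d < 1"
  shows "\<exists>g. parseval_frame \<pi> \<Gamma> g"
    "\<not> separating_vector (commutant (commutant (\<pi> ` \<Gamma>))) k" "\<not> riesz_sequence \<pi> \<Gamma> k"
proof -
  obtain u where u: "kleppner_polar_part \<Gamma> \<sigma> \<pi> k u" using obtain_polar_part by blast
  interpret P: kleppner_polar_part \<Gamma> \<sigma> \<pi> k u by fact
  have X: "\<forall>f. pairing u u f = f" "(norm u)\<^sup>2 < 1" using polar_part_cases[OF u] assms by auto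
  then have n: "norm u \<noteq> 1" by auto
  show "\<exists>g. parseval_frame \<pi> \<Gamma> g" using P.parseval_if_X_id X by blast
  show "\<not> separating_vector (commutant (commutant (\<pi> ` \<Gamma>))) k" using P.unit_if_separating n by blast
  show "\<not> riesz_sequence \<pi> \<Gamma> k" using P.unit_if_riesz orthogonal_if_pairing_zero n by blast
qed

lemma critical:
  assumes "measure \<mu> \<Omega> * d = 1"
  shows "\<exists>g. orthonormal_basis \<pi> \<Gamma> g"
proof -
  \<comment> \<open>No candidate has to be excluded here, so k = 0 is taken and extremality alone
    does the work.\<close>
  obtain u where u: "kleppner_polar_part \<Gamma> \<sigma> \<pi> 0 u" using obtain_polar_part by blast
  interpret P: kleppner_polar_part \<Gamma> \<sigma> \<pi> 0 u by fact
  have X: "\<forall>f. pairing u u f = f" "(norm u)\<^sup>2 = 1" using polar_part_cases[OF u] assms by auto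
  then have "norm u = 1" by (metis norm_ge_zero real_sqrt_abs abs_of_nonneg real_sqrt_one)
  then show ?thesis
    using unit_orthonormal[OF P.bb] P.orbit_total_if_X_id X by (auto simp: orthonormal_basis_def)
qed

lemma supercritical:
  assumes "measure \<mu> \<Omega> * d > 1"
  shows "\<exists>g. orthonormal_system \<pi> \<Gamma> g" "\<not> cyclic_vector \<pi> \<Gamma> k" "\<not> frame \<pi> \<Gamma> k"
proof -
  obtain u where u: "kleppner_polar_part \<Gamma> \<sigma> \<pi> k u" using obtain_polar_part by blast
  interpret P: kleppner_polar_part \<Gamma> \<sigma> \<pi> k u by fact
  have X: "\<not> (\<forall>f. pairing u u f = f)" "norm u = 1" using polar_part_cases[OF u] assms by auto
  show "\<exists>g. orthonormal_system \<pi> \<Gamma> g" using unit_orthonormal[OF P.bb X(2)] by blast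
  show c: "\<not> cyclic_vector \<pi> \<Gamma> k" using P.X_id_if_cyclic X(1) by blast
  show "\<not> frame \<pi> \<Gamma> k" using cyclic_if_frame c by blast
qed

end

theorem theorem8p1:
  fixes \<mu> :: "'g::{topological_group_add, t2_space, second_countable_topology} measure"
    and \<Gamma> :: "'g set"
    and \<sigma> :: "'g \<Rightarrow> 'g \<Rightarrow> complex"
    and \<pi> :: "'g \<Rightarrow> 'h \<Rightarrow> 'h::{chilbert_space, second_countable_topology}"
    and d :: real
  assumes "locally_compact_space (euclidean :: 'g topology)"
    and "unimodular TYPE('g)"
    and "haar_measure \<mu>"
    and "lattice_in \<mu> \<Gamma>"
    and "cocycle \<sigma>"
    and "discrete_series_rep \<mu> \<sigma> \<pi>"
    and "formal_dimension \<mu> \<pi> d"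
    and "kleppner_condition \<sigma> \<Gamma>"
  shows "(covolume \<mu> \<Gamma> * d < 1 \<longrightarrow>
            (\<exists>g. parseval_frame \<pi> \<Gamma> g)
            \<and> \<not> (\<exists>g. separating_vector (commutant (commutant (\<pi> ` \<Gamma>))) g)
            \<and> \<not> (\<exists>g. riesz_sequence \<pi> \<Gamma> g))
       \<and> (covolume \<mu> \<Gamma> * d = 1 \<longrightarrow> (\<exists>g. orthonormal_basis \<pi> \<Gamma> g))
       \<and> (covolume \<mu> \<Gamma> * d > 1 \<longrightarrow>
            (\<exists>g. orthonormal_system \<pi> \<Gamma> g)
            \<and> \<not> (\<exists>g. cyclic_vector \<pi> \<Gamma> g)
            \<and> \<not> (\<exists>g. frame \<pi> \<Gamma> g))"
proof -
  have sets: "sets \<mu> = sets borel" using assms(3) by (simp add: haar_measure_def radon_measure_def)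
  have right: "right_invariant \<mu>" using assms(2,3) by (simp add: unimodular_def)
  obtain \<Omega> where sub: "is_subgroup \<Gamma>" and disc: "discrete \<Gamma>" and \<Omega>: "fundamental_domain \<mu> \<Gamma> \<Omega>"
    using assms(4) by (auto simp: lattice_in_def)
  have cnt: "countable \<Gamma>" using disc by (rule countable_if_discrete)
  have rep: "projective_rep \<sigma> \<pi>" and irr: "irreducible_rep \<pi>"
    using assms(6) by (auto simp: discrete_series_rep_def)
  interpret kleppner_lattice_orbit \<Gamma> \<sigma> \<pi> \<mu> \<Omega> d
    using sub rep assms(5,7,8) sets right \<Omega> cnt irr
    by unfold_locales (auto simp: projective_rep_def cocycle_def irreducible_rep_def)
  have "covolume \<mu> \<Gamma> = measure \<mu> \<Omega>" by (rule covolume_eq[OF sets right sub cnt \<Omega>])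
  then show ?thesis using subcritical critical supercritical by auto
qed

end
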